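(* Gap rigidity fails for the pair $(\Delta^2,\Delta\times\{0\})$, where $\Delta\subset\mathbb C$ is the unit disk and $\Delta\times\{0\}\subset\Delta^2$ is the standard totally geodesic embedding. That is: for every $\epsilon>0$ there exist a torsion-free discrete group $\Gamma$ of biholomorphic automorphisms of $\Delta^2$ and a compact complex curve $S\subset X=\Delta^2/\Gamma$ which is $\epsilon$-geodesic and modeled on $(\Delta^2,\Delta\times\{0\})$, but which is not totally geodesic.
   Context: Let $\Omega$ be a bounded symmetric domain equipped with a canonical (invariant Kähler–Einstein) metric, here $\Delta^2$ with the product of Poincaré metrics, and let $i:D\hookrightarrow\Omega$ be a totally geodesic holomorphic embedding of a bounded symmetric domain $D$. For $X=\Omega/\Gamma$, $\Gamma$ a torsion-free discrete group of automorphisms, a compact complex submanifold $S\subset X$ is called $\epsilon$-geodesic if the norm of its second fundamental form in $X$ is uniformly bounded by $\epsilon$. For $\epsilon$ small such an $S$ locally resembles exactly one model $(\Omega,D;i)$ (up to $\mathrm{Aut}(\Omega)$); $S$ is said to be modeled on $(\Omega,D;i)$ if, for every point of a lift $\widetilde S\subset\Omega$ of $S$, after moving that point to a base point by an automorphism of $\Omega$, the piece of $\widetilde S$ in a fixed geodesic ball is close (as complex-analytic subvarieties) to the corresponding piece of $i(D)$. Gap rigidity holds for $(\Omega,D;i)$ if there is $\epsilon>0$ such that for every such $X$, every $\epsilon$-geodesic compact complex submanifold $S\subset X$ modeled on $(\Omega,D;i)$ is totally geodesic. *)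

theory Defs
  imports "HOL-Analysis.Analysis"
begin

definition bidisc :: "(complex \<times> complex) set" where
  "bidisc = {(z, w). cmod z < 1 \<and> cmod w < 1}"

definition cscale :: "complex \<Rightarrow> complex \<times> complex \<Rightarrow> complex \<times> complex" where
  "cscale c v = (c * fst v, c * snd v)"

definition holo2 :: "(complex \<times> complex \<Rightarrow> complex \<times> complex) \<Rightarrow> (complex \<times> complex) set \<Rightarrow> bool" where
  "holo2 f U \<longleftrightarrow> (\<forall>x\<in>U. \<exists>D. (f has_derivative D) (at x) \<and>
                      (\<forall>v. D (cscale \<i> v) = cscale \<i> (D v)))"

definition bidisc_aut :: "(complex \<times> complex \<Rightarrow> complex \<times> complex) \<Rightarrow> bool" where
  "bidisc_aut f \<longleftrightarrow> holo2 f bidisc \<and> bij_betw f bidisc bidisc \<and>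
     (\<exists>g. holo2 g bidisc \<and> (\<forall>x\<in>bidisc. g (f x) = x \<and> f (g x) = x))"

definition aut_group :: "(complex \<times> complex \<Rightarrow> complex \<times> complex) set \<Rightarrow> bool" where
  "aut_group G \<longleftrightarrow> (\<forall>g\<in>G. bidisc_aut g) \<and>
     (\<exists>e\<in>G. \<forall>x\<in>bidisc. e x = x) \<and>
     (\<forall>g\<in>G. \<forall>h\<in>G. \<exists>k\<in>G. \<forall>x\<in>bidisc. k x = g (h x)) \<and>
     (\<forall>g\<in>G. \<exists>h\<in>G. \<forall>x\<in>bidisc. h (g x) = x \<and> g (h x) = x)"

text \<open>Discreteness (for automorphism groups of bounded domains equivalent to
  proper discontinuity of the action): every compact subset meets only finitely
  many of its translates.\<close>
definition discrete_aut_group :: "(complex \<times> complex \<Rightarrow> complex \<times> complex) set \<Rightarrow> bool" where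
  "discrete_aut_group G \<longleftrightarrow>
     (\<forall>K. compact K \<and> K \<subseteq> bidisc \<longrightarrow>
        finite ((\<lambda>g. restrict g bidisc) ` {g\<in>G. g ` K \<inter> K \<noteq> {}}))"

definition torsion_free :: "(complex \<times> complex \<Rightarrow> complex \<times> complex) set \<Rightarrow> bool" where
  "torsion_free G \<longleftrightarrow> (\<forall>g\<in>G. \<forall>n::nat. n > 0 \<longrightarrow>
      (\<forall>x\<in>bidisc. (g ^^ n) x = x) \<longrightarrow> (\<forall>x\<in>bidisc. g x = x))"

definition curve_chart :: "(complex \<times> complex) set \<Rightarrow> (complex \<Rightarrow> complex \<times> complex) \<Rightarrow> real \<Rightarrow> bool" where
  "curve_chart S \<gamma> r \<longleftrightarrow> 0 < r \<and>
     (\<lambda>t. fst (\<gamma> t)) holomorphic_on ball 0 r \<and>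
     (\<lambda>t. snd (\<gamma> t)) holomorphic_on ball 0 r \<and>
     (\<forall>t\<in>ball 0 r. (deriv (\<lambda>s. fst (\<gamma> s)) t, deriv (\<lambda>s. snd (\<gamma> s)) t) \<noteq> (0, 0)) \<and>
     openin (top_of_set S) (\<gamma> ` ball 0 r) \<and>
     (\<exists>\<gamma>'. homeomorphism (ball 0 r) (\<gamma> ` ball 0 r) \<gamma> \<gamma>')"

definition complex_curve :: "(complex \<times> complex) set \<Rightarrow> bool" where
  "complex_curve S \<longleftrightarrow> S \<subseteq> bidisc \<and> closedin (top_of_set bidisc) S \<and>
     (\<forall>p\<in>S. \<exists>\<gamma> r. curve_chart S \<gamma> r \<and> \<gamma> 0 = p)"

text \<open>The lift St of a compact complex curve S in X = bidisc/G: a G-invariant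
  closed complex curve in the bidisc with compact quotient.\<close>
definition compact_curve_lift :: "(complex \<times> complex \<Rightarrow> complex \<times> complex) set \<Rightarrow> (complex \<times> complex) set \<Rightarrow> bool" where
  "compact_curve_lift G St \<longleftrightarrow> St \<noteq> {} \<and> complex_curve St \<and>
     (\<forall>g\<in>G. g ` St \<subseteq> St) \<and>
     (\<exists>K. compact K \<and> K \<subseteq> St \<and> St \<subseteq> (\<Union>g\<in>G. g ` K))"

definition pmetric :: "complex \<times> complex \<Rightarrow> complex \<times> complex \<Rightarrow> complex \<times> complex \<Rightarrow> complex" where
  "pmetric p u v =
     fst u * cnj (fst v) / of_real ((1 - (cmod (fst p))\<^sup>2)\<^sup>2) +
     snd u * cnj (snd v) / of_real ((1 - (cmod (snd p))\<^sup>2)\<^sup>2)"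

text \<open>Norm of the second fundamental form of a complex curve, computed through
  a chart gamma at parameter t: the normal component of the covariant derivative
  nabla_v v (Christoffel symbols of the product Poincare metric:
  Gamma^z_zz = 2 conj z/(1-|z|^2)), divided by |v|^2, v = gamma'(t).\<close>
definition sff_norm :: "(complex \<Rightarrow> complex \<times> complex) \<Rightarrow> complex \<Rightarrow> real" where
  "sff_norm \<gamma> t =
    (let p = \<gamma> t;
         g1 = (\<lambda>s. fst (\<gamma> s)); g2 = (\<lambda>s. snd (\<gamma> s));
         v = (deriv g1 t, deriv g2 t);
         a = (deriv (deriv g1) t + 2 * cnj (fst p) / of_real (1 - (cmod (fst p))\<^sup>2) * (fst v)\<^sup>2,
              deriv (deriv g2) t + 2 * cnj (snd p) / of_real (1 - (cmod (snd p))\<^sup>2) * (snd v)\<^sup>2);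
         c = pmetric p a v / pmetric p v v;
         n = (fst a - c * fst v, snd a - c * snd v)
     in sqrt (Re (pmetric p n n)) / Re (pmetric p v v))"

definition eps_geodesic :: "real \<Rightarrow> (complex \<times> complex) set \<Rightarrow> bool" where
  "eps_geodesic \<epsilon> St \<longleftrightarrow>
     (\<forall>\<gamma> r t. curve_chart St \<gamma> r \<and> t \<in> ball 0 r \<longrightarrow> sff_norm \<gamma> t \<le> \<epsilon>)"

definition totally_geodesic :: "(complex \<times> complex) set \<Rightarrow> bool" where
  "totally_geodesic St \<longleftrightarrow>
     (\<forall>\<gamma> r t. curve_chart St \<gamma> r \<and> t \<in> ball 0 r \<longrightarrow> sff_norm \<gamma> t = 0)"

text \<open>Geodesic ball of radius 1 about the origin for the product Poincare metric
  (Poincare distance from 0 to z is artanh |z| for this normalisation).\<close>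
definition geo_ball :: "(complex \<times> complex) set" where
  "geo_ball = {(z, w). cmod z < 1 \<and> cmod w < 1 \<and>
                 (artanh (cmod z))\<^sup>2 + (artanh (cmod w))\<^sup>2 < 1}"

definition hclose :: "real \<Rightarrow> (complex \<times> complex) set \<Rightarrow> (complex \<times> complex) set \<Rightarrow> bool" where
  "hclose d A B \<longleftrightarrow> (\<forall>a\<in>A. \<exists>b\<in>B. dist a b \<le> d) \<and> (\<forall>b\<in>B. \<exists>a\<in>A. dist a b \<le> d)"

definition model_disc :: "(complex \<times> complex) set" where
  "model_disc = {(z, 0) | z. cmod z < 1}"

definition modeled_on_disc :: "real \<Rightarrow> (complex \<times> complex) set \<Rightarrow> bool" where
  "modeled_on_disc d St \<longleftrightarrow>
     (\<forall>p\<in>St. \<exists>\<phi>. bidisc_aut \<phi> \<and> \<phi> p = (0, 0) \<and>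
        hclose d (\<phi> ` St \<inter> geo_ball) (model_disc \<inter> geo_ball))"

end

theory Submission
  imports Defs "HOL-Complex_Analysis.Complex_Analysis"
begin

text \<open>
  Let \<open>\<Lambda>\<close> be a torsion-free cocompact Fuchsian group and \<open>A = \<Lambda> A0\<close> for a finite set \<open>A0\<close> of
  inequivalent points. Among the holomorphic self-maps \<open>f\<close> of the disc for which \<open>f - a\<close> is a square
  for every \<open>a \<in> A\<close> there is a universal one, \<open>F\<close> (the orbifold covering with cone points of order 2
  along \<open>A\<close>). It minimises the derivative at \<open>0\<close> among all maps through which every such \<open>f\<close> factors:
  if \<open>F - a\<close> had a zero of odd order at \<open>p\<close>, composing \<open>F\<close> with the double cover branched at \<open>p\<close>
  would give a smaller competitor. By universality every \<open>\<lambda> \<in> \<Lambda>\<close> lifts to disc automorphisms \<open>\<gamma>\<close>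
  with \<open>F \<circ> \<gamma> = \<lambda> \<circ> F\<close>, and the pairs \<open>(\<gamma>, \<lambda>)\<close> act discretely and cocompactly on the graph of \<open>F\<close>.

  When \<open>A\<close> becomes dense, \<open>F\<close> becomes uniformly flat: a limit of such maps, normalised at any base
  point, would be ramified over every point and hence constant. So the graph of \<open>F\<close> is \<open>\<epsilon>\<close>-geodesic
  and close to a horizontal disc, but over a point of \<open>A\<close> one has \<open>F' = 0 \<noteq> F''\<close>, and the graph is not
  totally geodesic.

  The only torsion consists of the involutions \<open>(\<gamma>, 1)\<close> at the ramification points. With
  \<open>P = \<Prod>a\<in>A0. (x - a)\<close>, each \<open>P \<circ> \<lambda> \<circ> F\<close> has a square root, and \<open>\<gamma>\<close> permutes these roots up to signs;
  normalising the roots suitably (possible if \<open>A0\<close> has even cardinality) only finitely many signs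
  are negative. Their parity is a character which is odd on the involutions, and its kernel is
  the required group.
\<close>

section \<open>Moebius transformations and self-maps of the disc\<close>

text \<open>Holomorphic square roots stand in for orbifold coverings throughout. That
  \<open>f - a\<close> is a square survives precomposition, Moebius maps of the target and locally
  uniform limits, so the existence of \<open>F\<close>, lifting and flatness all become
  normal-family arguments. Branching of order exactly 2 is then forced by explicit maps that must
  lift through \<open>F\<close>: \<open>b + d z\<close> near a generic value and
  \<open>a + d z^2\<close> near a point of \<open>A\<close>.

  The parity of signs gives a torsion-free subgroup of index at most 2 without Selberg's lemma. An
  involution is odd because it flips a single sign, which is why \<open>\<Lambda>\<close> has to act
  freely and the points of \<open>A0\<close> have to be inequivalent. Freeness and cocompactness
  come from a congruence subgroup of a quaternion order.

  Flatness is uniform over all base points because density of \<open>A\<close> is measured in the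
  pseudo-hyperbolic distance: moving the base point to 0 in source and target leaves the hypotheses
  unchanged.\<close>

text \<open>A pair \<open>(\<alpha>, \<beta>)\<close> stands for the matrix with rows \<open>(\<alpha>, \<beta>)\<close> and \<open>(cnj \<beta>, cnj \<alpha>)\<close>.\<close>

definition su11 :: "(complex \<times> complex) set" where
  "su11 = {p. (cmod (fst p))\<^sup>2 - (cmod (snd p))\<^sup>2 = 1}"

definition mob :: "complex \<times> complex \<Rightarrow> complex \<Rightarrow> complex" where
  "mob p z = (fst p * z + snd p) / (cnj (snd p) * z + cnj (fst p))"

definition mmul :: "complex \<times> complex \<Rightarrow> complex \<times> complex \<Rightarrow> complex \<times> complex" where
  "mmul p q = (fst p * fst q + snd p * cnj (snd q), fst p * snd q + snd p * cnj (fst q))"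

definition minv :: "complex \<times> complex \<Rightarrow> complex \<times> complex" where
  "minv p = (cnj (fst p), - snd p)"

definition mshift :: "complex \<Rightarrow> complex \<times> complex" where
  "mshift a = (1 / of_real (sqrt (1 - (cmod a)\<^sup>2)), a / of_real (sqrt (1 - (cmod a)\<^sup>2)))"

lemma su11_iff: "p \<in> su11 \<longleftrightarrow> fst p * cnj (fst p) - snd p * cnj (snd p) = 1"
proof -
  have "fst p * cnj (fst p) - snd p * cnj (snd p) = of_real ((cmod (fst p))\<^sup>2 - (cmod (snd p))\<^sup>2)"
    by (simp only: of_real_diff complex_norm_square)
  then show ?thesis unfolding su11_def by (metis (mono_tags, lifting) mem_Collect_eq of_real_1 of_real_eq_iff)
qed

lemma su11_norm_less: "p \<in> su11 \<Longrightarrow> cmod (snd p) < cmod (fst p)"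
  unfolding su11_def by (auto intro: power2_less_imp_less)

lemma mob_denom_bound:
  assumes "p \<in> su11" "cmod z \<le> r" "r \<le> 1"
  shows "cmod (cnj (snd p) * z + cnj (fst p)) \<ge> cmod (fst p) * (1 - r)"
proof -
  have "cmod (cnj (snd p) * z) \<le> cmod (fst p) * r"
    using su11_norm_less[OF assms(1)] assms by (auto simp: norm_mult intro!: mult_mono)
  then show ?thesis
    using norm_diff_ineq[of "cnj (fst p)" "cnj (snd p) * z"] by (simp add: algebra_simps)
qed

lemma mob_denom_nz:
  assumes "p \<in> su11" "cmod z < 1"
  shows "cnj (snd p) * z + cnj (fst p) \<noteq> 0"
proof -
  have "cmod (fst p) > 0" using su11_norm_less[OF assms(1)] by (smt (verit) norm_ge_zero)
  then have "cmod (fst p) * (1 - cmod z) > 0" using assms by simp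
  with mob_denom_bound[OF assms(1) order.refl, of z] assms(2) show ?thesis by force
qed

text \<open>Numerator and denominator are the image of \<open>(z, 1)\<close> under the matrix, which
  preserves the indefinite form \<open>|y|^2 - |x|^2\<close>. The estimates of how far a group
  element moves a point go through this identity.\<close>

lemma mob_norm:
  assumes "p \<in> su11" "cmod z < 1"
  shows "1 - (cmod (mob p z))\<^sup>2 = (1 - (cmod z)\<^sup>2) / (cmod (cnj (snd p) * z + cnj (fst p)))\<^sup>2"
proof -
  let ?d = "cnj (snd p) * z + cnj (fst p)"
  let ?n = "fst p * z + snd p"
  have "?d * cnj ?d - ?n * cnj ?n = (fst p * cnj (fst p) - snd p * cnj (snd p)) * (1 - z * cnj z)"
    by (simp add: algebra_simps)
  also have "\<dots> = 1 - z * cnj z" using assms(1) su11_iff by simp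
  finally have "complex_of_real ((cmod ?d)\<^sup>2 - (cmod ?n)\<^sup>2) = of_real (1 - (cmod z)\<^sup>2)"
    by (simp only: of_real_diff of_real_1 complex_norm_square)
  then have "(cmod ?d)\<^sup>2 - (cmod ?n)\<^sup>2 = 1 - (cmod z)\<^sup>2" by (simp only: of_real_eq_iff)
  moreover have "cmod ?d \<noteq> 0" using mob_denom_nz[OF assms] by simp
  ultimately show ?thesis unfolding mob_def norm_divide power_divide
    by (smt (verit, best) diff_divide_distrib divide_self zero_eq_power2)
qed

lemma mob_in_disc: "p \<in> su11 \<Longrightarrow> cmod z < 1 \<Longrightarrow> cmod (mob p z) < 1"
proof -
  assume a: "p \<in> su11" "cmod z < 1"
  have "1 - (cmod z)\<^sup>2 > 0" using a by (simp add: power_less_one_iff)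
  then have "1 - (cmod (mob p z))\<^sup>2 > 0"
    unfolding mob_norm[OF a] using mob_denom_nz[OF a] by simp
  then show ?thesis using power2_less_imp_less[of "cmod (mob p z)" 1] by simp
qed

lemma mmul_su11: "p \<in> su11 \<Longrightarrow> q \<in> su11 \<Longrightarrow> mmul p q \<in> su11"
proof -
  assume "p \<in> su11" "q \<in> su11"
  then have *: "fst p * cnj (fst p) - snd p * cnj (snd p) = 1" "fst q * cnj (fst q) - snd q * cnj (snd q) = 1"
    by (auto simp: su11_iff)
  have "fst (mmul p q) * cnj (fst (mmul p q)) - snd (mmul p q) * cnj (snd (mmul p q))
      = (fst p * cnj (fst p) - snd p * cnj (snd p)) * (fst q * cnj (fst q) - snd q * cnj (snd q))"
    by (simp add: mmul_def algebra_simps)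
  then show ?thesis using * by (simp add: su11_iff)
qed

lemma minv_su11: "p \<in> su11 \<Longrightarrow> minv p \<in> su11"
  by (simp add: minv_def su11_def)

lemma one_su11: "(1, 0) \<in> su11" by (simp add: su11_def)

lemma mob_one [simp]: "mob (1, 0) z = z" by (simp add: mob_def)

lemma mob_mmul:
  assumes "p \<in> su11" "q \<in> su11" "cmod z < 1"
  shows "mob (mmul p q) z = mob p (mob q z)"
proof -
  note d1 = mob_denom_nz[OF assms(2,3)]
  note d2 = mob_denom_nz[OF assms(1) mob_in_disc[OF assms(2,3)]]
  note d3 = mob_denom_nz[OF mmul_su11[OF assms(1,2)] assms(3)]
  let ?e = "cnj (snd q) * z + cnj (fst q)"
  have n: "(fst p * mob q z + snd p) * ?e = fst (mmul p q) * z + snd (mmul p q)"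
    using d1 by (simp add: mob_def mmul_def field_simps)
  have d: "(cnj (snd p) * mob q z + cnj (fst p)) * ?e = cnj (snd (mmul p q)) * z + cnj (fst (mmul p q))"
    using d1 by (simp add: mob_def mmul_def field_simps)
  have "mob p (mob q z) = ((fst p * mob q z + snd p) * ?e) / ((cnj (snd p) * mob q z + cnj (fst p)) * ?e)"
    using d1 by (simp add: mob_def[of p])
  then show ?thesis unfolding n d by (simp add: mob_def)
qed

lemma mmul_minv: "p \<in> su11 \<Longrightarrow> mmul (minv p) p = (1, 0)" "p \<in> su11 \<Longrightarrow> mmul p (minv p) = (1, 0)"
  by (auto simp: mmul_def minv_def su11_iff mult.commute)

lemma mmul_assoc: "mmul (mmul p q) r = mmul p (mmul q r)"
  by (simp add: mmul_def algebra_simps)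

lemma mmul_one [simp]: "mmul (1,0) p = p" "mmul p (1,0) = p"
  by (simp_all add: mmul_def)

lemma mob_minv:
  assumes "p \<in> su11" "cmod z < 1"
  shows "mob (minv p) (mob p z) = z" "mob p (mob (minv p) z) = z"
  using mob_mmul[OF minv_su11[OF assms(1)] assms] mob_mmul[OF assms(1) minv_su11[OF assms(1)] assms(2)]
    mmul_minv[OF assms(1)] by simp_all

text \<open>The determinant is 1, so the difference of values is \<open>z - w\<close> times a factor
  without zeros; this lets square roots of \<open>f - a\<close> survive a Moebius map of the
  target.\<close>

lemma mob_diff:
  assumes "p \<in> su11" "cmod z < 1" "cmod w < 1"
  shows "mob p z - mob p w =
    (z - w) / ((cnj (snd p) * z + cnj (fst p)) * (cnj (snd p) * w + cnj (fst p)))"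
proof -
  have "(fst p * z + snd p) * (cnj (snd p) * w + cnj (fst p)) - (fst p * w + snd p) * (cnj (snd p) * z + cnj (fst p))
    = (fst p * cnj (fst p) - snd p * cnj (snd p)) * (z - w)" by (simp add: algebra_simps)
  also have "\<dots> = z - w" using assms(1) su11_iff by simp
  finally show ?thesis unfolding mob_def
    using mob_denom_nz[OF assms(1,2)] mob_denom_nz[OF assms(1,3)] by (simp add: diff_frac_eq)
qed

lemma mob_inj: "p \<in> su11 \<Longrightarrow> cmod z < 1 \<Longrightarrow> cmod w < 1 \<Longrightarrow> mob p z = mob p w \<Longrightarrow> z = w"
  by (metis mob_minv(1))

lemma mshift_su11: "cmod a < 1 \<Longrightarrow> mshift a \<in> su11"
proof -
  assume "cmod a < 1"
  then have "1 - (cmod a)\<^sup>2 > 0" by (simp add: power_less_one_iff)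
  then show ?thesis by (simp add: su11_def mshift_def norm_divide power_divide diff_divide_distrib[symmetric])
qed

lemma mob_mshift:
  assumes "cmod a < 1"
  shows "mob (mshift a) z = (z + a) / (1 + cnj a * z)"
proof -
  let ?s = "complex_of_real (sqrt (1 - (cmod a)\<^sup>2))"
  have "1 - (cmod a)\<^sup>2 > 0" using assms by (simp add: power_less_one_iff)
  then have s: "?s \<noteq> 0" by simp
  have "mob (mshift a) z = ((z + a) / ?s) / ((1 + cnj a * z) / ?s)"
    by (simp add: mob_def mshift_def add_divide_distrib add.commute)
  then show ?thesis using s by simp
qed

lemma minv_mshift: "minv (mshift a) = mshift (- a)"
  by (simp add: minv_def mshift_def)

lemma mob_mshift_0 [simp]: "cmod a < 1 \<Longrightarrow> mob (mshift a) 0 = a"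
  by (simp add: mob_mshift)

lemma mob_mshift_neg [simp]: "cmod a < 1 \<Longrightarrow> mob (mshift (- a)) a = 0"
  by (simp add: mob_mshift)

lemma mob_mshift_cancel:
  "cmod a < 1 \<Longrightarrow> cmod z < 1 \<Longrightarrow> mob (mshift a) (mob (mshift (- a)) z) = z"
  "cmod a < 1 \<Longrightarrow> cmod z < 1 \<Longrightarrow> mob (mshift (- a)) (mob (mshift a) z) = z"
  using mob_minv[OF mshift_su11, of a z] by (simp_all add: minv_mshift)

lemma mob_holomorphic: "p \<in> su11 \<Longrightarrow> mob p holomorphic_on ball 0 1"
  unfolding mob_def using mob_denom_nz[of p] by (intro holomorphic_intros) auto

lemma mob_has_derivative:
  assumes "p \<in> su11" "cmod z < 1"
  shows "(mob p has_field_derivative 1 / (cnj (snd p) * z + cnj (fst p))\<^sup>2) (at z)"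
proof -
  note d = mob_denom_nz[OF assms]
  have e: "fst p * (cnj (snd p) * z + cnj (fst p)) - (fst p * z + snd p) * cnj (snd p) = 1"
    using assms(1) by (simp add: algebra_simps su11_iff)
  have "((\<lambda>z. (fst p * z + snd p) / (cnj (snd p) * z + cnj (fst p))) has_field_derivative
     (fst p * (cnj (snd p) * z + cnj (fst p)) - (fst p * z + snd p) * cnj (snd p)) /
      ((cnj (snd p) * z + cnj (fst p)) * (cnj (snd p) * z + cnj (fst p)))) (at z)"
    by (rule derivative_eq_intros refl d | simp)+
  then show ?thesis unfolding e mob_def[abs_def] by (simp add: power2_eq_square)
qed

section \<open>Self-maps of the disc ramified over a given set\<close>

definition disc_map :: "(complex \<Rightarrow> complex) \<Rightarrow> bool" where
  "disc_map f \<longleftrightarrow> f holomorphic_on ball 0 1 \<and> (\<forall>z. cmod z < 1 \<longrightarrow> cmod (f z) < 1)"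

text \<open>For functions not identically zero this means that all zeros have even order. The root
  is asked for explicitly because roots pass to limits by normal families.\<close>

definition has_sqrt :: "(complex \<Rightarrow> complex) \<Rightarrow> bool" where
  "has_sqrt f \<longleftrightarrow> (\<exists>g. g holomorphic_on ball 0 1 \<and> (\<forall>z. cmod z < 1 \<longrightarrow> f z = (g z)\<^sup>2))"

definition ramified :: "complex set \<Rightarrow> (complex \<Rightarrow> complex) \<Rightarrow> bool" where
  "ramified A f \<longleftrightarrow> disc_map f \<and> (\<forall>a\<in>A. has_sqrt (\<lambda>z. f z - a))"

lemma disc_map_holo: "disc_map f \<Longrightarrow> f holomorphic_on ball 0 1"
  and disc_map_norm: "disc_map f \<Longrightarrow> cmod z < 1 \<Longrightarrow> cmod (f z) < 1"
  by (auto simp: disc_map_def)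

lemma disc_map_mob: "p \<in> su11 \<Longrightarrow> disc_map (mob p)"
  by (simp add: disc_map_def mob_holomorphic mob_in_disc)

lemma disc_map_compose: "disc_map f \<Longrightarrow> disc_map g \<Longrightarrow> disc_map (\<lambda>z. f (g z))"
  unfolding disc_map_def by (auto intro!: holomorphic_on_compose_gen[of g _ f, unfolded o_def])

lemma has_sqrt_compose:
  assumes "has_sqrt f" "disc_map h" shows "has_sqrt (\<lambda>z. f (h z))"
proof -
  obtain g where g: "g holomorphic_on ball 0 1" "\<And>z. cmod z < 1 \<Longrightarrow> f z = (g z)\<^sup>2"
    using assms(1) by (auto simp: has_sqrt_def)
  have "(\<lambda>z. g (h z)) holomorphic_on ball 0 1"
    using holomorphic_on_compose_gen[of h "ball 0 1" g "ball 0 1"] g assms(2)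
    by (force simp: disc_map_def o_def image_subset_iff)
  then show ?thesis unfolding has_sqrt_def using g(2) disc_map_norm[OF assms(2)] by blast
qed

lemma ramified_compose: "ramified A f \<Longrightarrow> disc_map h \<Longrightarrow> ramified A (\<lambda>z. f (h z))"
  unfolding ramified_def using disc_map_compose has_sqrt_compose by (fastforce dest: has_sqrt_compose)

lemma ramified_disc_map: "ramified A f \<Longrightarrow> disc_map f" by (simp add: ramified_def)

lemma has_sqrt_mult: "has_sqrt f \<Longrightarrow> has_sqrt g \<Longrightarrow> has_sqrt (\<lambda>z. f z * g z)"
  unfolding has_sqrt_def by (metis (no_types, lifting) holomorphic_on_mult power_mult_distrib)

lemma has_sqrt_nonvanishing:
  assumes "f holomorphic_on ball 0 1" "\<And>z. cmod z < 1 \<Longrightarrow> f z \<noteq> 0"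
  shows "has_sqrt f"
proof -
  obtain g where "g holomorphic_on ball 0 1" "\<And>z. z \<in> ball 0 1 \<Longrightarrow> f z = (g z)\<^sup>2"
    using contractible_imp_holomorphic_sqrt[OF assms(1), of thesis] assms(2)
      convex_imp_contractible[OF convex_ball] by (metis mem_ball_0)
  then show ?thesis unfolding has_sqrt_def by auto
qed

text \<open>By \<open>mob_diff\<close> the new difference is \<open>f - a\<close> times a zero-free
  function, which has a root on the disc.\<close>

lemma ramified_mob:
  assumes f: "ramified A f" and p: "p \<in> su11" and A: "A \<subseteq> ball 0 1"
  shows "ramified (mob p ` A) (\<lambda>z. mob p (f z))"
  unfolding ramified_def
proof (intro conjI ballI)
  have df: "disc_map f" using f ramified_disc_map by auto
  show "disc_map (\<lambda>z. mob p (f z))" using disc_map_compose[OF disc_map_mob[OF p] df] .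
  fix b assume "b \<in> mob p ` A"
  then obtain a where a: "a \<in> A" "b = mob p a" by auto
  have ca: "cmod a < 1" using a A by auto
  let ?u = "\<lambda>z. 1 / ((cnj (snd p) * f z + cnj (fst p)) * (cnj (snd p) * a + cnj (fst p)))"
  have "?u holomorphic_on ball 0 1"
    using mob_denom_nz[OF p] disc_map_norm[OF df] disc_map_holo[OF df] ca
    by (intro holomorphic_intros) auto
  then have "has_sqrt ?u" using mob_denom_nz[OF p] disc_map_norm[OF df] ca
    by (intro has_sqrt_nonvanishing) auto
  moreover have "has_sqrt (\<lambda>z. f z - a)" using f a by (auto simp: ramified_def)
  ultimately have "has_sqrt (\<lambda>z. (f z - a) * ?u z)" using has_sqrt_mult by blast
  then show "has_sqrt (\<lambda>z. mob p (f z) - b)" unfolding has_sqrt_def a(2)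
    using mob_diff[OF p disc_map_norm[OF df] ca] by simp
qed

section \<open>Normal families and limits\<close>

lemma montel_disc:
  fixes f :: "nat \<Rightarrow> complex \<Rightarrow> complex"
  assumes "\<And>n. f n holomorphic_on ball 0 1" "\<And>n z. cmod z < 1 \<Longrightarrow> cmod (f n z) \<le> B"
  shows "\<exists>g r. g holomorphic_on ball 0 1 \<and> strict_mono (r :: nat \<Rightarrow> nat) \<and>
    (\<forall>z. cmod z < 1 \<longrightarrow> (\<lambda>n. f (r n) z) \<longlonglongrightarrow> g z) \<and>
    (\<forall>K. compact K \<longrightarrow> K \<subseteq> ball 0 1 \<longrightarrow> uniform_limit K (\<lambda>n. f (r n)) g sequentially)"
proof -
  have bd: "\<exists>B. \<forall>h\<in>range f. \<forall>z\<in>K. cmod (h z) \<le> B" if "K \<subseteq> ball 0 1" for K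
    using that assms(2) by (intro exI[of _ B]) auto
  have hol: "h holomorphic_on ball 0 1" if "h \<in> range f" for h using that assms(1) by auto
  show ?thesis
  proof (rule Montel[OF open_ball hol bd order.refl], assumption, assumption, goal_cases)
    case (1 g r)
    then show ?case by (intro exI[of _ g] exI[of _ r]) (auto simp: o_def)
  qed
qed

lemma montel_disc_map:
  assumes "\<And>n. disc_map (f n)"
  shows "\<exists>g r. g holomorphic_on ball 0 1 \<and> strict_mono (r :: nat \<Rightarrow> nat) \<and>
    (\<forall>z. cmod z < 1 \<longrightarrow> (\<lambda>n. f (r n) z) \<longlonglongrightarrow> g z) \<and>
    (\<forall>K. compact K \<longrightarrow> K \<subseteq> ball 0 1 \<longrightarrow> uniform_limit K (\<lambda>n. f (r n)) g sequentially)"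
  by (rule montel_disc[of f 1]) (use assms disc_map_holo disc_map_norm less_imp_le in blast)+

text \<open>A limit of maps into the open disc could land on the unit circle; by the maximum
  principle it would then be a unimodular constant, which the value at \<open>z0\<close>
  excludes.\<close>

lemma limit_disc_map:
  assumes g: "g holomorphic_on ball 0 1" and f: "\<And>n. disc_map (f n)"
    and lim: "\<And>z. cmod z < 1 \<Longrightarrow> (\<lambda>n. f n z) \<longlonglongrightarrow> g z" and z0: "cmod z0 < 1" "cmod (g z0) < 1"
  shows "disc_map g"
proof -
  have le: "cmod (g z) \<le> 1" if "cmod z < 1" for z
    by (rule tendsto_le[OF _ tendsto_const tendsto_norm[OF lim[OF that]]])
       (auto intro!: always_eventually less_imp_le disc_map_norm[OF f that])
  have "cmod (g z) < 1" if z: "cmod z < 1" for z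
  proof (rule ccontr)
    assume "\<not> cmod (g z) < 1"
    then have e: "cmod (g z) = 1" using le[OF z] by simp
    have "g constant_on ball 0 1"
      by (rule maximum_modulus_principle[OF g open_ball connected_ball open_ball order.refl, of z])
         (use z le e in auto)
    then have "g z0 = g z" using z z0 unfolding constant_on_def by (metis mem_ball_0)
    then show False using e z0 by simp
  qed
  then show ?thesis using g by (simp add: disc_map_def)
qed

text \<open>Serves to pass to the limit in compositions whose two factors both vary.\<close>

lemma limit_at_moving_point:
  fixes f :: "nat \<Rightarrow> complex \<Rightarrow> complex" and h :: "nat \<Rightarrow> complex"
  assumes lim: "\<And>K. compact K \<Longrightarrow> K \<subseteq> ball 0 1 \<Longrightarrow> uniform_limit K f g sequentially"
    and h: "h \<longlonglongrightarrow> w" and w: "cmod w < 1" and g: "g holomorphic_on ball 0 1"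
  shows "(\<lambda>n. f n (h n)) \<longlonglongrightarrow> g w"
proof -
  obtain e where e: "e > 0" "cball w e \<subseteq> ball 0 1"
    using open_contains_cball[of "ball (0::complex) 1"] w by (metis mem_ball_0 open_ball)
  have ev: "\<forall>\<^sub>F n in sequentially. h n \<in> cball w e"
    using tendstoD[OF h e(1)] by eventually_elim (simp add: dist_commute)
  have u: "uniform_limit (cball w e) f g sequentially" using lim e by auto
  have "isCont g w"
    using holomorphic_on_imp_differentiable_at[OF g open_ball] w by (simp add: field_differentiable_imp_continuous_at)
  then have gh: "(\<lambda>n. g (h n)) \<longlonglongrightarrow> g w" using h by (simp add: isCont_tendsto_compose)
  have "(\<lambda>n. dist (f n (h n)) (g (h n))) \<longlonglongrightarrow> 0"
  proof (rule tendstoI)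
    fix d :: real assume d: "0 < d"
    show "\<forall>\<^sub>F n in sequentially. dist (dist (f n (h n)) (g (h n))) 0 < d"
      using uniform_limitD[OF u d] ev by eventually_elim simp
  qed
  then have "(\<lambda>n. f n (h n) - g (h n)) \<longlonglongrightarrow> 0" by (simp add: dist_norm tendsto_norm_zero_iff)
  from tendsto_add[OF this gh] show ?thesis by simp
qed

lemma deriv_limit:
  fixes f :: "nat \<Rightarrow> complex \<Rightarrow> complex"
  assumes f: "\<And>n. f n holomorphic_on ball 0 1"
    and lim: "\<And>K. compact K \<Longrightarrow> K \<subseteq> ball 0 1 \<Longrightarrow> uniform_limit K f g sequentially"
    and w: "cmod w < 1"
  shows "(\<lambda>n. deriv (f n) w) \<longlonglongrightarrow> deriv g w"
proof -
  obtain e where e: "e > 0" "cball w e \<subseteq> ball 0 1"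
    using open_contains_cball[of "ball (0::complex) 1"] w by (metis mem_ball_0 open_ball)
  have u: "uniform_limit (ball w e) f g sequentially"
    using uniform_limit_on_subset[OF lim[OF compact_cball e(2)]] ball_subset_cball by blast
  have hol: "\<forall>\<^sub>F n in sequentially. f n holomorphic_on ball w e"
    using holomorphic_on_subset[OF f, of "ball w e"] e(2) ball_subset_cball by (intro always_eventually) blast
  show ?thesis
    using higher_deriv_complex_uniform_limit[OF u hol, of w 1] e(1) by simp
qed

text \<open>The roots are bounded by \<open>sqrt B\<close>, so a subsequence of them converges, and
  its limit squares to \<open>g\<close>.\<close>

lemma has_sqrt_limit:
  fixes f :: "nat \<Rightarrow> complex \<Rightarrow> complex"
  assumes f: "\<And>n. has_sqrt (f n)" and bd: "\<And>n z. cmod z < 1 \<Longrightarrow> cmod (f n z) \<le> B"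
    and lim: "\<And>z. cmod z < 1 \<Longrightarrow> (\<lambda>n. f n z) \<longlonglongrightarrow> g z"
  shows "has_sqrt g"
proof -
  obtain u where u: "\<And>n. u n holomorphic_on ball 0 1" "\<And>n z. cmod z < 1 \<Longrightarrow> f n z = (u n z)\<^sup>2"
  proof -
    have "\<forall>n. \<exists>v. v holomorphic_on ball 0 1 \<and> (\<forall>z. cmod z < 1 \<longrightarrow> f n z = (v z)\<^sup>2)"
      using f unfolding has_sqrt_def by blast
    from choice[OF this] show ?thesis using that by blast
  qed
  have ub: "cmod (u n z) \<le> sqrt B" if "cmod z < 1" for n z
    using bd[OF that, of n] u(2)[OF that, of n] by (simp add: norm_power real_le_rsqrt)
  obtain v r where v: "v holomorphic_on ball 0 1" "strict_mono (r :: nat \<Rightarrow> nat)"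
    "\<forall>z. cmod z < 1 \<longrightarrow> (\<lambda>n. u (r n) z) \<longlonglongrightarrow> v z"
    using montel_disc[of u "sqrt B", OF u(1) ub] by blast
  have "g z = (v z)\<^sup>2" if z: "cmod z < 1" for z
  proof (rule LIMSEQ_unique)
    show "(\<lambda>n. f (r n) z) \<longlonglongrightarrow> g z" using LIMSEQ_subseq_LIMSEQ[OF lim[OF z] v(2)] by (simp add: o_def)
    show "(\<lambda>n. f (r n) z) \<longlonglongrightarrow> (v z)\<^sup>2" unfolding u(2)[OF z] by (intro tendsto_intros v(3)[rule_format] z)
  qed
  then show ?thesis unfolding has_sqrt_def using v by blast
qed

lemma schwarz_identity:
  assumes "disc_map k" "k 0 = 0" "deriv k 0 = 1" "cmod z < 1"
  shows "k z = z"
proof -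
  obtain c where c: "\<And>z. cmod z < 1 \<Longrightarrow> k z = c * z"
    using Schwarz_Lemma(3)[OF disc_map_holo[OF assms(1)] assms(2) disc_map_norm[OF assms(1)] assms(4)] assms(3) by auto
  have "(k has_field_derivative c) (at 0)"
    by (rule has_field_derivative_transform_within_open[of "\<lambda>z. c * z" _ _ "ball 0 1"])
       (auto intro!: derivative_eq_intros simp: c)
  then have "c = 1" using assms(3) DERIV_imp_deriv by metis
  then show ?thesis using c assms by simp
qed

lemma disc_map_deriv: "disc_map f \<Longrightarrow> cmod z < 1 \<Longrightarrow> (f has_field_derivative deriv f z) (at z)"
  using holomorphic_derivI[OF disc_map_holo open_ball] by simp

lemma disc_map_chain:
  assumes "disc_map f" "disc_map g" "cmod z < 1"
  shows "deriv (\<lambda>z. f (g z)) z = deriv f (g z) * deriv g z"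
  using DERIV_chain2[OF disc_map_deriv[OF assms(1) disc_map_norm[OF assms(2,3)]] disc_map_deriv[OF assms(2,3)]]
  by (rule DERIV_imp_deriv)

lemma deriv_cong_disc:
  assumes "\<And>z. cmod z < 1 \<Longrightarrow> f z = g z" "cmod z < 1"
  shows "deriv f z = deriv g z"
  by (rule deriv_cong_ev[OF _ refl])
     (use assms eventually_nhds_in_open[of "ball (0::complex) 1" z] in \<open>auto elim: eventually_mono\<close>)

section \<open>Holomorphic square roots\<close>

text \<open>Near \<open>z0\<close> the sum \<open>g + h\<close> has no zero, so
  \<open>(g - h) * (g + h) = 0\<close> gives \<open>g = h\<close> there; the identity theorem does
  the rest.\<close>

lemma holomorphic_sqrt_unique:
  assumes S: "open S" "connected S" and g: "g holomorphic_on S" "h holomorphic_on S"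
    and eq: "\<And>z. z \<in> S \<Longrightarrow> (g z)\<^sup>2 = (h z)\<^sup>2" and z0: "z0 \<in> S" "g z0 = h z0" "g z0 \<noteq> 0"
    and z: "z \<in> S"
  shows "g z = h z"
proof -
  define U where "U = {z\<in>S. g z + h z \<noteq> 0}"
  have "continuous_on S (\<lambda>z. g z + h z)"
    using g holomorphic_on_imp_continuous_on continuous_on_add by blast
  from continuous_open_preimage[OF this S(1) open_Compl[OF closed_singleton[of 0]]]
  have oU: "open U" by (simp add: U_def vimage_def Int_def Compl_eq)
  have "z0 \<in> U" using z0 by (simp add: U_def)
  show ?thesis
  proof (rule analytic_continuation_open[OF oU S(1) _ S(2) _ g _ z])
    show "g z = h z" if "z \<in> U" for z
    proof -
      have "(g z - h z) * (g z + h z) = 0"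
        using eq[of z] that by (simp add: U_def algebra_simps power2_eq_square)
      then show ?thesis using that by (simp add: U_def)
    qed
  qed (use \<open>z0 \<in> U\<close> in \<open>auto simp: U_def\<close>)
qed

lemma holomorphic_sqrt_sign:
  assumes g: "g holomorphic_on ball 0 1" "h holomorphic_on ball 0 1"
    and eq: "\<And>z. cmod z < 1 \<Longrightarrow> (g z)\<^sup>2 = (h z)\<^sup>2"
  shows "(\<forall>z. cmod z < 1 \<longrightarrow> g z = h z) \<or> (\<forall>z. cmod z < 1 \<longrightarrow> g z = - h z)"
proof (cases "\<exists>z0. cmod z0 < 1 \<and> g z0 \<noteq> 0")
  case True
  then obtain z0 where z0: "cmod z0 < 1" "g z0 \<noteq> 0" by auto
  consider "g z0 = h z0" | "g z0 = - h z0" using eq[OF z0(1)] by (auto simp: power2_eq_iff)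
  then show ?thesis
  proof cases
    case 1
    then show ?thesis
      using holomorphic_sqrt_unique[OF open_ball connected_ball g, of z0] z0 eq by auto
  next
    case 2
    then show ?thesis
      using holomorphic_sqrt_unique[OF open_ball connected_ball g(1) holomorphic_on_minus[OF g(2)], of z0] z0 eq
      by auto
  qed
next
  case False
  then show ?thesis using eq by fastforce
qed

lemma zero_factor:
  assumes f: "f holomorphic_on ball 0 1" and p: "cmod p < 1" "f p = 0" and nz: "cmod z0 < 1" "f z0 \<noteq> 0"
  shows "\<exists>n G. 0 < n \<and> G holomorphic_on ball 0 1 \<and> (\<forall>z. cmod z < 1 \<longrightarrow> f z = (z - p) ^ n * G z) \<and> G p \<noteq> 0"
proof -
  have nc: "\<not> f constant_on ball 0 1"
    using p nz unfolding constant_on_def by (metis mem_ball_0)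
  obtain g r n where n: "0 < n" "0 < r" "ball p r \<subseteq> ball 0 1" "g holomorphic_on ball p r"
      "\<And>w. w \<in> ball p r \<Longrightarrow> f w = (w - p) ^ n * g w" "\<And>w. w \<in> ball p r \<Longrightarrow> g w \<noteq> 0"
    by (rule holomorphic_factor_zero_nonconstant[OF f open_ball connected_ball _ p(2) nc]) (use p(1) in auto)
  define G where "G = (\<lambda>z. if z = p then g p else f z / (z - p) ^ n)"
  have Gg: "G z = g z" if "z \<in> ball p r" for z using n(5)[OF that] by (simp add: G_def)
  have h1: "G holomorphic_on ball p r" using holomorphic_transform[OF n(4)] Gg by simp
  have "(\<lambda>z. f z / (z - p) ^ n) holomorphic_on (ball 0 1 - {p})"
    by (intro holomorphic_intros holomorphic_on_subset[OF f]) auto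
  then have h2: "G holomorphic_on (ball 0 1 - {p})" by (rule holomorphic_transform) (auto simp: G_def)
  have "G holomorphic_on (ball p r \<union> (ball 0 1 - {p}))"
    by (rule holomorphic_on_Un[OF h1 h2]) auto
  moreover have "ball p r \<union> (ball 0 1 - {p}) = ball 0 1" using n(2,3) by auto
  ultimately have "G holomorphic_on ball 0 1" by simp
  moreover have "f z = (z - p) ^ n * G z" for z using p(2) n(1) by (simp add: G_def)
  moreover have "G p \<noteq> 0" using Gg[of p] n(2,6) by simp
  ultimately show ?thesis using n(1) by blast
qed

text \<open>If the exponents differed, cancelling the smaller power and letting \<open>z\<close>
  tend to \<open>w\<close> would make one of the nonzero values vanish.\<close>

lemma factor_order_unique:
  assumes "L holomorphic_on ball 0 1" "K holomorphic_on ball 0 1" "cmod w < 1" "L w \<noteq> 0" "K w \<noteq> 0"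
    and eq: "\<And>z. cmod z < 1 \<Longrightarrow> (z - w) ^ i * L z = (z - w) ^ j * K z"
  shows "i = j"
proof -
  have False if L: "L holomorphic_on ball 0 1" and K: "K holomorphic_on ball 0 1" and Lw: "L w \<noteq> 0" and ij: "i < j"
    and eq: "\<And>z. cmod z < 1 \<Longrightarrow> (z - w) ^ i * L z = (z - w) ^ j * K z" for L K i j
  proof -
    have e: "L z = (z - w) ^ (j - i) * K z" if "cmod z < 1" "z \<noteq> w" for z
    proof -
      have "(z - w) ^ i * L z = (z - w) ^ i * ((z - w) ^ (j - i) * K z)"
        using eq[OF that(1)] ij by (simp add: mult.assoc[symmetric] power_add[symmetric])
      then show ?thesis using that(2) by simp
    qed
    have w: "w \<in> ball 0 1" using assms by simp
    have "isCont L w" "isCont K w"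
      using L K w holomorphic_on_imp_differentiable_at open_ball field_differentiable_imp_continuous_at by blast+
    then have "isCont L w" "isCont (\<lambda>z. (z - w) ^ (j - i) * K z) w" by (auto intro!: continuous_intros)
    then have c1: "L \<midarrow>w\<rightarrow> L w" and c2: "(\<lambda>z. (z - w) ^ (j - i) * K z) \<midarrow>w\<rightarrow> (w - w) ^ (j - i) * K w"
      unfolding isCont_def .
    have "\<forall>\<^sub>F z in at w. L z = (z - w) ^ (j - i) * K z"
      using eventually_at_in_open[OF open_ball w] by eventually_elim (auto simp: e)
    from tendsto_cong[OF this] c1 c2 have "L w = (w - w) ^ (j - i) * K w"
      by (metis LIM_unique)
    then show False using Lw ij by simp
  qed
  from this[of L K i j] this[of K L j i] show ?thesis using assms by (metis linorder_neqE_nat)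
qed

lemma square_order_even:
  assumes g: "g holomorphic_on ball 0 1" and K: "K holomorphic_on ball 0 1" "K w \<noteq> 0" and w: "cmod w < 1"
    and eq: "\<And>z. cmod z < 1 \<Longrightarrow> (g z)\<^sup>2 = (z - w) ^ N * K z"
  shows "even N"
proof (cases "g w = 0")
  case False
  have "(\<lambda>z. (g z)\<^sup>2) holomorphic_on ball 0 1" by (intro holomorphic_intros g)
  moreover have "(g w)\<^sup>2 \<noteq> 0" using False by simp
  moreover have "(z - w) ^ 0 * (g z)\<^sup>2 = (z - w) ^ N * K z" if "cmod z < 1" for z using eq[OF that] by simp
  ultimately have "0 = N" using factor_order_unique[of "\<lambda>z. (g z)\<^sup>2" K w 0 N] K w by blast
  then show ?thesis by simp
next
  case True
  have "\<exists>z0. cmod z0 < 1 \<and> g z0 \<noteq> 0"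
  proof (rule ccontr)
    assume "\<not> ?thesis"
    then have "K z = 0" if "cmod z < 1" "z \<noteq> w" for z using eq[OF that(1)] that by auto
    moreover have "isCont K w"
      using K w holomorphic_on_imp_differentiable_at open_ball field_differentiable_imp_continuous_at
      by (metis mem_ball_0)
    moreover have "\<forall>\<^sub>F z in at w. K z = 0"
      using eventually_at_in_open[of "ball 0 1" w] w calculation(1) by (auto elim!: eventually_mono)
    ultimately have "K w = 0" by (metis isCont_def tendsto_eventually LIM_unique)
    then show False using K by simp
  qed
  then obtain z0 where z0: "cmod z0 < 1" "g z0 \<noteq> 0" by auto
  obtain n G where G: "0 < n" "G holomorphic_on ball 0 1" "\<And>z. cmod z < 1 \<Longrightarrow> g z = (z - w) ^ n * G z" "G w \<noteq> 0"
    using zero_factor[OF g w True z0] by blast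
  have "(\<lambda>z. (G z)\<^sup>2) holomorphic_on ball 0 1" by (intro holomorphic_intros G)
  moreover have "(G w)\<^sup>2 \<noteq> 0" using G by simp
  moreover have "(z - w) ^ (n * 2) * (G z)\<^sup>2 = (z - w) ^ N * K z" if "cmod z < 1" for z
    unfolding eq[OF that, symmetric] G(3)[OF that] by (simp add: power_mult power_mult_distrib)
  ultimately have "n * 2 = N" using factor_order_unique[of "\<lambda>z. (G z)\<^sup>2" K w "n * 2" N] K w by blast
  then show ?thesis by auto
qed

text \<open>A smaller disc contains finitely many zeros. They are divided out one at a time, each
  with an even exponent, until a zero-free function is left. The roots so found are then glued over
  all radii below 1.\<close>

lemma even_zeros_has_sqrt:
  assumes f: "f holomorphic_on ball 0 1" and z0: "cmod z0 < 1" "f z0 \<noteq> 0"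
    and ev: "\<And>p n G. cmod p < 1 \<Longrightarrow> G holomorphic_on ball 0 1 \<Longrightarrow> G p \<noteq> 0 \<Longrightarrow>
               (\<And>z. cmod z < 1 \<Longrightarrow> f z = (z - p) ^ n * G z) \<Longrightarrow> even n"
  shows "has_sqrt f"
proof -
  have loc: "\<exists>g. g holomorphic_on ball 0 r \<and> (\<forall>z\<in>ball 0 r. f z = (g z)\<^sup>2)"
    if r: "r < 1" "finite {z\<in>cball 0 r. f z = 0}"
      "f holomorphic_on ball 0 1" "cmod z0 < 1" "f z0 \<noteq> 0"
      "\<And>p n G. cmod p < 1 \<Longrightarrow> G holomorphic_on ball 0 1 \<Longrightarrow> G p \<noteq> 0 \<Longrightarrow>
               (\<And>z. cmod z < 1 \<Longrightarrow> f z = (z - p) ^ n * G z) \<Longrightarrow> even n" for f r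
    using r(2-)
  proof (induction "card {z\<in>cball 0 r. f z = 0}" arbitrary: f)
    case 0
    then have "f z \<noteq> 0" if "z \<in> ball 0 r" for z using that by auto
    moreover have "f holomorphic_on ball 0 r"
      using holomorphic_on_subset[OF 0(3), of "ball 0 r"] r(1) by (simp add: subset_ball)
    ultimately obtain g where "g holomorphic_on ball 0 r" "\<And>z. z \<in> ball 0 r \<Longrightarrow> f z = (g z)\<^sup>2"
      using contractible_imp_holomorphic_sqrt[of f "ball 0 r", OF _ convex_imp_contractible[OF convex_ball]] by blast
    then show ?case by blast
  next
    case (Suc k)
    from Suc(2) have "{z\<in>cball 0 r. f z = 0} \<noteq> {}" by (metis card.empty nat.distinct(1))
    then obtain p where p: "cmod p \<le> r" "f p = 0" by auto
    have pn: "cmod p < 1" using p r by simp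
    obtain n G where G: "0 < n" "G holomorphic_on ball 0 1" "\<And>z. cmod z < 1 \<Longrightarrow> f z = (z - p) ^ n * G z" "G p \<noteq> 0"
      using zero_factor[OF Suc(4) pn p(2) Suc(5,6)] by blast
    have en: "even n" using Suc(7)[OF pn G(2) G(4) G(3)] .
    have zs: "{z\<in>cball 0 r. f z = 0} = insert p {z\<in>cball 0 r. G z = 0}"
      using G(1,3) p r(1) by auto
    have pz: "p \<notin> {z\<in>cball 0 r. G z = 0}" using G by auto
    have fin: "finite {z\<in>cball 0 r. G z = 0}" using Suc(3) zs by simp
    have "k = card {z\<in>cball 0 r. G z = 0}" using Suc(2) zs pz fin by simp
    then have "\<exists>g. g holomorphic_on ball 0 r \<and> (\<forall>z\<in>ball 0 r. G z = (g z)\<^sup>2)"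
    proof (rule Suc(1)[OF _ fin G(2) Suc(5)])
      show "G z0 \<noteq> 0" using G(3)[OF Suc(5)] Suc(6) by auto
      fix q m H assume H: "cmod q < 1" "H holomorphic_on ball 0 1" "H q \<noteq> 0"
         "\<And>z. cmod z < 1 \<Longrightarrow> G z = (z - q) ^ m * H z"
      show "even m"
      proof (cases "q = p")
        case True
        then have "m = 0" using H(4)[OF pn] G(4) by (cases m) auto
        then show ?thesis by simp
      next
        case False
        show ?thesis
        proof (rule Suc(7)[OF H(1)])
          show "(\<lambda>z. (z - p) ^ n * H z) holomorphic_on ball 0 1" by (intro holomorphic_intros H)
          show "(q - p) ^ n * H q \<noteq> 0" using False H by simp
          show "f z = (z - q) ^ m * ((z - p) ^ n * H z)" if "cmod z < 1" for z
            using G(3)[OF that] H(4)[OF that] by simp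
        qed
      qed
    qed
    then obtain g where g: "g holomorphic_on ball 0 r" "\<And>z. z \<in> ball 0 r \<Longrightarrow> G z = (g z)\<^sup>2" by auto
    have "f z = ((z - p) ^ (n div 2) * g z)\<^sup>2" if "z \<in> ball 0 r" for z
      using G(3)[of z] g(2)[OF that] that r(1) en
      by (simp add: power_mult_distrib power_mult[symmetric])
    moreover have "(\<lambda>z. (z - p) ^ (n div 2) * g z) holomorphic_on ball 0 r" by (intro holomorphic_intros g)
    ultimately show ?case by blast
  qed
  have fin: "finite {z\<in>cball 0 r. f z = 0}" if "r < 1" for r
  proof (cases "\<exists>z. cmod z < 1 \<and> f z = 0")
    case True
    then have "\<not> f constant_on ball 0 1" using z0 unfolding constant_on_def by (metis mem_ball_0)
    moreover have "cball 0 r \<subseteq> ball (0::complex) 1" using that by auto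
    ultimately show ?thesis
      using holomorphic_compact_finite_zeros[OF f open_ball connected_ball compact_cball] by blast
  next
    case False
    then have "{z\<in>cball 0 r. f z = 0} = {}" using that by auto
    then show ?thesis by (simp only: finite.emptyI)
  qed
  \<comment> \<open>A root is determined up to sign, so prescribing its value at \<open>z0\<close>,
    where \<open>f\<close> is nonzero, makes the roots on different discs agree.\<close>
  have loc': "\<exists>g. g holomorphic_on ball 0 r \<and> (\<forall>z\<in>ball 0 r. f z = (g z)\<^sup>2) \<and> g z0 = csqrt (f z0)"
    if r: "cmod z0 < r" "r < 1" for r
  proof -
    have "\<exists>g. g holomorphic_on ball 0 r \<and> (\<forall>z\<in>ball 0 r. f z = (g z)\<^sup>2)"
      by (rule loc[OF r(2) fin[OF r(2)] f z0]) (rule ev)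
    then obtain g where g: "g holomorphic_on ball 0 r" "\<And>z. z \<in> ball 0 r \<Longrightarrow> f z = (g z)\<^sup>2" by blast
    have "(g z0)\<^sup>2 = (csqrt (f z0))\<^sup>2" using g(2)[of z0] r by simp
    then consider "g z0 = csqrt (f z0)" | "- g z0 = csqrt (f z0)" unfolding power2_eq_iff by fastforce
    then show ?thesis
    proof cases
      case 1 then show ?thesis using g by blast
    next
      case 2
      then show ?thesis using g by (intro exI[of _ "\<lambda>z. - g z"]) (auto intro: holomorphic_intros)
    qed
  qed
  then have "\<forall>r. \<exists>g. cmod z0 < r \<and> r < 1 \<longrightarrow> g holomorphic_on ball 0 r \<and> (\<forall>z\<in>ball 0 r. f z = (g z)\<^sup>2) \<and> g z0 = csqrt (f z0)"
    by blast
  from choice[OF this] obtain g where g0: "\<And>r. cmod z0 < r \<and> r < 1 \<longrightarrow>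
     g r holomorphic_on ball 0 r \<and> (\<forall>z\<in>ball 0 r. f z = (g r z)\<^sup>2) \<and> g r z0 = csqrt (f z0)" by blast
  have g: "g r holomorphic_on ball 0 r" "g r z0 = csqrt (f z0)" if "cmod z0 < r" "r < 1" for r
    using g0[of r] that by blast+
  have g2: "f z = (g r z)\<^sup>2" if "cmod z0 < r" "r < 1" "cmod z < r" for r z
  proof -
    have "\<forall>z\<in>ball 0 r. f z = (g r z)\<^sup>2" using g0[of r] that by blast
    from bspec[OF this, of z] show ?thesis using that(3) by (simp only: mem_ball_0)
  qed
  have un: "g r z = g s z" if "cmod z0 < r" "r < 1" "r \<le> s" "s < 1" "cmod z < r" for r s z
  proof (rule holomorphic_sqrt_unique[of "ball 0 r" "g r" "g s" z0])
    show "g s holomorphic_on ball 0 r" using g(1)[of s] that by (auto elim!: holomorphic_on_subset)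
    show "(g r z)\<^sup>2 = (g s z)\<^sup>2" if "z \<in> ball 0 r" for z
    proof -
      have "cmod z < r" "cmod z < s" "cmod z0 < s" using that \<open>r \<le> s\<close> \<open>cmod z0 < r\<close> by auto
      then show ?thesis using g2[OF \<open>cmod z0 < r\<close> \<open>r < 1\<close>, of z] g2[OF _ \<open>s < 1\<close>, of z] by metis
    qed
    show "g r z0 = g s z0" "g r z0 \<noteq> 0" using g(2)[of r] g(2)[of s] that z0(2) by auto
    show "z \<in> ball 0 r" "z0 \<in> ball 0 r" using that by auto
  qed (use g(1)[OF that(1,2)] in auto)
  \<comment> \<open>A radius below 1 and beyond both \<open>z\<close> and \<open>z0\<close>.\<close>
  define R where "R z = (1 + max (cmod z) (cmod z0)) / 2" for z :: complex
  have R: "cmod z < R z" "cmod z0 < R z" "R z < 1" if "cmod z < 1" for z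
    using that z0 by (auto simp: R_def max_def)
  define h where "h z = g (R z) z" for z
  have hg: "h z = g r z" if "cmod z0 < r" "r < 1" "cmod z < r" for r z
  proof -
    have "cmod z < 1" using that by simp
    note Rz = R[OF this]
    show ?thesis
    proof (cases "r \<le> R z")
      case True
      show ?thesis unfolding h_def using un[OF that(1,2) True Rz(3) that(3)] by (rule sym)
    next
      case False
      then show ?thesis unfolding h_def using un[OF Rz(2,3) less_imp_le that(2) Rz(1)] by simp
    qed
  qed
  have "h holomorphic_on ball 0 1"
    unfolding holomorphic_on_def
  proof
    fix z :: complex assume "z \<in> ball 0 1"
    then have z: "cmod z < 1" by simp
    have "h holomorphic_on ball 0 (R z)"
      using holomorphic_transform[OF g(1)[OF R(2,3)[OF z]]] hg[OF R(2,3)[OF z]] by simp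
    then have "h field_differentiable at z"
      using holomorphic_on_imp_differentiable_at[OF _ open_ball] R(1)[OF z] by simp
    then show "h field_differentiable at z within ball 0 1" by (rule field_differentiable_at_within)
  qed
  moreover have "f z = (h z)\<^sup>2" if "cmod z < 1" for z
    unfolding h_def using g2[OF R(2,3)[OF that] R(1)[OF that]] .
  ultimately show ?thesis unfolding has_sqrt_def by blast
qed

section \<open>The universal ramified map\<close>

text \<open>Fixing the base point makes factorisations compose and lets Schwarz's lemma bound the
  derivative of \<open>h\<close> at 0.\<close>

definition factors_through :: "(complex \<Rightarrow> complex) \<Rightarrow> (complex \<Rightarrow> complex) \<Rightarrow> bool" where
  "factors_through F f \<longleftrightarrow> (\<exists>h. disc_map h \<and> h 0 = 0 \<and> (\<forall>z. cmod z < 1 \<longrightarrow> f z = F (h z)))"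

text \<open>The image is a round disc that misses \<open>A\<close>, so each \<open>f - a\<close> is
  zero-free and has a root. This map keeps derivatives of competitors away from 0.\<close>

lemma ramified_affine:
  assumes "cmod b < 1" "ball b e \<inter> A = {}" "0 < d" "d \<le> e" "d \<le> 1 - cmod b"
  shows "ramified A (\<lambda>z. b + of_real d * z)"
  unfolding ramified_def
proof (intro conjI ballI)
  have lt: "cmod (of_real d * z) < d" if "cmod z < 1" for z using that assms by (simp add: norm_mult)
  show "disc_map (\<lambda>z. b + of_real d * z)" unfolding disc_map_def
  proof (intro conjI allI impI)
    show "(\<lambda>z. b + of_real d * z) holomorphic_on ball 0 1" by (intro holomorphic_intros)
    show "cmod (b + of_real d * z) < 1" if "cmod z < 1" for z
      using norm_triangle_ineq[of b "of_real d * z"] lt[OF that] assms(5) by linarith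
  qed
  fix a assume "a \<in> A"
  then have "dist b a \<ge> d" using assms by (metis disjoint_iff mem_ball not_less order.trans)
  then have "b + of_real d * z - a \<noteq> 0" if "cmod z < 1" for z
    using lt[OF that] by (auto simp: dist_norm algebra_simps)
  then show "has_sqrt (\<lambda>z. b + of_real d * z - a)"
    by (intro has_sqrt_nonvanishing) (auto intro!: holomorphic_intros)
qed

text \<open>Squaring, moved so that its critical value is \<open>p\<close>; the inner shift to a
  root of \<open>- p\<close> makes 0 go to 0.\<close>

definition double_cover :: "complex \<Rightarrow> complex \<Rightarrow> complex" where
  "double_cover p z = mob (mshift p) ((mob (mshift (csqrt (- p))) z)\<^sup>2)"

lemma norm_csqrt_less: "cmod p < 1 \<Longrightarrow> cmod (csqrt p) < 1"
  by (simp add: norm_csqrt)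

text \<open>Equality in Schwarz's lemma would make the map a rotation, but it is not injective: the
  points sent to \<open>1/2\<close> and \<open>- 1/2\<close> by the inner shift have the same
  image.\<close>

lemma double_cover_props:
  assumes p: "cmod p < 1"
  shows "disc_map (double_cover p)" "double_cover p 0 = 0" "cmod (deriv (double_cover p) 0) < 1"
proof -
  let ?s = "csqrt (- p)"
  have s: "cmod ?s < 1" using norm_csqrt_less[of "- p"] p by simp
  have sq: "disc_map (\<lambda>z. z\<^sup>2)"
    unfolding disc_map_def by (auto intro!: holomorphic_intros simp: norm_power power_less_one_iff)
  show d: "disc_map (double_cover p)"
    unfolding double_cover_def[abs_def]
    using disc_map_compose[OF disc_map_mob[OF mshift_su11[OF p]] disc_map_compose[OF sq disc_map_mob[OF mshift_su11[OF s]]]] .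
  show 0: "double_cover p 0 = 0"
    using p s by (simp add: double_cover_def mob_mshift)
  have le: "cmod (deriv (double_cover p) 0) \<le> 1"
    using Schwarz_Lemma(2)[OF disc_map_holo[OF d] 0 disc_map_norm[OF d], of 0] by simp
  have "cmod (deriv (double_cover p) 0) \<noteq> 1"
  proof
    assume "cmod (deriv (double_cover p) 0) = 1"
    then obtain c where c: "\<And>z. cmod z < 1 \<Longrightarrow> double_cover p z = c * z" "cmod c = 1"
      using Schwarz_Lemma(3)[OF disc_map_holo[OF d] 0 disc_map_norm[OF d], of 0] by auto
    define u v where "u = mob (mshift (- ?s)) (1/2)" and "v = mob (mshift (- ?s)) (- 1/2)"
    have uv: "cmod u < 1" "cmod v < 1"
      unfolding u_def v_def using mob_in_disc[OF mshift_su11[of "- ?s"]] s by auto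
    have mu: "mob (mshift ?s) u = 1/2" "mob (mshift ?s) v = - 1/2"
      unfolding u_def v_def using mob_mshift_cancel(1)[OF s] by auto
    then have "double_cover p u = double_cover p v" unfolding double_cover_def mu by (simp add: power2_eq_square)
    then have "u = v" using c uv by auto
    then show False using mu by simp
  qed
  then show "cmod (deriv (double_cover p) 0) < 1" using le by simp
qed

text \<open>Moving \<open>p\<close> to 0 turns the root of \<open>h - p\<close> into a root
  \<open>k\<close> of the moved map; its sign is chosen so that \<open>k 0\<close> is the root of
  \<open>- p\<close> used in \<open>double_cover\<close>.\<close>

lemma double_cover_lift:
  assumes p: "cmod p < 1" and h: "disc_map h" "h 0 = 0" and sq: "has_sqrt (\<lambda>z. h z - p)"
  shows "factors_through (double_cover p) h"
proof -
  let ?s = "csqrt (- p)"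
  have s: "cmod ?s < 1" using norm_csqrt_less[of "- p"] p by simp
  have np: "cmod (- p) < 1" using p by simp
  have "ramified {p} h" using h sq by (simp add: ramified_def)
  from ramified_mob[OF this mshift_su11[OF np]] p
  have "has_sqrt (\<lambda>z. mob (mshift (- p)) (h z))" by (auto simp: ramified_def)
  then obtain k where k: "k holomorphic_on ball 0 1" "\<And>z. cmod z < 1 \<Longrightarrow> mob (mshift (- p)) (h z) = (k z)\<^sup>2"
    unfolding has_sqrt_def by blast
  have "(k 0)\<^sup>2 = ?s\<^sup>2" using k(2)[of 0] h p by simp
  then have "\<exists>k. k holomorphic_on ball 0 1 \<and> (\<forall>z. cmod z < 1 \<longrightarrow> mob (mshift (- p)) (h z) = (k z)\<^sup>2) \<and> k 0 = ?s"
    unfolding power2_eq_iff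
  proof
    assume "k 0 = ?s" then show ?thesis using k by blast
  next
    assume "k 0 = - ?s" then show ?thesis using k
      by (intro exI[of _ "\<lambda>z. - k z"]) (auto intro: holomorphic_intros)
  qed
  then obtain k where k: "k holomorphic_on ball 0 1" "\<And>z. cmod z < 1 \<Longrightarrow> mob (mshift (- p)) (h z) = (k z)\<^sup>2" "k 0 = ?s"
    by blast
  have kd: "disc_map k" unfolding disc_map_def
  proof (intro conjI allI impI k(1))
    fix z :: complex assume z: "cmod z < 1"
    have "cmod ((k z)\<^sup>2) < 1" unfolding k(2)[OF z, symmetric]
      using mob_in_disc[OF mshift_su11[OF np] disc_map_norm[OF h(1) z]] .
    then show "cmod (k z) < 1" by (simp add: norm_power power_less_one_iff)
  qed
  let ?h = "\<lambda>z. mob (mshift (- ?s)) (k z)"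
  have "disc_map ?h" using disc_map_compose[OF disc_map_mob[OF mshift_su11] kd] s by simp
  moreover have "?h 0 = 0" using k(3) s by simp
  moreover have "h z = double_cover p (?h z)" if z: "cmod z < 1" for z
    unfolding double_cover_def mob_mshift_cancel(1)[OF s disc_map_norm[OF kd z]] k(2)[OF z, symmetric]
    using mob_mshift_cancel(1)[OF p disc_map_norm[OF h(1) z]] by simp
  ultimately show ?thesis unfolding factors_through_def by blast
qed

theorem universal_ramified_map:
  assumes b: "cmod b < 1" and e: "0 < e" "ball b e \<inter> A = {}"
  shows "\<exists>F. ramified A F \<and> F 0 = b \<and> deriv F 0 \<noteq> 0 \<and> (\<forall>f. ramified A f \<and> f 0 = b \<longrightarrow> factors_through F f)"
proof -
  define \<B> where "\<B> = {B. disc_map B \<and> B 0 = b \<and> (\<forall>f. ramified A f \<and> f 0 = b \<longrightarrow> factors_through B f)}"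
  have B0: "mob (mshift b) \<in> \<B>"
  proof -
    have "factors_through (mob (mshift b)) f" if f: "ramified A f" "f 0 = b" for f
      unfolding factors_through_def
    proof (intro exI conjI allI impI)
      note fd = ramified_disc_map[OF f(1)]
      show "disc_map (\<lambda>z. mob (mshift (- b)) (f z))"
        using disc_map_compose[OF disc_map_mob[OF mshift_su11] fd] b by simp
      show "mob (mshift (- b)) (f 0) = 0" using f b by simp
      show "f z = mob (mshift b) (mob (mshift (- b)) (f z))" if "cmod z < 1" for z
        using mob_mshift_cancel(1)[OF b disc_map_norm[OF fd that]] by simp
    qed
    then show ?thesis unfolding \<B>_def using b disc_map_mob[OF mshift_su11[OF b]] by simp
  qed
  define d where "d = min e (1 - cmod b)"
  have d: "0 < d" "d \<le> e" "d \<le> 1 - cmod b" using b e by (auto simp: d_def)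
  \<comment> \<open>The affine disc factors through \<open>B\<close> by a map fixing 0, whose
    derivative has modulus at most 1 by Schwarz; hence its slope \<open>d\<close> is a common lower
    bound.\<close>
  have low: "d \<le> cmod (deriv B 0)" if B: "B \<in> \<B>" for B
  proof -
    have "factors_through B (\<lambda>z. b + of_real d * z)"
      using B ramified_affine[OF b e(2) d] by (simp add: \<B>_def)
    then obtain h where h: "disc_map h" "h 0 = 0" "\<And>z. cmod z < 1 \<Longrightarrow> b + of_real d * z = B (h z)"
      unfolding factors_through_def by blast
    have "deriv (\<lambda>z. b + of_real d * z) 0 = deriv (\<lambda>z. B (h z)) 0"
      by (rule deriv_cong_disc) (use h in auto)
    moreover have "deriv (\<lambda>z. b + of_real d * z) 0 = of_real d"
      by (rule DERIV_imp_deriv) (auto intro!: derivative_eq_intros)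
    ultimately have "of_real d = deriv B 0 * deriv h 0"
      using disc_map_chain[OF _ h(1), of B 0] B h(2) by (simp add: \<B>_def)
    then have "cmod (complex_of_real d) = cmod (deriv B 0) * cmod (deriv h 0)" by (metis norm_mult)
    then have "d = cmod (deriv B 0) * cmod (deriv h 0)" using d(1) by simp
    moreover have "cmod (deriv h 0) \<le> 1"
      using Schwarz_Lemma(2)[OF disc_map_holo[OF h(1)] h(2) disc_map_norm[OF h(1)], of 0] by simp
    ultimately show ?thesis by (metis mult_left_le norm_ge_zero)
  qed
  define m where "m = Inf ((\<lambda>B. cmod (deriv B 0)) ` \<B>)"
  have bdd: "bdd_below ((\<lambda>B. cmod (deriv B 0)) ` \<B>)" by (rule bdd_belowI[of _ d]) (use low in auto)
  have m_le: "m \<le> cmod (deriv B 0)" if "B \<in> \<B>" for B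
    unfolding m_def using bdd that by (intro cInf_lower) auto
  have "\<exists>B\<in>\<B>. cmod (deriv B 0) < m + 1 / Suc n" for n :: nat
    using cInf_lessD[of "(\<lambda>B. cmod (deriv B 0)) ` \<B>" "m + 1 / Suc n"] B0 unfolding m_def by auto
  then have "\<forall>n. \<exists>B. B \<in> \<B> \<and> cmod (deriv B 0) < m + 1 / Suc n" by blast
  from choice[OF this] obtain B where B: "\<And>n. B n \<in> \<B>" "\<And>n. cmod (deriv (B n) 0) < m + 1 / Suc n" by blast
  have Bd: "disc_map (B n)" "B n 0 = b" "\<And>f. ramified A f \<Longrightarrow> f 0 = b \<Longrightarrow> factors_through (B n) f" for n
    using B(1)[of n] by (auto simp: \<B>_def)
  obtain F r where F: "F holomorphic_on ball 0 1" "strict_mono (r :: nat \<Rightarrow> nat)"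
    "\<forall>z. cmod z < 1 \<longrightarrow> (\<lambda>n. B (r n) z) \<longlonglongrightarrow> F z"
    "\<forall>K. compact K \<longrightarrow> K \<subseteq> ball 0 1 \<longrightarrow> uniform_limit K (\<lambda>n. B (r n)) F sequentially"
    using montel_disc_map[of B, OF Bd(1)] by blast
  have F0: "F 0 = b"
    using F(3)[rule_format, of 0] Bd(2) by (simp add: LIMSEQ_const_iff)
  have Fd: "disc_map F"
    by (rule limit_disc_map[OF F(1), of "\<lambda>n. B (r n)" 0]) (use F Bd F0 b in auto)
  have dF: "(\<lambda>n. deriv (B (r n)) 0) \<longlonglongrightarrow> deriv F 0"
    by (rule deriv_limit) (use F Bd disc_map_holo in auto)
  have "cmod (deriv F 0) \<le> m"
  proof (rule tendsto_le[OF _ _ tendsto_norm[OF dF]])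
    show "(\<lambda>n. m + 1 / Suc (r n)) \<longlonglongrightarrow> m"
      using tendsto_add[OF tendsto_const LIMSEQ_subseq_LIMSEQ[OF lim_inverse_n' F(2)], of m]
        LIMSEQ_subseq_LIMSEQ[OF tendsto_add[OF tendsto_const[of m] LIMSEQ_Suc[OF lim_inverse_n']] F(2)]
      by (simp add: o_def)
    show "\<forall>\<^sub>F n in sequentially. cmod (deriv (B (r n)) 0) \<le> m + 1 / real (Suc (r n))"
      using B(2) less_imp_le by (intro always_eventually) blast
  qed simp
  have FB: "factors_through F f" if f: "ramified A f" "f 0 = b" for f
  proof -
    have "\<forall>n. \<exists>h. disc_map h \<and> h 0 = 0 \<and> (\<forall>z. cmod z < 1 \<longrightarrow> f z = B (r n) (h z))"
      using Bd(3)[OF f] unfolding factors_through_def by blast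
    from choice[OF this] obtain h where h: "\<And>n. disc_map (h n)" "\<And>n. h n 0 = 0"
       "\<And>n z. cmod z < 1 \<Longrightarrow> f z = B (r n) (h n z)" by blast
    obtain g s where g: "g holomorphic_on ball 0 1" "strict_mono (s :: nat \<Rightarrow> nat)"
      "\<forall>z. cmod z < 1 \<longrightarrow> (\<lambda>n. h (s n) z) \<longlonglongrightarrow> g z"
      using montel_disc_map[of h, OF h(1)] by blast
    have g0: "g 0 = 0"
      using g(3)[rule_format, of 0] h(2) by (simp add: LIMSEQ_const_iff)
    have gd: "disc_map g"
      by (rule limit_disc_map[OF g(1), of "\<lambda>n. h (s n)" 0]) (use g h g0 in auto)
    have "f z = F (g z)" if z: "cmod z < 1" for z
    proof -
      have u: "uniform_limit K (\<lambda>n. B (r (s n))) F sequentially" if "compact K" "K \<subseteq> ball 0 1" for K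
        using F(4)[rule_format, OF that] filterlim_subseq[OF g(2)]
        by (rule filterlim_compose[where g = "\<lambda>n. B (r n)" for r, unfolded o_def]) 
      have "(\<lambda>n. B (r (s n)) (h (s n) z)) \<longlonglongrightarrow> F (g z)"
        by (rule limit_at_moving_point[OF u g(3)[rule_format, OF z] disc_map_norm[OF gd z] F(1)])
      then show ?thesis unfolding h(3)[OF z, symmetric] by (simp add: LIMSEQ_const_iff)
    qed
    then show ?thesis unfolding factors_through_def using gd g0 by blast
  qed
  have "F \<in> \<B>" using Fd F0 FB by (simp add: \<B>_def)
  then have dnz: "deriv F 0 \<noteq> 0" using low d(1) by fastforce
  have "has_sqrt (\<lambda>z. F z - a)" if a: "a \<in> A" for a
  proof (rule ccontr)
    assume no: "\<not> has_sqrt (\<lambda>z. F z - a)"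
    have ab: "b \<noteq> a" using e a by (metis centre_in_ball disjoint_iff)
    have "\<exists>p n G. cmod p < 1 \<and> G holomorphic_on ball 0 1 \<and> G p \<noteq> 0 \<and>
        (\<forall>z. cmod z < 1 \<longrightarrow> F z - a = (z - p) ^ n * G z) \<and> odd n"
    proof (rule ccontr)
      assume "\<not> ?thesis"
      then have "has_sqrt (\<lambda>z. F z - a)"
        by (intro even_zeros_has_sqrt[of _ 0]) (use F0 ab in \<open>auto intro!: holomorphic_intros F(1)\<close>)
      then show False using no by simp
    qed
    then obtain p n G where p: "cmod p < 1" "G holomorphic_on ball 0 1" "G p \<noteq> 0"
        "\<And>z. cmod z < 1 \<Longrightarrow> F z - a = (z - p) ^ n * G z" "odd n" by blast
    have "F p = a" using p(4)[OF p(1)] p(5) by (cases n) auto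
    then have p0: "p \<noteq> 0" using F0 ab by auto
    note dc = double_cover_props[OF p(1)]
    \<comment> \<open>Write \<open>f = F o h\<close>. At a zero of \<open>h - p\<close> of order
      \<open>k\<close> the order of \<open>f - a\<close> is \<open>k * n\<close>. It is even while
      \<open>n\<close> is odd, so \<open>k\<close> is even, \<open>h - p\<close> is a square, and
      \<open>h\<close> lifts to the double cover.\<close>
    have "factors_through (\<lambda>z. F (double_cover p z)) f" if f: "ramified A f" "f 0 = b" for f
    proof -
      obtain h where h: "disc_map h" "h 0 = 0" "\<And>z. cmod z < 1 \<Longrightarrow> f z = F (h z)"
        using FB[OF f] unfolding factors_through_def by blast
      obtain g where g: "g holomorphic_on ball 0 1" "\<And>z. cmod z < 1 \<Longrightarrow> f z - a = (g z)\<^sup>2"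
        using f(1) a unfolding ramified_def has_sqrt_def by blast
      have "has_sqrt (\<lambda>z. h z - p)"
      proof (rule even_zeros_has_sqrt[of _ 0])
        show "(\<lambda>z. h z - p) holomorphic_on ball 0 1" by (intro holomorphic_intros disc_map_holo h)
        show "h 0 - p \<noteq> 0" using h p0 by simp
        fix w k H assume w: "cmod w < 1" and H: "H holomorphic_on ball 0 1" "H w \<noteq> 0"
          "\<And>z. cmod z < 1 \<Longrightarrow> h z - p = (z - w) ^ k * H z"
        show "even k"
        proof (cases "k = 0")
          case False
          then have hw: "h w = p" using H(3)[OF w] by (simp add: zero_power)
          have Gh: "(\<lambda>z. G (h z)) holomorphic_on ball 0 1"
            using holomorphic_on_compose_gen[OF disc_map_holo[OF h(1)] p(2)] disc_map_norm[OF h(1)]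
            by (force simp: o_def)
          have "even (k * n)"
          proof (rule square_order_even[OF g(1), of "\<lambda>z. H z ^ n * G (h z)"])
            show "(\<lambda>z. H z ^ n * G (h z)) holomorphic_on ball 0 1" by (intro holomorphic_intros H Gh)
            show "H w ^ n * G (h w) \<noteq> 0" using H hw p by simp
            show "(g z)\<^sup>2 = (z - w) ^ (k * n) * (H z ^ n * G (h z))" if z: "cmod z < 1" for z
              using g(2)[OF z] h(3)[OF z] p(4)[OF disc_map_norm[OF h(1) z]] H(3)[OF z]
              by (simp add: power_mult power_mult_distrib mult.assoc)
          qed (use w in auto)
          then show ?thesis using p(5) by simp
        qed simp
      qed simp
      from double_cover_lift[OF p(1) h(1,2) this]
      obtain k where "disc_map k" "k 0 = 0" "\<And>z. cmod z < 1 \<Longrightarrow> h z = double_cover p (k z)"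
        unfolding factors_through_def by blast
      then show ?thesis unfolding factors_through_def using h(3) by metis
    qed
    then have "(\<lambda>z. F (double_cover p z)) \<in> \<B>"
      using disc_map_compose[OF Fd dc(1)] F0 dc(2) by (simp add: \<B>_def)
    from m_le[OF this] have "m \<le> cmod (deriv F 0) * cmod (deriv (double_cover p) 0)"
      using disc_map_chain[OF Fd dc(1), of 0] dc(2) by (simp add: norm_mult)
    also have "\<dots> < cmod (deriv F 0)" using dc(3) dnz by simp
    finally show False using \<open>cmod (deriv F 0) \<le> m\<close> by simp
  qed
  then have "ramified A F" using Fd by (simp add: ramified_def)
  then show ?thesis using F0 dnz FB by blast
qed

section \<open>Lifting and deck transformations\<close>

text \<open>After \<open>z\<close> and \<open>h z\<close> are moved to 0, both maps have derivative
  of modulus at most 1 there, so a product of modulus 1 means equality in Schwarz's lemma: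
  \<open>h\<close> is a rotation between two shifts.\<close>

lemma disc_automorphism:
  assumes h: "disc_map h" and k: "disc_map k" and z: "cmod z < 1" and kh: "k (h z) = z"
    and d: "cmod (deriv (\<lambda>u. k (h u)) z) = 1"
  shows "\<exists>p\<in>su11. \<forall>u. cmod u < 1 \<longrightarrow> h u = mob p u"
proof -
  define w where "w = h z"
  have w: "cmod w < 1" using disc_map_norm[OF h z] by (simp add: w_def)
  have sm: "disc_map (mob (mshift x))" "disc_map (mob (mshift (- x)))" if "cmod x < 1" for x
    using that by (auto intro!: disc_map_mob mshift_su11)
  define H where "H = (\<lambda>u. mob (mshift (- w)) (h (mob (mshift z) u)))"
  define K where "K = (\<lambda>u. mob (mshift (- z)) (k (mob (mshift w) u)))"
  have Hd: "disc_map H" unfolding H_def by (intro disc_map_compose[OF sm(2)[OF w]] disc_map_compose[OF h] sm z)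
  have Kd: "disc_map K" unfolding K_def by (intro disc_map_compose[OF sm(2)[OF z]] disc_map_compose[OF k] sm w)
  have H0: "H 0 = 0" using z w by (simp add: H_def w_def[symmetric])
  have K0: "K 0 = 0" using z w kh by (simp add: K_def w_def[symmetric])
  have hmd: "cmod (h (mob (mshift z) u)) < 1" if "cmod u < 1" for u
    using disc_map_norm[OF h disc_map_norm[OF sm(1)[OF z] that]] .
  have KH: "K (H u) = mob (mshift (- z)) (k (h (mob (mshift z) u)))" if "cmod u < 1" for u
    unfolding K_def H_def using mob_mshift_cancel(1)[OF w hmd[OF that]] by simp
  have "deriv (\<lambda>u. K (H u)) 0 = deriv (\<lambda>u. mob (mshift (- z)) (k (h (mob (mshift z) u)))) 0"
    by (rule deriv_cong_disc) (auto simp: KH)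
  also have "\<dots> = deriv (mob (mshift (- z))) z * (deriv (\<lambda>u. k (h u)) z * deriv (mob (mshift z)) 0)"
    using disc_map_chain[OF sm(2)[OF z] disc_map_compose[OF disc_map_compose[OF k h] sm(1)[OF z]], of 0]
      disc_map_chain[OF disc_map_compose[OF k h] sm(1)[OF z], of 0] z kh by simp
  also have "\<dots> = (deriv (mob (mshift (- z))) z * deriv (mob (mshift z)) 0) * deriv (\<lambda>u. k (h u)) z" by simp
  also have "deriv (mob (mshift (- z))) z * deriv (mob (mshift z)) 0 = deriv (\<lambda>u. mob (mshift (- z)) (mob (mshift z) u)) 0"
    using disc_map_chain[OF sm(2)[OF z] sm(1)[OF z], of 0] z by simp
  also have "\<dots> = deriv (\<lambda>u. u) 0"
    by (rule deriv_cong_disc) (use mob_mshift_cancel(2)[OF z] in auto)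
  finally have "deriv K 0 * deriv H 0 = deriv (\<lambda>u. k (h u)) z"
    using disc_map_chain[OF Kd Hd, of 0] H0 by simp
  then have "cmod (deriv K 0) * cmod (deriv H 0) = 1" using d by (metis norm_mult)
  moreover have "cmod (deriv K 0) \<le> 1" "cmod (deriv H 0) \<le> 1"
    using Schwarz_Lemma(2)[OF disc_map_holo[OF Kd] K0 disc_map_norm[OF Kd], of 0]
      Schwarz_Lemma(2)[OF disc_map_holo[OF Hd] H0 disc_map_norm[OF Hd], of 0] by auto
  ultimately have "cmod (deriv H 0) = 1"
    by (metis mult_left_le_one_le norm_ge_zero order_antisym)
  then obtain c where c: "\<And>u. cmod u < 1 \<Longrightarrow> H u = c * u" "cmod c = 1"
    using Schwarz_Lemma(3)[OF disc_map_holo[OF Hd] H0 disc_map_norm[OF Hd], of 0] by auto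
  \<comment> \<open>A diagonal matrix acts by the square of its first entry, hence the root of
    \<open>c\<close>.\<close>
  let ?r = "(csqrt c, 0)"
  have r: "?r \<in> su11" using c(2) by (simp add: su11_def norm_csqrt)
  have cc: "csqrt c * cnj (csqrt c) = 1" using r by (simp add: su11_iff)
  have mr: "mob ?r u = c * u" for u
  proof -
    have "csqrt c / cnj (csqrt c) = (csqrt c * csqrt c) / (csqrt c * cnj (csqrt c))"
      using cc by (metis mult_eq_0_iff mult_divide_mult_cancel_left zero_neq_one)
    then have "csqrt c / cnj (csqrt c) = c" unfolding cc by (simp add: power2_eq_square[symmetric])
    moreover have "mob ?r u = csqrt c / cnj (csqrt c) * u" by (simp add: mob_def)
    ultimately show ?thesis by simp
  qed
  let ?p = "mmul (mshift w) (mmul ?r (mshift (- z)))"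
  have zs: "mshift (- z) \<in> su11" using z mshift_su11[of "- z"] by simp
  show ?thesis
  proof (intro bexI[of _ ?p] allI impI)
    show "?p \<in> su11" by (intro mmul_su11 r zs mshift_su11 w)
    fix u :: complex assume u: "cmod u < 1"
    let ?v = "mob (mshift (- z)) u"
    have v: "cmod ?v < 1" using mob_in_disc[OF zs u] .
    have "mob ?p u = mob (mshift w) (c * ?v)"
      using mob_mmul[OF mshift_su11[OF w] mmul_su11[OF r zs] u] mob_mmul[OF r zs u] by (simp add: mr)
    also have "\<dots> = mob (mshift w) (H ?v)" using c(1)[OF v] by simp
    also have "\<dots> = h u" unfolding H_def
      using mob_mshift_cancel(1)[OF z u] mob_mshift_cancel(1)[OF w disc_map_norm[OF h u]] by simp
    finally show "h u = mob ?p u" by simp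
  qed
qed

text \<open>The local model of branching of order 2. The centre may lie in \<open>A\<close> or not:
  \<open>f - a\<close> is visibly a square, and \<open>f - c\<close> has no zero for any other
  \<open>c\<close> in \<open>A\<close>.\<close>

lemma ramified_square_at:
  assumes a: "cmod a < 1" and e: "ball a d \<inter> A \<subseteq> {a}" "0 < d" "d \<le> 1 - cmod a"
  shows "ramified A (\<lambda>z. a + of_real d * z\<^sup>2)"
  unfolding ramified_def
proof (intro conjI ballI)
  have lt: "cmod (of_real d * z\<^sup>2) < d" if "cmod z < 1" for z
    using that e(2) by (simp add: norm_mult norm_power power_less_one_iff)
  have hol: "(\<lambda>z. a + of_real d * z\<^sup>2) holomorphic_on ball 0 1" by (intro holomorphic_intros)
  show "disc_map (\<lambda>z. a + of_real d * z\<^sup>2)" unfolding disc_map_def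
  proof (intro conjI allI impI hol)
    show "cmod (a + of_real d * z\<^sup>2) < 1" if "cmod z < 1" for z
      using norm_triangle_ineq[of a "of_real d * z\<^sup>2"] lt[OF that] e(3) by linarith
  qed
  fix c assume c: "c \<in> A"
  show "has_sqrt (\<lambda>z. a + of_real d * z\<^sup>2 - c)"
  proof (cases "c = a")
    case True
    then show ?thesis unfolding has_sqrt_def using e(2)
      by (intro exI[of _ "\<lambda>z. of_real (sqrt d) * z"])
         (auto intro!: holomorphic_intros simp: power_mult_distrib simp flip: of_real_power)
  next
    case False
    then have "c \<notin> ball a d" using e(1) c by blast
    then have "a + of_real d * z\<^sup>2 - c \<noteq> 0" if "cmod z < 1" for z
      using lt[OF that] by (auto simp: dist_norm algebra_simps)
    then show ?thesis by (intro has_sqrt_nonvanishing) (auto intro!: holomorphic_intros)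
  qed
qed

lemma square_nonconstant:
  assumes "0 < d" shows "\<not> (\<lambda>u. x + complex_of_real d * u\<^sup>2) constant_on ball 0 1"
proof
  assume "(\<lambda>u. x + complex_of_real d * u\<^sup>2) constant_on ball 0 1"
  then obtain y where y: "\<And>u. cmod u < 1 \<Longrightarrow> x + complex_of_real d * u\<^sup>2 = y" by (auto simp: constant_on_def)
  have "x + complex_of_real d * 0\<^sup>2 = x + complex_of_real d * (1/2)\<^sup>2" using y[of 0] y[of "1/2"] by simp
  then show False using assms by simp
qed

text \<open>Universality is assumed only at the base point 0, whose image avoids \<open>A\<close>;
  lifting through other points is derived from it.\<close>

locale ramified_cover =
  fixes A :: "complex set" and F :: "complex \<Rightarrow> complex"
  assumes A_disc: "A \<subseteq> ball 0 1"
    and A_discrete: "\<And>z. cmod z < 1 \<Longrightarrow> \<exists>e>0. ball z e \<inter> A \<subseteq> {z}"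
    and F_ram: "ramified A F" and F0: "F 0 \<notin> A" and dF0: "deriv F 0 \<noteq> 0"
    and F_univ: "\<And>f. ramified A f \<Longrightarrow> f 0 = F 0 \<Longrightarrow> factors_through F f"
begin

lemma Fd: "disc_map F" using F_ram ramified_disc_map by blast

lemma F_norm: "cmod z < 1 \<Longrightarrow> cmod (F z) < 1" using disc_map_norm[OF Fd] .

lemma isolating_radius:
  assumes "cmod z < 1" shows "\<exists>d>0. ball z d \<inter> A \<subseteq> {z} \<and> d \<le> 1 - cmod z"
proof -
  obtain e where e: "e > 0" "ball z e \<inter> A \<subseteq> {z}" using A_discrete[OF assms] by auto
  have "ball z (min e (1 - cmod z)) \<subseteq> ball z e" by auto
  then show ?thesis using e assms by (intro exI[of _ "min e (1 - cmod z)"]) auto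
qed

text \<open>Let \<open>Q\<close> be the universal map based at \<open>F z\<close>. Then
  \<open>F\<close> and \<open>Q\<close> factor through each other, and the composite
  \<open>\<kappa>\<close> fixes 0 with \<open>F o \<kappa> = F\<close>. As \<open>deriv F 0\<close>
  is nonzero, \<open>\<kappa>\<close> has derivative 1 at 0 and is the identity. Hence the base
  point of \<open>Q\<close> corresponds to \<open>z\<close>, and a factorisation of \<open>f\<close>
  through \<open>Q\<close> becomes a lift through \<open>F\<close>.\<close>

lemma lift_generic:
  assumes f: "ramified A f" and w: "cmod w < 1" and z: "cmod z < 1" and fw: "f w = F z" and nA: "F z \<notin> A"
  shows "\<exists>h. disc_map h \<and> h w = z \<and> (\<forall>u. cmod u < 1 \<longrightarrow> f u = F (h u))"
proof -
  define b where "b = F z"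
  have b: "cmod b < 1" using F_norm[OF z] by (simp add: b_def)
  have sm: "disc_map (mob (mshift x))" "disc_map (mob (mshift (- x)))" if "cmod x < 1" for x
    using that by (auto intro!: disc_map_mob mshift_su11)
  obtain e where e: "e > 0" "ball b e \<inter> A \<subseteq> {b}" using A_discrete[OF b] by auto
  then have "ball b e \<inter> A = {}" using nA by (auto simp: b_def)
  from universal_ramified_map[OF b e(1) this]
  obtain Q where Q: "ramified A Q" "Q 0 = b" "\<And>f. ramified A f \<Longrightarrow> f 0 = b \<Longrightarrow> factors_through Q f" by blast
  have "factors_through Q (\<lambda>u. F (mob (mshift z) u))"
    by (rule Q(3)[OF ramified_compose[OF F_ram sm(1)[OF z]]]) (use z in \<open>simp add: b_def\<close>)
  then obtain h where h: "disc_map h" "h 0 = 0" "\<And>u. cmod u < 1 \<Longrightarrow> F (mob (mshift z) u) = Q (h u)"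
    unfolding factors_through_def by blast
  define v where "v = h (mob (mshift (- z)) 0)"
  have mz0: "cmod (mob (mshift (- z)) 0) < 1" using disc_map_norm[OF sm(2)[OF z], of 0] by simp
  have v: "cmod v < 1" unfolding v_def using disc_map_norm[OF h(1) mz0] .
  have Qv: "Q v = F 0" unfolding v_def h(3)[OF mz0, symmetric] using mob_mshift_cancel(1)[OF z, of 0] by simp
  have "factors_through F (\<lambda>u. Q (mob (mshift v) u))"
    by (rule F_univ[OF ramified_compose[OF Q(1) sm(1)[OF v]]]) (use v Qv in simp)
  then obtain k where k: "disc_map k" "k 0 = 0" "\<And>u. cmod u < 1 \<Longrightarrow> Q (mob (mshift v) u) = F (k u)"
    unfolding factors_through_def by blast
  define \<kappa> where "\<kappa> = (\<lambda>u. k (mob (mshift (- v)) (h (mob (mshift (- z)) u))))"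
  have \<kappa>d: "disc_map \<kappa>" unfolding \<kappa>_def
    by (intro disc_map_compose[OF k(1)] disc_map_compose[OF sm(2)[OF v]] disc_map_compose[OF h(1)] sm z)
  have \<kappa>0: "\<kappa> 0 = 0" unfolding \<kappa>_def v_def[symmetric] using v k by simp
  have QF: "Q u = F (k (mob (mshift (- v)) u))" if u: "cmod u < 1" for u
    using k(3)[OF disc_map_norm[OF sm(2)[OF v] u]] mob_mshift_cancel(1)[OF v u] by simp
  have F\<kappa>: "F (\<kappa> u) = F u" if u: "cmod u < 1" for u
  proof -
    have mu: "cmod (mob (mshift (- z)) u) < 1" using disc_map_norm[OF sm(2)[OF z] u] .
    show ?thesis unfolding \<kappa>_def QF[OF disc_map_norm[OF h(1) mu], symmetric] h(3)[OF mu, symmetric]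
      using mob_mshift_cancel(1)[OF z u] by simp
  qed
  have "deriv (\<lambda>u. F (\<kappa> u)) 0 = deriv F 0" by (rule deriv_cong_disc) (auto simp: F\<kappa>)
  then have "deriv \<kappa> 0 = 1" using disc_map_chain[OF Fd \<kappa>d, of 0] \<kappa>0 dF0 by simp
  then have \<kappa>_id: "\<kappa> u = u" if "cmod u < 1" for u using schwarz_identity[OF \<kappa>d \<kappa>0 _ that] by simp
  have kz: "k (mob (mshift (- v)) 0) = z"
    using \<kappa>_id[OF z] z h(2) by (simp add: \<kappa>_def)
  have "factors_through Q (\<lambda>u. f (mob (mshift w) u))"
    by (rule Q(3)[OF ramified_compose[OF f sm(1)[OF w]]]) (use w fw in \<open>simp add: b_def\<close>)
  then obtain h1 where h1: "disc_map h1" "h1 0 = 0" "\<And>u. cmod u < 1 \<Longrightarrow> f (mob (mshift w) u) = Q (h1 u)"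
    unfolding factors_through_def by blast
  let ?h = "\<lambda>u. k (mob (mshift (- v)) (h1 (mob (mshift (- w)) u)))"
  have "disc_map ?h"
    by (intro disc_map_compose[OF k(1)] disc_map_compose[OF sm(2)[OF v]] disc_map_compose[OF h1(1)] sm w)
  moreover have "?h w = z" using w h1(2) kz by simp
  moreover have "f u = F (?h u)" if u: "cmod u < 1" for u
  proof -
    have mu: "cmod (mob (mshift (- w)) u) < 1" using disc_map_norm[OF sm(2)[OF w] u] .
    show ?thesis unfolding QF[OF disc_map_norm[OF h1(1) mu], symmetric] h1(3)[OF mu, symmetric]
      using mob_mshift_cancel(1)[OF w u] by simp
  qed
  ultimately show ?thesis by blast
qed

section \<open>Lifting over branch points and its consequences\<close>

lemma F_nonconstant: "\<not> F constant_on ball 0 1"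
proof
  assume "F constant_on ball 0 1"
  then obtain c where "\<And>z. cmod z < 1 \<Longrightarrow> F z = c" by (auto simp: constant_on_def)
  then have "deriv F 0 = deriv (\<lambda>z. c) 0" by (intro deriv_cong_disc) auto
  then show False using dF0 by simp
qed

lemma F_open: "open U \<Longrightarrow> U \<subseteq> ball 0 1 \<Longrightarrow> open (F ` U)"
  using open_mapping_thm[OF disc_map_holo[OF Fd] open_ball connected_ball _ _ F_nonconstant] by blast

text \<open>Over a point of \<open>A\<close> the lift is obtained as a limit of lifts through nearby generic points.\<close>

lemma lift:
  assumes f: "ramified A f" and w: "cmod w < 1" and z: "cmod z < 1" and fw: "f w = F z"
    and nc: "\<not> f constant_on ball 0 1"
  shows "\<exists>h. disc_map h \<and> h w = z \<and> (\<forall>u. cmod u < 1 \<longrightarrow> f u = F (h u))"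
proof -
  have fd: "disc_map f" using f ramified_disc_map by blast
  obtain e where e: "e > 0" "ball (F z) e \<inter> A \<subseteq> {F z}" using A_discrete[OF F_norm[OF z]] by auto
  have "\<exists>w' z'. dist w' w < d \<and> dist z' z < d \<and> cmod w' < 1 \<and> cmod z' < 1 \<and> f w' = F z' \<and> F z' \<notin> A"
    if d: "d > 0" for d
  proof -
    \<comment> \<open>Values in \<open>V\<close> are taken by \<open>F\<close> close to
      \<open>z\<close>, and the only possible point of \<open>A\<close> in \<open>V\<close> is
      \<open>F z\<close>; so points \<open>w'\<close> near \<open>w\<close> with
      \<open>f w' \<noteq> f w\<close> are generic.\<close>
    define V where "V = F ` (ball z d \<inter> ball 0 1) \<inter> ball (F z) e"
    have oV: "open V" unfolding V_def by (intro open_Int F_open open_ball) auto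
    have wV: "f w \<in> V" unfolding V_def fw using z d e by auto
    have "isCont f w"
      using holomorphic_on_imp_differentiable_at[OF disc_map_holo[OF fd] open_ball] w
      by (simp add: field_differentiable_imp_continuous_at)
    then have "\<forall>\<^sub>F x in at w. f x \<in> V"
      using oV wV topological_tendstoD unfolding isCont_def by blast
    moreover have "\<forall>\<^sub>F x in at w. f x \<noteq> f w"
    proof -
      have "\<exists>r>0. \<forall>x\<in>ball w r - {w}. f x \<noteq> f w"
      proof -
        have c: "(\<lambda>x. f x - f w) holomorphic_on ball 0 1" by (intro holomorphic_intros disc_map_holo fd)
        have "\<not> (\<forall>x\<in>ball 0 1. f x - f w = 0)"
          using nc unfolding constant_on_def by (metis eq_iff_diff_eq_0)
        then obtain \<beta> where \<beta>: "\<beta> \<in> ball 0 1" "f \<beta> - f w \<noteq> 0" by blast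
        obtain r where "0 < r" "\<And>x. x \<in> ball w r - {w} \<Longrightarrow> f x - f w \<noteq> 0"
          using isolated_zeros[OF c open_ball connected_ball _ _ \<beta>, of w] w by (metis diff_self mem_ball_0)
        then show ?thesis by auto
      qed
      then show ?thesis unfolding eventually_at by (auto simp: dist_commute)
    qed
    moreover have "\<forall>\<^sub>F x in at w. x \<in> ball w d \<inter> ball 0 1"
      using eventually_at_in_open'[of "ball w d \<inter> ball 0 1" w] w d by (auto elim: eventually_mono)
    ultimately have "\<forall>\<^sub>F x in at w. f x \<in> V \<and> f x \<noteq> f w \<and> x \<in> ball w d \<inter> ball 0 1"
      by (simp add: eventually_conj_iff)
    then obtain w' where w': "f w' \<in> V" "f w' \<noteq> f w" "w' \<in> ball w d \<inter> ball 0 1"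
      using eventually_happens'[OF at_neq_bot] by blast
    from w'(1) obtain z' where z': "z' \<in> ball z d \<inter> ball 0 1" "f w' = F z'" unfolding V_def by auto
    have "F z' \<notin> A" using w' e z' fw unfolding V_def by auto
    then show ?thesis using w'(3) z' by (intro exI[of _ w'] exI[of _ z']) (auto simp: dist_commute)
  qed
  then have "\<forall>n. \<exists>w' z'. dist w' w < 1 / Suc n \<and> dist z' z < 1 / Suc n \<and> cmod w' < 1 \<and> cmod z' < 1 \<and> f w' = F z' \<and> F z' \<notin> A"
    by simp
  then obtain ws zs where wz: "\<And>n. dist (ws n) w < 1 / Suc n" "\<And>n. dist (zs n) z < 1 / Suc n"
     "\<And>n. cmod (ws n) < 1" "\<And>n. cmod (zs n) < 1" "\<And>n. f (ws n) = F (zs n)" "\<And>n. F (zs n) \<notin> A"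
    by metis
  have lims: "ws \<longlonglongrightarrow> w" "zs \<longlonglongrightarrow> z"
  proof -
    have i: "(\<lambda>n. 1 / real (Suc n)) \<longlonglongrightarrow> 0" using LIMSEQ_Suc[OF lim_1_over_n[where 'a=real]] by simp
    have "(\<lambda>n. dist (ws n) w) \<longlonglongrightarrow> 0"
      by (rule tendsto_sandwich[OF _ _ tendsto_const i]) (use wz(1) less_imp_le in \<open>auto intro!: always_eventually\<close>)
    then show "ws \<longlonglongrightarrow> w" using tendsto_dist_iff by blast
    have "(\<lambda>n. dist (zs n) z) \<longlonglongrightarrow> 0"
      by (rule tendsto_sandwich[OF _ _ tendsto_const i]) (use wz(2) less_imp_le in \<open>auto intro!: always_eventually\<close>)
    then show "zs \<longlonglongrightarrow> z" using tendsto_dist_iff by blast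
  qed
  have "\<forall>n. \<exists>h. disc_map h \<and> h (ws n) = zs n \<and> (\<forall>u. cmod u < 1 \<longrightarrow> f u = F (h u))"
    using lift_generic[OF f wz(3,4,5,6)] by blast
  from choice[OF this] obtain h where h: "\<And>n. disc_map (h n)" "\<And>n. h n (ws n) = zs n"
    "\<And>n u. cmod u < 1 \<Longrightarrow> f u = F (h n u)" by blast
  obtain g s where g: "g holomorphic_on ball 0 1" "strict_mono (s :: nat \<Rightarrow> nat)"
    "\<forall>z. cmod z < 1 \<longrightarrow> (\<lambda>n. h (s n) z) \<longlonglongrightarrow> g z"
    "\<forall>K. compact K \<longrightarrow> K \<subseteq> ball 0 1 \<longrightarrow> uniform_limit K (\<lambda>n. h (s n)) g sequentially"
    using montel_disc_map[of h, OF h(1)] by blast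
  have "(\<lambda>n. h (s n) (ws (s n))) \<longlonglongrightarrow> g w"
    by (rule limit_at_moving_point[OF _ _ w g(1)])
       (use g(4) LIMSEQ_subseq_LIMSEQ[OF lims(1) g(2)] in \<open>auto simp: o_def\<close>)
  moreover have "(\<lambda>n. h (s n) (ws (s n))) \<longlonglongrightarrow> z"
    unfolding h(2) using LIMSEQ_subseq_LIMSEQ[OF lims(2) g(2)] by (simp add: o_def)
  ultimately have gw: "g w = z" by (rule LIMSEQ_unique)
  have gd: "disc_map g"
    by (rule limit_disc_map[OF g(1), of "\<lambda>n. h (s n)" w]) (use g h gw w z in auto)
  have "f u = F (g u)" if u: "cmod u < 1" for u
  proof -
    have "isCont F (g u)"
      using holomorphic_on_imp_differentiable_at[OF disc_map_holo[OF Fd] open_ball] disc_map_norm[OF gd u]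
      by (simp add: field_differentiable_imp_continuous_at)
    then have "(\<lambda>n. F (h (s n) u)) \<longlonglongrightarrow> F (g u)" using g(3)[rule_format, OF u] by (rule isCont_tendsto_compose)
    then show ?thesis unfolding h(3)[OF u, symmetric] by (simp add: LIMSEQ_const_iff)
  qed
  then show ?thesis using gd gw by blast
qed

text \<open>The affine disc around \<open>F z\<close> lifts through \<open>z\<close>, and the chain
  rule makes its slope a multiple of \<open>deriv F z\<close>.\<close>

lemma F_deriv_nonzero:
  assumes z: "cmod z < 1" and nA: "F z \<notin> A" shows "deriv F z \<noteq> 0"
proof
  assume 0: "deriv F z = 0"
  obtain d where d: "d > 0" "ball (F z) d \<inter> A \<subseteq> {F z}" "d \<le> 1 - cmod (F z)"
    using isolating_radius[OF F_norm[OF z]] by blast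
  then have "ball (F z) d \<inter> A = {}" using nA by auto
  from lift_generic[OF ramified_affine[OF F_norm[OF z] this d(1) order.refl d(3)] _ z _ nA, of 0]
  obtain h where h: "disc_map h" "h 0 = z" "\<And>u. cmod u < 1 \<Longrightarrow> F z + of_real d * u = F (h u)" by auto
  have "deriv (\<lambda>u. F z + of_real d * u) 0 = deriv (\<lambda>u. F (h u)) 0"
    by (rule deriv_cong_disc) (use h in auto)
  moreover have "deriv (\<lambda>u. F z + of_real d * u) 0 = of_real d"
    by (rule DERIV_imp_deriv) (auto intro!: derivative_eq_intros)
  ultimately show False using disc_map_chain[OF Fd h(1), of 0] h(2) 0 d(1) by simp
qed

text \<open>The branching order is exactly 2: the model \<open>F z + d * u^2\<close> lifts by some
  \<open>h\<close>, and \<open>g o h\<close> is a root of \<open>d * u^2\<close>, so it is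
  \<open>sqrt d * u\<close> up to sign and has nonzero derivative.\<close>

lemma F_sqrt_deriv_nonzero:
  assumes z: "cmod z < 1" and a: "F z \<in> A" and g: "g holomorphic_on ball 0 1"
    and eq: "\<And>u. cmod u < 1 \<Longrightarrow> F u - F z = (g u)\<^sup>2"
  shows "deriv g z \<noteq> 0"
proof
  assume 0: "deriv g z = 0"
  obtain d where d: "d > 0" "ball (F z) d \<inter> A \<subseteq> {F z}" "d \<le> 1 - cmod (F z)"
    using isolating_radius[OF F_norm[OF z]] by blast
  let ?f = "\<lambda>u. F z + of_real d * u\<^sup>2"
  note nc = square_nonconstant[OF d(1), of "F z"]
  from lift[OF ramified_square_at[OF F_norm[OF z] d(2,1,3)] _ z _ nc, of 0]
  obtain h where h: "disc_map h" "h 0 = z" "\<And>u. cmod u < 1 \<Longrightarrow> ?f u = F (h u)" by auto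
  let ?s = "\<lambda>u. complex_of_real (sqrt d) * u"
  have gh: "(\<lambda>u. g (h u)) holomorphic_on ball 0 1"
    using holomorphic_on_compose_gen[OF disc_map_holo[OF h(1)] g] disc_map_norm[OF h(1)] by (force simp: o_def)
  have "(g (h u))\<^sup>2 = (?s u)\<^sup>2" if u: "cmod u < 1" for u
    unfolding eq[OF disc_map_norm[OF h(1) u], symmetric] h(3)[OF u, symmetric] using d(1)
    by (simp add: power_mult_distrib flip: of_real_power)
  then have "(\<forall>u. cmod u < 1 \<longrightarrow> g (h u) = ?s u) \<or> (\<forall>u. cmod u < 1 \<longrightarrow> g (h u) = - ?s u)"
    by (intro holomorphic_sqrt_sign gh) (auto intro!: holomorphic_intros)
  then have "deriv (\<lambda>u. g (h u)) 0 = deriv ?s 0 \<or> deriv (\<lambda>u. g (h u)) 0 = deriv (\<lambda>u. - ?s u) 0"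
    using deriv_cong_disc[of "\<lambda>u. g (h u)" ?s 0] deriv_cong_disc[of "\<lambda>u. g (h u)" "\<lambda>u. - ?s u" 0] by auto
  moreover have "deriv ?s 0 = of_real (sqrt d)" "deriv (\<lambda>u. - ?s u) 0 = - of_real (sqrt d)"
    by (rule DERIV_imp_deriv, auto intro!: derivative_eq_intros)+
  moreover have "deriv (\<lambda>u. g (h u)) 0 = deriv g (h 0) * deriv h 0"
    by (rule DERIV_imp_deriv[OF DERIV_chain2[OF _ disc_map_deriv[OF h(1)]]])
       (use holomorphic_derivI[OF g open_ball] h z in auto)
  ultimately show False using 0 h(2) d(1) by auto
qed

text \<open>A small disc around \<open>x\<close> that meets the image lies in it, because its
  parametrisation \<open>x + d * u^2\<close> lifts. So the image is open and closed in the unit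
  disc.\<close>

lemma F_surj:
  assumes c: "cmod c < 1" shows "\<exists>z. cmod z < 1 \<and> F z = c"
proof -
  have key: "\<exists>d>0. ball x d \<subseteq> ball 0 1 \<and> (ball x d \<inter> F ` ball 0 1 \<noteq> {} \<longrightarrow> ball x d \<subseteq> F ` ball 0 1)"
    if x: "cmod x < 1" for x
  proof -
    obtain d where d: "d > 0" "ball x d \<inter> A \<subseteq> {x}" "d \<le> 1 - cmod x" using isolating_radius[OF x] by blast
    let ?f = "\<lambda>u. x + of_real d * u\<^sup>2"
    note nc = square_nonconstant[OF d(1), of x]
    have surj: "\<exists>u. cmod u < 1 \<and> ?f u = y" if "y \<in> ball x d" for y
    proof (intro exI conjI)
      let ?u = "csqrt ((y - x) / of_real d)"
      have "cmod ((y - x) / of_real d) < 1" using that d(1) by (simp add: norm_divide dist_norm norm_minus_commute)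
      then show "cmod ?u < 1" by (rule norm_csqrt_less)
      show "x + of_real d * ?u\<^sup>2 = y" using d(1) by simp
    qed
    have "ball x d \<subseteq> F ` ball 0 1" if ne: "ball x d \<inter> F ` ball 0 1 \<noteq> {}"
    proof
      fix y assume y: "y \<in> ball x d"
      from ne obtain z where z: "cmod z < 1" "F z \<in> ball x d" by auto
      obtain u where u: "cmod u < 1" "?f u = F z" using surj[OF z(2)] by blast
      obtain h where h: "disc_map h" "\<And>u. cmod u < 1 \<Longrightarrow> ?f u = F (h u)"
        using lift[OF ramified_square_at[OF x d(2,1,3)] u(1) z(1) u(2) nc] by blast
      obtain v where v: "cmod v < 1" "?f v = y" using surj[OF y] by blast
      then show "y \<in> F ` ball 0 1" using h disc_map_norm[OF h(1) v(1)] by (metis image_eqI mem_ball_0)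
    qed
    moreover have "ball x d \<subseteq> ball 0 1"
    proof
      fix y assume "y \<in> ball x d"
      then show "y \<in> ball 0 1" using d(3) norm_triangle_ineq[of x "y - x"] by (simp add: dist_norm norm_minus_commute)
    qed
    ultimately show ?thesis using d(1) by blast
  qed
  let ?W = "F ` ball 0 1"
  have oW: "open ?W" by (rule F_open) auto
  have oC: "open (ball 0 1 - ?W)"
    unfolding open_contains_ball
  proof
    fix x assume x: "x \<in> ball 0 1 - ?W"
    then obtain d where d: "d > 0" "ball x d \<subseteq> ball 0 1" "ball x d \<inter> ?W \<noteq> {} \<longrightarrow> ball x d \<subseteq> ?W"
      using key[of x] by auto
    have "x \<in> ball x d" using d by simp
    then have "ball x d \<inter> ?W = {}" using d(3) x by blast
    then show "\<exists>e>0. ball x e \<subseteq> ball 0 1 - ?W" using d by blast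
  qed
  have "?W \<inter> ball 0 1 \<noteq> {}" using F_norm[of 0] by (auto intro!: exI[of _ "F 0"] image_eqI[of _ F 0])
  moreover have "?W \<inter> ball 0 1 = {} \<or> (ball 0 1 - ?W) \<inter> ball 0 1 = {}"
    by (rule connectedD[OF connected_ball oW oC]) auto
  ultimately have "ball 0 1 - ?W = {}" by blast
  then have "c \<in> ?W" using c by auto
  then show ?thesis by auto
qed

text \<open>Off \<open>A\<close> the nonzero derivative of \<open>F\<close> cancels in the chain
  rule. Over \<open>A\<close> the root \<open>g\<close> of \<open>F - F z\<close> takes its place,
  and \<open>g o k\<close> is \<open>g\<close> or \<open>- g\<close>.\<close>

lemma fixing_deriv:
  assumes k: "disc_map k" and z: "cmod z < 1" "k z = z" and Fk: "\<And>u. cmod u < 1 \<Longrightarrow> F (k u) = F u"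
  shows "(deriv k z)\<^sup>2 = 1"
proof (cases "F z \<in> A")
  case False
  have "deriv (\<lambda>u. F (k u)) z = deriv F z" by (rule deriv_cong_disc) (use Fk z in auto)
  then have "deriv k z = 1" using disc_map_chain[OF Fd k z(1)] z F_deriv_nonzero[OF z(1) False] by simp
  then show ?thesis by simp
next
  case True
  then obtain g where g: "g holomorphic_on ball 0 1" "\<And>u. cmod u < 1 \<Longrightarrow> F u - F z = (g u)\<^sup>2"
    using F_ram unfolding ramified_def has_sqrt_def by blast
  have gk: "(\<lambda>u. g (k u)) holomorphic_on ball 0 1"
    using holomorphic_on_compose_gen[OF disc_map_holo[OF k] g(1)] disc_map_norm[OF k] by (force simp: o_def)
  have "(g (k u))\<^sup>2 = (g u)\<^sup>2" if "cmod u < 1" for u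
    using g(2)[OF disc_map_norm[OF k that]] g(2)[OF that] Fk[OF that] by simp
  then have "(\<forall>u. cmod u < 1 \<longrightarrow> g (k u) = g u) \<or> (\<forall>u. cmod u < 1 \<longrightarrow> g (k u) = - g u)"
    by (intro holomorphic_sqrt_sign gk g)
  then have "deriv (\<lambda>u. g (k u)) z = deriv g z \<or> deriv (\<lambda>u. g (k u)) z = deriv (\<lambda>u. - g u) z"
    using deriv_cong_disc[of "\<lambda>u. g (k u)" g z] deriv_cong_disc[of "\<lambda>u. g (k u)" "\<lambda>u. - g u" z] z by auto
  moreover have gz: "(g has_field_derivative deriv g z) (at z)"
    using holomorphic_derivI[OF g(1) open_ball] z by simp
  moreover have "deriv (\<lambda>u. - g u) z = - deriv g z"
    by (rule DERIV_imp_deriv[OF DERIV_minus[OF gz]])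
  moreover have "deriv (\<lambda>u. g (k u)) z = deriv g z * deriv k z"
    by (rule DERIV_imp_deriv[OF DERIV_chain2[OF _ disc_map_deriv[OF k z(1)]]]) (use gz z in simp)
  moreover have "deriv g z \<noteq> 0" using F_sqrt_deriv_nonzero[OF z(1) True g] .
  ultimately have "deriv g z * deriv k z = deriv g z * 1 \<or> deriv g z * deriv k z = deriv g z * (- 1)"
    and "deriv g z \<noteq> 0" by auto
  then have "deriv k z = 1 \<or> deriv k z = - 1" using mult_left_cancel by blast
  then show ?thesis by auto
qed

text \<open>\<open>q o F\<close> and its counterpart for the inverse of \<open>q\<close> are
  ramified over \<open>A\<close> and lift through \<open>F\<close>. The composite of the two lifts
  fixes \<open>z\<close> and leaves \<open>F\<close> unchanged, so its derivative there is 1 or -1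
  and \<open>disc_automorphism\<close> applies.\<close>

lemma deck_transformation:
  assumes q: "q \<in> su11" "mob q ` A = A" and z: "cmod z < 1" "cmod z' < 1" and eq: "F z' = mob q (F z)"
  shows "\<exists>p\<in>su11. mob p z = z' \<and> (\<forall>u. cmod u < 1 \<longrightarrow> F (mob p u) = mob q (F u))"
proof -
  note qi = minv_su11[OF q(1)]
  have qiA: "mob (minv q) ` A = A"
  proof -
    have "mob (minv q) ` A = mob (minv q) ` (mob q ` A)" using q by simp
    also have "\<dots> = (\<lambda>x. x) ` A" unfolding image_image
      using mob_minv(1)[OF q(1)] A_disc by (intro image_cong) auto
    finally show ?thesis by simp
  qed
  have nc: "\<not> (\<lambda>u. mob p (F u)) constant_on ball 0 1" if p: "p \<in> su11" for p
  proof
    assume "(\<lambda>u. mob p (F u)) constant_on ball 0 1"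
    then obtain c where c: "\<And>u. cmod u < 1 \<Longrightarrow> mob p (F u) = c" by (auto simp: constant_on_def)
    have "F u = mob (minv p) c" if "cmod u < 1" for u
      using c[OF that] mob_minv(1)[OF p F_norm[OF that]] by simp
    then have "F constant_on ball 0 1" by (auto simp: constant_on_def)
    then show False using F_nonconstant by simp
  qed
  have r1: "ramified A (\<lambda>u. mob q (F u))" using ramified_mob[OF F_ram q(1) A_disc] q(2) by simp
  have r2: "ramified A (\<lambda>u. mob (minv q) (F u))" using ramified_mob[OF F_ram qi A_disc] qiA by simp
  obtain h where h: "disc_map h" "h z = z'" "\<And>u. cmod u < 1 \<Longrightarrow> mob q (F u) = F (h u)"
    using lift[OF r1 z eq[symmetric] nc[OF q(1)]] by blast
  have "mob (minv q) (F z') = F z" using eq mob_minv(1)[OF q(1) F_norm[OF z(1)]] by simp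
  then obtain k where k: "disc_map k" "k z' = z" "\<And>u. cmod u < 1 \<Longrightarrow> mob (minv q) (F u) = F (k u)"
    using lift[OF r2 z(2,1) _ nc[OF qi]] by blast
  have "F (k (h u)) = F u" if u: "cmod u < 1" for u
    unfolding k(3)[OF disc_map_norm[OF h(1) u], symmetric] h(3)[OF u, symmetric] mob_minv(1)[OF q(1) F_norm[OF u]] ..
  then have "(deriv (\<lambda>u. k (h u)) z)\<^sup>2 = 1"
    using fixing_deriv[OF disc_map_compose[OF k(1) h(1)] z(1)] h(2) k(2) by simp
  then have "deriv (\<lambda>u. k (h u)) z = 1 \<or> deriv (\<lambda>u. k (h u)) z = - 1" by (simp add: power2_eq_1_iff)
  then have "cmod (deriv (\<lambda>u. k (h u)) z) = 1" by auto
  then obtain p where p: "p \<in> su11" "\<And>u. cmod u < 1 \<Longrightarrow> h u = mob p u"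
    using disc_automorphism[OF h(1) k(1) z(1)] h(2) k(2) by blast
  have "F (mob p u) = mob q (F u)" if "cmod u < 1" for u using p(2)[OF that] h(3)[OF that] by simp
  moreover have "mob p z = z'" using p(2)[OF z(1)] h(2) by simp
  ultimately show ?thesis using p(1) by blast
qed

end

section \<open>An arithmetic cocompact Fuchsian group\<close>

text \<open>If the entry is large, the denominator is large on the smaller disc and
  \<open>mob_norm\<close> pushes that disc towards the unit circle. Both discreteness proofs start
  from this properness.\<close>

lemma mob_norm_bound:
  assumes p: "p \<in> su11" and r: "0 \<le> r" "r < 1" and z: "cmod z \<le> r" "cmod (mob p z) \<le> r"
  shows "(cmod (fst p))\<^sup>2 * ((1 - r\<^sup>2) * (1 - r)\<^sup>2) \<le> 1"
proof -
  let ?d = "cmod (cnj (snd p) * z + cnj (fst p))"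
  have z1: "cmod z < 1" using z r by simp
  have d: "cmod (fst p) * (1 - r) \<le> ?d" using mob_denom_bound[OF p z(1)] r by simp
  have "cmod (fst p) * (1 - r) \<ge> 0" using r by simp
  then have d2: "(cmod (fst p) * (1 - r))\<^sup>2 \<le> ?d\<^sup>2" using d by (rule power_mono[rotated])
  have dpos: "?d\<^sup>2 > 0" using mob_denom_nz[OF p z1] by simp
  have "1 - r\<^sup>2 \<le> 1 - (cmod (mob p z))\<^sup>2" using z r by (simp add: power_mono)
  also have "\<dots> = (1 - (cmod z)\<^sup>2) / ?d\<^sup>2" by (rule mob_norm[OF p z1])
  also have "\<dots> \<le> 1 / ?d\<^sup>2" by (rule divide_right_mono) auto
  finally have "(1 - r\<^sup>2) * ?d\<^sup>2 \<le> 1" using dpos by (simp add: pos_le_divide_eq)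
  moreover have "(1 - r\<^sup>2) * (cmod (fst p) * (1 - r))\<^sup>2 \<le> (1 - r\<^sup>2) * ?d\<^sup>2"
    using d2 r by (intro mult_left_mono) (auto simp: power_le_one)
  ultimately show ?thesis by (simp add: power_mult_distrib mult_ac)
qed

text \<open>A fixed point makes \<open>(z, 1)\<close> an eigenvector with eigenvalue the denominator
  \<open>\<mu>\<close>. The invariant form is nonzero on it, so \<open>|\<mu>| = 1\<close>, and the
  trace \<open>2 * Re (fst p)\<close> equals \<open>\<mu> + cnj \<mu>\<close>.\<close>

lemma mob_fixed_trace:
  assumes p: "p \<in> su11" and z: "cmod z < 1" "mob p z = z"
  shows "\<bar>Re (fst p)\<bar> \<le> 1"
proof -
  define \<mu> where "\<mu> = cnj (snd p) * z + cnj (fst p)"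
  have \<mu>0: "\<mu> \<noteq> 0" using mob_denom_nz[OF p z(1)] by (simp add: \<mu>_def)
  have "1 - (cmod z)\<^sup>2 > 0" using z by (simp add: power_less_one_iff)
  moreover have "1 - (cmod z)\<^sup>2 = (1 - (cmod z)\<^sup>2) / (cmod \<mu>)\<^sup>2"
    using mob_norm[OF p z(1)] z(2) by (simp add: \<mu>_def)
  ultimately have "(cmod \<mu>)\<^sup>2 = 1" using \<mu>0
    by (metis divide_eq_eq_1 less_irrefl mult.commute mult_cancel_left2 nonzero_eq_divide_eq norm_eq_zero power_not_zero)
  then have m1: "cmod \<mu> = 1" using norm_ge_zero[of \<mu>] power2_eq_1_iff[of "cmod \<mu>"] by linarith
  then have mm: "\<mu> * cnj \<mu> = 1" using complex_norm_square[of \<mu>] by simp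
  have "\<mu> * z = fst p * z + snd p" using z(2) \<mu>0 unfolding mob_def \<mu>_def by (simp add: field_simps)
  then have "cnj (snd p) * (\<mu> * z) = cnj (snd p) * (fst p * z + snd p)" by simp
  moreover have e1: "cnj (snd p) * z = \<mu> - cnj (fst p)" by (simp add: \<mu>_def)
  ultimately have "\<mu> * (\<mu> - cnj (fst p)) = fst p * (\<mu> - cnj (fst p)) + snd p * cnj (snd p)"
    unfolding e1[symmetric] by (simp add: algebra_simps)
  then have e2: "\<mu> * \<mu> = (fst p + cnj (fst p)) * \<mu> - 1"
    using p by (simp add: su11_iff algebra_simps)
  have "\<mu> = cnj \<mu> * (\<mu> * \<mu>)" using mm by (simp add: mult_ac)
  also have "\<dots> = (fst p + cnj (fst p)) * (\<mu> * cnj \<mu>) - cnj \<mu>" unfolding e2 by (simp add: algebra_simps)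
  finally have "\<mu> + cnj \<mu> = fst p + cnj (fst p)" unfolding mm by (simp add: algebra_simps)
  then have "Re \<mu> = Re (fst p)" by (simp add: complex_eq_iff)
  then show ?thesis using abs_Re_le_cmod[of \<mu>] m1 by simp
qed

section \<open>A quaternion order and its congruence subgroup modulo 3\<close>

lemma sum_squares_3_dvd:
  fixes x y :: int assumes "3 dvd x\<^sup>2 + y\<^sup>2" shows "3 dvd x" "3 dvd y"
proof -
  have aux: "r = 0 \<and> s = 0" if "r \<in> {0,1,2}" "s \<in> {0,1,2}" "(r\<^sup>2 + s\<^sup>2) mod 3 = 0" for r s :: int
    using that by auto
  have rng: "t mod 3 \<in> {0,1,2}" for t :: int
  proof -
    have "0 \<le> t mod 3" "t mod 3 < 3" by (rule pos_mod_sign pos_mod_bound, simp)+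
    then show ?thesis unfolding insert_iff by linarith
  qed
  have "((x mod 3)\<^sup>2 + (y mod 3)\<^sup>2) mod 3 = (x\<^sup>2 + y\<^sup>2) mod 3" by (rule mod_add_cong; rule power_mod)
  also have "\<dots> = 0" using assms by (rule dvd_imp_mod_0)
  finally have "x mod 3 = 0 \<and> y mod 3 = 0" by (rule aux[OF rng rng])
  then show "3 dvd x" "3 dvd y" by (blast intro: mod_0_imp_dvd)+
qed

text \<open>Infinite descent: -1 is not a square modulo 3, so 3 divides \<open>a\<close> and
  \<open>b\<close>, hence also \<open>c\<close> and \<open>d\<close>.\<close>

lemma anisotropic:
  fixes a b c d :: int
  assumes "a\<^sup>2 + b\<^sup>2 = 3 * (c\<^sup>2 + d\<^sup>2)"
  shows "a = 0 \<and> b = 0 \<and> c = 0 \<and> d = 0"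
  using assms
proof (induction "nat (\<bar>a\<bar> + \<bar>b\<bar> + \<bar>c\<bar> + \<bar>d\<bar>)" arbitrary: a b c d rule: less_induct)
  case less
  have "3 dvd a" "3 dvd b" using sum_squares_3_dvd[of a b] less(2) by auto
  then obtain a' b' where ab: "a = 3 * a'" "b = 3 * b'" by (elim dvdE)
  then have e: "c\<^sup>2 + d\<^sup>2 = 3 * (a'\<^sup>2 + b'\<^sup>2)" using less(2) by (simp add: power_mult_distrib)
  have "3 dvd c" "3 dvd d" using sum_squares_3_dvd[of c d] e by auto
  then obtain c' d' where cd: "c = 3 * c'" "d = 3 * d'" by (elim dvdE)
  have e': "a'\<^sup>2 + b'\<^sup>2 = 3 * (c'\<^sup>2 + d'\<^sup>2)" using e unfolding cd by (simp add: power_mult_distrib)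
  show ?case
  proof (rule ccontr)
    assume "\<not> ?case"
    then have "nat (\<bar>a'\<bar> + \<bar>b'\<bar> + \<bar>c'\<bar> + \<bar>d'\<bar>) < nat (\<bar>a\<bar> + \<bar>b\<bar> + \<bar>c\<bar> + \<bar>d\<bar>)"
      unfolding ab cd by auto
    from less(1)[OF this e'] \<open>\<not> ?case\<close> show False unfolding ab cd by auto
  qed
qed

definition gauss :: "int \<Rightarrow> int \<Rightarrow> complex" where "gauss a b = Complex (of_int a) (of_int b)"

text \<open>The quaternion \<open>a + b i + (c + d i) j\<close> with \<open>j^2 = 3\<close> as a
  matrix; the determinant is its reduced norm.\<close>

definition quat :: "int \<Rightarrow> int \<Rightarrow> int \<Rightarrow> int \<Rightarrow> complex \<times> complex" where
  "quat a b c d = (gauss a b, of_real (sqrt 3) * gauss c d)"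

text \<open>The norm-one elements congruent to \<open>1\<close> modulo \<open>3\<close> in the order spanned by \<open>1, i, j, ij\<close> in the
  quaternion algebra with \<open>i\<^sup>2 = -1\<close> and \<open>j\<^sup>2 = 3\<close>, a division algebra by the lemma \<open>anisotropic\<close>.\<close>

definition Lam :: "(complex \<times> complex) set" where
  "Lam = {quat (1 + 3 * a) (3 * b) (3 * c) (3 * d) | a b c d. (1 + 3 * a)\<^sup>2 + (3 * b)\<^sup>2 - 3 * ((3 * c)\<^sup>2 + (3 * d)\<^sup>2) = 1}"

lemma norm_gauss: "(cmod (gauss a b))\<^sup>2 = of_int (a\<^sup>2 + b\<^sup>2)"
  by (simp add: gauss_def cmod_def)

lemma quat_norm: "(cmod (fst (quat a b c d)))\<^sup>2 - (cmod (snd (quat a b c d)))\<^sup>2 = of_int (a\<^sup>2 + b\<^sup>2 - 3 * (c\<^sup>2 + d\<^sup>2))"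
  by (simp add: quat_def norm_mult power_mult_distrib norm_gauss)

lemma quat_su11: "quat a b c d \<in> su11 \<longleftrightarrow> a\<^sup>2 + b\<^sup>2 - 3 * (c\<^sup>2 + d\<^sup>2) = 1"
  unfolding su11_def mem_Collect_eq quat_norm by (metis of_int_1 of_int_eq_iff)

lemma Lam_su11: "Lam \<subseteq> su11"
  unfolding Lam_def using quat_su11 by blast

lemma sqrt3_sq: "complex_of_real (sqrt 3) * complex_of_real (sqrt 3) = 3"
  by (simp flip: of_real_mult)

lemma mmul_quat:
  "mmul (quat a b c d) (quat a' b' c' d') =
    quat (a * a' - b * b' + 3 * (c * c' + d * d')) (a * b' + b * a' + 3 * (d * c' - c * d'))
         (a * c' - b * d' + c * a' + d * b') (a * d' + b * c' + d * a' - c * b')"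
proof -
  have 3: "sqrt 3 * (sqrt 3 * x) = 3 * x" for x by (simp flip: mult.assoc)
  show ?thesis
    unfolding mmul_def quat_def gauss_def
    by (simp add: complex_eq_iff algebra_simps 3)
qed

lemma quat_cong: "a = a' \<Longrightarrow> b = b' \<Longrightarrow> c = c' \<Longrightarrow> d = d' \<Longrightarrow> quat a b c d = quat a' b' c' d'"
  by simp

lemma minv_quat: "minv (quat a b c d) = quat a (- b) (- c) (- d)"
  by (simp add: minv_def quat_def gauss_def complex_eq_iff)

lemma LamI:
  assumes "quat a b c d \<in> su11" "3 dvd a - 1" "3 dvd b" "3 dvd c" "3 dvd d"
  shows "quat a b c d \<in> Lam"
proof -
  obtain a' b' c' d' where e0: "a - 1 = 3 * a'" "b = 3 * b'" "c = 3 * c'" "d = 3 * d'"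
    using assms(2-) by (elim dvdE)
  then have e: "a = 1 + 3 * a'" "b = 3 * b'" "c = 3 * c'" "d = 3 * d'" by auto
  show ?thesis using assms(1) unfolding Lam_def quat_su11 e by blast
qed

lemma LamE:
  assumes "p \<in> Lam"
  obtains a b c d where "p = quat (1 + 3 * a) (3 * b) (3 * c) (3 * d)"
    "(1 + 3 * a)\<^sup>2 + (3 * b)\<^sup>2 - 3 * ((3 * c)\<^sup>2 + (3 * d)\<^sup>2) = 1"
  using assms unfolding Lam_def by blast

lemma Lam_one: "(1, 0) \<in> Lam"
  unfolding Lam_def by (auto simp: quat_def gauss_def complex_eq_iff intro!: exI[of _ 0])

lemma Lam_mmul:
  assumes "p \<in> Lam" "q \<in> Lam" shows "mmul p q \<in> Lam"
proof -
  have su: "mmul p q \<in> su11" using mmul_su11 Lam_su11 assms by blast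
  from assms(1) obtain a b c d where p: "p = quat (1 + 3 * a) (3 * b) (3 * c) (3 * d)" by (rule LamE)
  from assms(2) obtain a' b' c' d' where q: "q = quat (1 + 3 * a') (3 * b') (3 * c') (3 * d')" by (rule LamE)
  show ?thesis using su unfolding p q mmul_quat
  proof (rule LamI)
    show "3 dvd (1 + 3 * a) * (1 + 3 * a') - 3 * b * (3 * b') + 3 * (3 * c * (3 * c') + 3 * d * (3 * d')) - 1"
      by (rule dvdI[of _ _ "a + a' + 3 * a * a' - 3 * b * b' + 9 * (c * c' + d * d')"]) (simp add: algebra_simps)
  qed (auto intro!: dvd_add dvd_diff dvd_mult dvd_mult2)
qed

lemma Lam_minv:
  assumes "p \<in> Lam" shows "minv p \<in> Lam"
proof -
  have su: "minv p \<in> su11" using minv_su11 Lam_su11 assms by blast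
  from assms(1) obtain a b c d where p: "p = quat (1 + 3 * a) (3 * b) (3 * c) (3 * d)" by (rule LamE)
  show ?thesis using su unfolding p minv_quat
    by (rule LamI) simp_all
qed

text \<open>A fixed point bounds the half-trace \<open>1 + 3 * a\<close> by 1 in absolute value, and
  the congruence leaves only \<open>a = 0\<close>; anisotropy then removes the other
  coordinates.\<close>

lemma Lam_free:
  assumes p: "p \<in> Lam" and z: "cmod z < 1" "mob p z = z"
  shows "p = (1, 0)"
proof -
  from p obtain a b c d where p': "p = quat (1 + 3 * a) (3 * b) (3 * c) (3 * d)"
    "(1 + 3 * a)\<^sup>2 + (3 * b)\<^sup>2 - 3 * ((3 * c)\<^sup>2 + (3 * d)\<^sup>2) = 1" by (rule LamE)
  have "\<bar>Re (fst p)\<bar> \<le> 1" using mob_fixed_trace[OF _ z] p Lam_su11 by blast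
  then have "\<bar>real_of_int (1 + 3 * a)\<bar> \<le> 1" by (simp add: p'(1) quat_def gauss_def)
  then have "\<bar>1 + 3 * a\<bar> \<le> 1" by linarith
  then have a: "a = 0" by presburger
  then have "0\<^sup>2 + (3 * b)\<^sup>2 = 3 * ((3 * c)\<^sup>2 + (3 * d)\<^sup>2)" using p'(2) by simp
  from anisotropic[OF this] show ?thesis using a by (simp add: p'(1) quat_def gauss_def complex_eq_iff)
qed

lemma Lam_discrete:
  assumes r: "r < 1"
  shows "finite {p\<in>Lam. \<exists>z. cmod z \<le> r \<and> cmod (mob p z) \<le> r}"
proof (cases "0 \<le> r")
  case True
  define M where "M = \<lceil>1 / ((1 - r\<^sup>2) * (1 - r)\<^sup>2)\<rceil> + 1"
  have pos: "(1 - r\<^sup>2) * (1 - r)\<^sup>2 > 0" using True r by (simp add: power_less_one_iff)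
  define I where "I = {- M .. M}"
  have "{p\<in>Lam. \<exists>z. cmod z \<le> r \<and> cmod (mob p z) \<le> r} \<subseteq> (\<lambda>(a,b,c,d). quat a b c d) ` (I \<times> I \<times> I \<times> I)"
  proof
    fix p assume "p \<in> {p\<in>Lam. \<exists>z. cmod z \<le> r \<and> cmod (mob p z) \<le> r}"
    then obtain z where p: "p \<in> Lam" and z: "cmod z \<le> r" "cmod (mob p z) \<le> r" by auto
    from p obtain a b c d where p': "p = quat a b c d" by (metis LamE)
    have su: "p \<in> su11" using p Lam_su11 by auto
    have "(cmod (fst p))\<^sup>2 \<le> 1 / ((1 - r\<^sup>2) * (1 - r)\<^sup>2)"
      using mob_norm_bound[OF su True r z] pos by (simp add: pos_le_divide_eq)
    then have "real_of_int (a\<^sup>2 + b\<^sup>2) \<le> 1 / ((1 - r\<^sup>2) * (1 - r)\<^sup>2)" by (simp add: p' quat_def norm_gauss)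
    then have ab: "a\<^sup>2 + b\<^sup>2 \<le> M" unfolding M_def by linarith
    have "a\<^sup>2 + b\<^sup>2 - 3 * (c\<^sup>2 + d\<^sup>2) = 1" using su unfolding p' quat_su11 .
    then have cd: "c\<^sup>2 + d\<^sup>2 \<le> M" using ab by (smt (verit) zero_le_power2)
    have sq: "\<bar>x\<bar> \<le> x\<^sup>2" for x :: int
      using self_le_power[of "\<bar>x\<bar>" 2] by (cases "x = 0") auto
    have "\<bar>a\<bar> \<le> M" "\<bar>b\<bar> \<le> M" "\<bar>c\<bar> \<le> M" "\<bar>d\<bar> \<le> M"
      using ab cd sq[of a] sq[of b] sq[of c] sq[of d] zero_le_power2[of a] zero_le_power2[of b]
        zero_le_power2[of c] zero_le_power2[of d] by linarith+
    then show "p \<in> (\<lambda>(a,b,c,d). quat a b c d) ` (I \<times> I \<times> I \<times> I)"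
      unfolding I_def p' by (intro image_eqI[of _ _ "(a,b,c,d)"]) auto
  qed
  then show ?thesis by (rule finite_subset) (auto simp: I_def)
next
  case False
  then have "{p\<in>Lam. \<exists>z. cmod z \<le> r \<and> cmod (mob p z) \<le> r} = {}"
    using norm_ge_zero order.trans by blast
  then show ?thesis by (simp only: finite.emptyI)
qed

text \<open>Pigeonhole: the \<open>(N + 1)^2\<close> fractional parts of Gaussian multiples of
  \<open>\<zeta>\<close> fall into \<open>N^2\<close> boxes of side \<open>1 / N\<close>; two
  multiples in one box are subtracted.\<close>

lemma dirichlet_gauss:
  fixes N :: nat assumes N: "N \<ge> 1"
  shows "\<exists>a b c d. (c \<noteq> 0 \<or> d \<noteq> 0) \<and> cmod (gauss c d) \<le> 2 * N \<and> cmod (gauss a b + gauss c d * \<zeta>) \<le> 2 / N"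
proof -
  define x where "x ij = gauss (int (fst ij)) (int (snd ij)) * \<zeta>" for ij
  define box where "box ij = (\<lfloor>N * frac (Re (x ij))\<rfloor>, \<lfloor>N * frac (Im (x ij))\<rfloor>)" for ij
  have fl: "\<lfloor>N * frac t\<rfloor> \<in> {0..<int N}" for t :: real
  proof -
    have "real N * frac t < real N * 1" using N frac_lt_1[of t] by (intro mult_strict_left_mono) auto
    then show ?thesis by (simp add: floor_less_iff frac_ge_0)
  qed
  have "box ` ({..N} \<times> {..N}) \<subseteq> {0..<int N} \<times> {0..<int N}"
    using fl unfolding box_def by auto
  then have "card (box ` ({..N} \<times> {..N})) \<le> card ({0..<int N} \<times> {0..<int N})" by (intro card_mono) auto
  also have "\<dots> < card ({..N} \<times> {..N})" by (simp add: card_cartesian_product)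
  finally have "\<not> inj_on box ({..N} \<times> {..N})" by (metis card_image less_irrefl)
  then obtain p q where pq: "p \<in> {..N} \<times> {..N}" "q \<in> {..N} \<times> {..N}" "p \<noteq> q" "box p = box q"
    unfolding inj_on_def by blast
  define c d where "c = int (fst p) - int (fst q)" and "d = int (snd p) - int (snd q)"
  define a b where "a = \<lfloor>Re (x q)\<rfloor> - \<lfloor>Re (x p)\<rfloor>" and "b = \<lfloor>Im (x q)\<rfloor> - \<lfloor>Im (x p)\<rfloor>"
  have close: "\<bar>frac s - frac t\<bar> \<le> 1 / N" if "\<lfloor>N * frac s\<rfloor> = \<lfloor>N * frac t\<rfloor>" for s t :: real
  proof -
    have "\<bar>N * frac s - N * frac t\<bar> \<le> 1" using that by linarith
    moreover have "\<bar>N * frac s - N * frac t\<bar> = N * \<bar>frac s - frac t\<bar>"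
      by (simp add: abs_mult flip: right_diff_distrib)
    ultimately show ?thesis using N by (simp add: field_simps)
  qed
  have e: "gauss a b + gauss c d * \<zeta> = Complex (frac (Re (x p)) - frac (Re (x q))) (frac (Im (x p)) - frac (Im (x q)))"
  proof -
    have "gauss c d * \<zeta> = x p - x q" by (simp add: x_def gauss_def c_def d_def complex_eq_iff algebra_simps)
    then show ?thesis by (simp add: gauss_def a_def b_def complex_eq_iff frac_def)
  qed
  have le: "cmod (Complex s t) \<le> \<bar>s\<bar> + \<bar>t\<bar>" for s t using cmod_le[of "Complex s t"] by simp
  have "cmod (gauss a b + gauss c d * \<zeta>) \<le> 1 / N + 1 / N"
    unfolding e using le close pq(4) unfolding box_def by (smt (verit) prod.inject)
  moreover have "cmod (gauss c d) \<le> N + N"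
  proof -
    have "\<bar>real_of_int c\<bar> \<le> N" "\<bar>real_of_int d\<bar> \<le> N" using pq(1,2) by (auto simp: c_def d_def)
    then show ?thesis unfolding gauss_def using le[of "of_int c" "of_int d"] by linarith
  qed
  moreover have "c \<noteq> 0 \<or> d \<noteq> 0" using pq(3) by (auto simp: c_def d_def prod_eq_iff)
  ultimately show ?thesis by (intro exI[of _ a] exI[of _ b] exI[of _ c] exI[of _ d]) auto
qed

text \<open>Dirichlet's approximation provides an element \<open>x\<close> of the order, of bounded norm \<open>n \<noteq> 0\<close>, with
  \<open>x (z, 1)\<close> as short as \<open>\<surd>(1 - |z|\<^sup>2)\<close>. Elements of the same norm that are congruent modulo \<open>3 n\<close>
  differ by an element of \<open>Lam\<close>, so \<open>x\<close> can be corrected by one of finitely many \<open>y\<close> to lie in \<open>Lam\<close>.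
  The constants are \<open>104 = 2\<^sup>2 + 10\<^sup>2\<close> and \<open>312 = 3 \<cdot> 104\<close>.\<close>

lemma Lam_cocompact: "\<exists>r<1. \<forall>z. cmod z < 1 \<longrightarrow> (\<exists>p\<in>Lam. cmod (mob p z) \<le> r)"
proof -
  define nrm :: "int \<times> int \<times> int \<times> int \<Rightarrow> int" where "nrm = (\<lambda>(a,b,c,d). a\<^sup>2 + b\<^sup>2 - 3 * (c\<^sup>2 + d\<^sup>2))"
  \<comment> \<open>The norm, and the coordinates modulo three times the norm. Bounded norm leaves
    finitely many keys, and \<open>Y\<close> contains an element for each.\<close>
  define key where "key = (\<lambda>(a,b,c,d). let n = nrm (a,b,c,d) in (n, a mod (3*n), b mod (3*n), c mod (3*n), d mod (3*n)))"
  define X where "X = {x. nrm x \<noteq> 0 \<and> \<bar>nrm x\<bar> \<le> 104}"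
  let ?I = "{-312..312::int}"
  have md: "y mod (3 * n) \<in> ?I" if "n \<noteq> 0" "\<bar>n\<bar> \<le> 104" for y n :: int
  proof (cases "n > 0")
    case True
    then have "0 \<le> y mod (3 * n)" "y mod (3 * n) < 3 * n" by simp_all
    then show ?thesis using that unfolding atLeastAtMost_iff by linarith
  next
    case False
    then have "y mod (3 * n) \<le> 0" "3 * n < y mod (3 * n)" using that(1) by simp_all
    then show ?thesis using that unfolding atLeastAtMost_iff by linarith
  qed
  have "key ` X \<subseteq> ?I \<times> ?I \<times> ?I \<times> ?I \<times> ?I"
    using md by (auto simp: key_def X_def Let_def)
  then have "finite (key ` X)" by (rule finite_subset) auto
  from finite_subset_image[OF this order.refl] obtain Y where Y: "Y \<subseteq> X" "finite Y" "key ` X = key ` Y" by blast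
  define sz :: "int \<times> int \<times> int \<times> int \<Rightarrow> real" where "sz = (\<lambda>(a,b,c,d). cmod (gauss a b) + cmod (gauss c d))"
  define M where "M = 1 + (\<Sum>y\<in>Y. sz y)"
  have sz0: "sz y \<ge> 0" for y by (simp add: sz_def split: prod.split)
  have szM: "sz y \<le> M" if "y \<in> Y" for y
    unfolding M_def using member_le_sum[of y Y sz] sz0 Y(2) that by fastforce
  have M1: "M \<ge> 1" unfolding M_def using sz0 by (simp add: sum_nonneg)
  \<comment> \<open>The element found below has denominator at most \<open>20 * M * s\<close> at
    \<open>z\<close>, so \<open>mob_norm\<close> gives
    \<open>1 - |mob g z|^2 \<ge> 1 / (20 * M)^2\<close>.\<close>
  define r where "r = sqrt (1 - 1 / (20 * M)\<^sup>2)"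
  have "r < 1" using M1 by (simp add: r_def real_sqrt_lt_1_iff)
  moreover have "\<exists>p\<in>Lam. cmod (mob p z) \<le> r" if z: "cmod z < 1" for z
  proof -
    define s where "s = sqrt (1 - (cmod z)\<^sup>2)"
    have s2: "s\<^sup>2 = 1 - (cmod z)\<^sup>2" and s0: "s > 0" and s1: "s \<le> 1"
      using z by (auto simp: s_def power_less_one_iff power_le_one)
    \<comment> \<open>With \<open>N\<close> about \<open>1 / s\<close>, both \<open>2 / N\<close>
      and \<open>N * s^2\<close> are of order \<open>s\<close>.\<close>
    define N where "N = nat \<lceil>1 / s\<rceil>"
    have is1: "1 / s \<ge> 1" using s0 s1 by simp
    have N: "N \<ge> 1" "1 / s \<le> N" "N \<le> 1 / s + 1"
      using is1 unfolding N_def by linarith+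
    have N2: "N * s \<le> 2" using N(3) s0 s1 by (simp add: field_simps)
    have Ns: "2 / N \<le> 2 * s" using N(1,2) s0 by (simp add: field_simps)
    obtain a b c d where D: "c \<noteq> 0 \<or> d \<noteq> 0" "cmod (gauss c d) \<le> 2 * N"
        "cmod (gauss a b + gauss c d * (of_real (sqrt 3) * z)) \<le> 2 / N"
      using dirichlet_gauss[OF N(1), of "of_real (sqrt 3) * z"] by blast
    \<comment> \<open>\<open>v\<close> and \<open>w\<close> are numerator and denominator of the
      quaternion \<open>(a, -b, c, -d)\<close> acting on \<open>z\<close>. Dirichlet makes
      \<open>w\<close> small, and \<open>cnj z * z = 1 - s^2\<close> shows that \<open>v\<close>
      differs from \<open>z * cnj w\<close> only by a term of order \<open>s\<close>.\<close>
    define w where "w = gauss a b + gauss c d * (of_real (sqrt 3) * z)"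
    define v where "v = gauss a (- b) * z + of_real (sqrt 3) * gauss c (- d)"
    have cg: "cnj (gauss x y) = gauss x (- y)" for x y by (simp add: gauss_def complex_eq_iff)
    have w: "cmod w \<le> 2 * s" using D(3) Ns by (simp add: w_def)
    have zz: "cnj z * z = 1 - of_real (s\<^sup>2)"
      unfolding s2 of_real_diff complex_norm_square by (simp add: mult.commute)
    have "cnj v = cnj z * w + of_real (sqrt 3) * gauss c d * of_real (s\<^sup>2)"
    proof -
      have "cnj z * w = gauss a b * cnj z + gauss c d * of_real (sqrt 3) * (cnj z * z)"
        by (simp add: w_def algebra_simps)
      then show ?thesis unfolding zz by (simp add: v_def cg algebra_simps)
    qed
    then have "cmod v = cmod (cnj z * w + of_real (sqrt 3) * gauss c d * of_real (s\<^sup>2))" by (metis complex_mod_cnj)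
    also have "\<dots> \<le> cmod (cnj z * w) + cmod (of_real (sqrt 3) * gauss c d * of_real (s\<^sup>2))" by (rule norm_triangle_ineq)
    also have "cmod (cnj z * w) \<le> 1 * (2 * s)" unfolding norm_mult using z w by (intro mult_mono) auto
    also have "cmod (of_real (sqrt 3) * gauss c d * of_real (s\<^sup>2)) \<le> 8 * s"
    proof -
      have s3: "sqrt 3 \<le> 2" by (rule real_le_lsqrt) auto
      have "cmod (of_real (sqrt 3) * gauss c d * of_real (s\<^sup>2)) = sqrt 3 * (cmod (gauss c d) * s\<^sup>2)"
        unfolding norm_mult norm_of_real by (simp add: mult_ac)
      also have "\<dots> \<le> 2 * (2 * N * s\<^sup>2)" using s3 D(2) by (intro mult_mono) auto
      also have "\<dots> = 4 * s * (N * s)" by (simp add: power2_eq_square)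
      also have "\<dots> \<le> 4 * s * 2" using N2 s0 by (intro mult_left_mono) auto
      finally show ?thesis by simp
    qed
    finally have v: "cmod v \<le> 10 * s" by simp
    define x where "x = (a, - b, c, - d)"
    define n where "n = nrm x"
    have n: "n = a\<^sup>2 + b\<^sup>2 - 3 * (c\<^sup>2 + d\<^sup>2)" by (simp add: n_def nrm_def x_def)
    \<comment> \<open>A quaternion of norm \<open>n\<close> multiplies the indefinite form by
      \<open>n\<close>; here it is evaluated at the image of \<open>(z, 1)\<close>.\<close>
    have ns: "of_int n * s\<^sup>2 = (cmod w)\<^sup>2 - (cmod v)\<^sup>2"
    proof -
      have "complex_of_real ((cmod w)\<^sup>2 - (cmod v)\<^sup>2) = w * cnj w - v * cnj v" by (simp only: of_real_diff complex_norm_square)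
      also have "\<dots> = (gauss a b * cnj (gauss a b) - 3 * (gauss c d * cnj (gauss c d))) * (1 - cnj z * z)"
        using sqrt3_sq by (simp add: w_def v_def cg algebra_simps)
      also have "\<dots> = of_int n * of_real (s\<^sup>2)"
        unfolding zz n using norm_gauss by (simp add: complex_norm_square[symmetric])
      finally have "complex_of_real ((cmod w)\<^sup>2 - (cmod v)\<^sup>2) = complex_of_real (of_int n * s\<^sup>2)" by simp
      then show ?thesis by (simp only: of_real_eq_iff)
    qed
    have "(cmod w)\<^sup>2 \<le> (2 * s)\<^sup>2" "(cmod v)\<^sup>2 \<le> (10 * s)\<^sup>2" using power_mono[OF w, of 2] power_mono[OF v, of 2] by simp_all
    then have "(cmod w)\<^sup>2 \<le> 4 * s\<^sup>2" "(cmod v)\<^sup>2 \<le> 100 * s\<^sup>2" by (simp_all add: power_mult_distrib)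
    then have "\<bar>(cmod w)\<^sup>2 - (cmod v)\<^sup>2\<bar> \<le> 104 * s\<^sup>2"
      using zero_le_power2[of "cmod w"] zero_le_power2[of "cmod v"] zero_le_power2[of s] by linarith
    then have "\<bar>of_int n\<bar> * s\<^sup>2 \<le> 104 * s\<^sup>2" unfolding ns[symmetric] by (simp add: abs_mult)
    then have "\<bar>real_of_int n\<bar> \<le> 104" using s0 by simp
    then have nb: "\<bar>n\<bar> \<le> 104" by linarith
    have n0: "n \<noteq> 0" using anisotropic[of a b c d] D(1) unfolding n by auto
    have "x \<in> X" using n0 nb by (simp add: X_def n_def)
    then obtain y where y: "y \<in> Y" "key x = key y" using Y(3) by (metis imageE imageI)
    obtain a0 b0 c0 d0 where y': "y = (a0,b0,c0,d0)" by (cases y)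
    have ny: "nrm y = n" and cong: "a mod (3*n) = a0 mod (3*n)" "(-b) mod (3*n) = b0 mod (3*n)"
        "c mod (3*n) = c0 mod (3*n)" "(-d) mod (3*n) = d0 mod (3*n)"
      using y(2) by (auto simp: key_def y' x_def Let_def n_def)
    have n': "n = a0\<^sup>2 + b0\<^sup>2 - 3 * (c0\<^sup>2 + d0\<^sup>2)" using ny by (simp add: nrm_def y')
    have ex: "\<exists>u. x = y + m * u" if "x mod m = y mod m" for x y m :: int
    proof -
      have "m dvd x - y" using that by (simp add: mod_eq_dvd_iff)
      then obtain u where "x - y = m * u" by (elim dvdE)
      then show ?thesis by (intro exI[of _ u]) simp
    qed
    obtain u1 u2 u3 u4 where u: "a = a0 + 3*n*u1" "-b = b0 + 3*n*u2" "c = c0 + 3*n*u3" "-d = d0 + 3*n*u4"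
      using ex[OF cong(1)] ex[OF cong(2)] ex[OF cong(3)] ex[OF cong(4)] by blast
    \<comment> \<open>As \<open>y\<close> has the same norm \<open>n\<close> as \<open>x\<close> and
      is congruent to it modulo \<open>3 * n\<close>, the conjugate of \<open>y\<close> times
      \<open>x\<close> is congruent to \<open>n\<close> modulo \<open>3 * n\<close>. Dividing by
      \<open>n\<close> gives the integral element \<open>g\<close>, congruent to 1 modulo 3.\<close>
    define g where "g = quat (1 + 3 * (a0*u1 + b0*u2 - 3*(c0*u3 + d0*u4))) (3 * (a0*u2 - b0*u1 - 3*(d0*u3 - c0*u4)))
        (3 * (a0*u3 + b0*u4 - c0*u1 - d0*u2)) (3 * (a0*u4 - b0*u3 - d0*u1 + c0*u2))"
    have gm: "mmul (minv (quat a0 b0 c0 d0)) (quat a (-b) c (-d)) = (of_int n * fst g, of_int n * snd g)"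
    proof -
      have sc: "(of_int n * fst (quat p q r t), of_int n * snd (quat p q r t)) = quat (n*p) (n*q) (n*r) (n*t)" for p q r t
        by (simp add: quat_def gauss_def complex_eq_iff)
      show ?thesis unfolding g_def sc minv_quat mmul_quat u
        by (rule quat_cong) (simp_all add: n' algebra_simps power2_eq_square)
    qed
    have gsu: "g \<in> su11"
    proof -
      have "of_int (n * n) = (cmod (fst (mmul (minv (quat a0 b0 c0 d0)) (quat a (-b) c (-d)))))\<^sup>2 -
          (cmod (snd (mmul (minv (quat a0 b0 c0 d0)) (quat a (-b) c (-d)))))\<^sup>2"
        unfolding minv_quat mmul_quat quat_norm of_int_eq_iff
        using n n' by algebra
      also have "\<dots> = (of_int n)\<^sup>2 * ((cmod (fst g))\<^sup>2 - (cmod (snd g))\<^sup>2)"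
        unfolding gm by (simp add: norm_mult power_mult_distrib right_diff_distrib)
      finally show ?thesis using n0 by (simp add: su11_def power2_eq_square)
    qed
    have gL: "g \<in> Lam" using gsu unfolding g_def by (rule LamI) simp_all
    let ?den = "cnj (snd g) * z + cnj (fst g)"
    have "of_int n * ?den = cnj (of_int n * snd g) * z + cnj (of_int n * fst g)" by (simp add: algebra_simps)
    also have "\<dots> = gauss a0 b0 * w - of_real (sqrt 3) * cnj (gauss c0 d0) * v"
    proof -
      have gg: "of_int n * fst g = fst (mmul (minv (quat a0 b0 c0 d0)) (quat a (-b) c (-d)))"
        "of_int n * snd g = snd (mmul (minv (quat a0 b0 c0 d0)) (quat a (-b) c (-d)))"
        using gm by simp_all
      show ?thesis unfolding gg using sqrt3_sq
        by (simp add: mmul_def minv_def quat_def w_def v_def cg[symmetric] algebra_simps)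
    qed
    finally have den: "of_int n * ?den = gauss a0 b0 * w - of_real (sqrt 3) * cnj (gauss c0 d0) * v" .
    have "cmod ?den \<le> cmod (of_int n * ?den)"
    proof -
      have "\<bar>real_of_int n\<bar> \<ge> 1" using n0 by linarith
      then show ?thesis by (simp add: norm_mult mult_le_cancel_right1)
    qed
    also have "\<dots> \<le> cmod (gauss a0 b0 * w) + cmod (of_real (sqrt 3) * cnj (gauss c0 d0) * v)"
      unfolding den by (rule norm_triangle_ineq4)
    also have "\<dots> = cmod (gauss a0 b0) * cmod w + sqrt 3 * cmod (gauss c0 d0) * cmod v" by (simp add: norm_mult)
    \<comment> \<open>The bound \<open>2 * s\<close> on \<open>w\<close> is relaxed to
      \<open>20 * s\<close> so that both terms carry the same factor.\<close>
    also have "\<dots> \<le> cmod (gauss a0 b0) * (20 * s) + 2 * cmod (gauss c0 d0) * (10 * s)"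
    proof (intro add_mono mult_mono)
      show "sqrt 3 \<le> 2" by (rule real_le_lsqrt) auto
    qed (use w v s0 in auto)
    also have "\<dots> = 20 * s * sz y" by (simp add: sz_def y' algebra_simps)
    also have "\<dots> \<le> 20 * s * M" using szM[OF y(1)] s0 by (intro mult_left_mono) auto
    finally have dle: "cmod ?den \<le> 20 * M * s" by (simp add: mult_ac)
    have dpos: "cmod ?den > 0" using mob_denom_nz[OF gsu z] by simp
    have "1 / (20 * M)\<^sup>2 = s\<^sup>2 / (20 * M * s)\<^sup>2" using s0 M1 by (simp add: power_mult_distrib)
    also have "\<dots> \<le> s\<^sup>2 / (cmod ?den)\<^sup>2" using dle dpos s0 M1
      by (intro divide_left_mono power_mono mult_pos_pos zero_less_power) auto
    also have "\<dots> = 1 - (cmod (mob g z))\<^sup>2" unfolding mob_norm[OF gsu z] s2 ..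
    finally have "cmod (mob g z) \<le> r" unfolding r_def by (intro real_le_rsqrt) simp
    then show ?thesis using gL by blast
  qed
  ultimately show ?thesis by blast
qed

section \<open>Flatness of finely ramified maps\<close>

text \<open>Every point has pseudo-hyperbolic distance less than \<open>\<eta>\<close> from some
  point of \<open>A\<close>; the quotient is cleared.\<close>

definition dense_in_disc :: "real \<Rightarrow> complex set \<Rightarrow> bool" where
  "dense_in_disc \<eta> A \<longleftrightarrow> (\<forall>z. cmod z < 1 \<longrightarrow> (\<exists>a\<in>A. cmod (a - z) < \<eta> * cmod (1 - cnj z * a)))"

definition recenter :: "(complex \<Rightarrow> complex) \<Rightarrow> complex \<Rightarrow> complex \<Rightarrow> complex" where
  "recenter f z u = mob (mshift (- f z)) (f (mob (mshift z) u))"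

lemma mob_one_minus:
  assumes p: "p \<in> su11" and z: "cmod z < 1" and w: "cmod w < 1"
  shows "1 - cnj (mob p z) * mob p w =
    (1 - cnj z * w) / (cnj (cnj (snd p) * z + cnj (fst p)) * (cnj (snd p) * w + cnj (fst p)))"
proof -
  let ?dz = "cnj (snd p) * z + cnj (fst p)" and ?dw = "cnj (snd p) * w + cnj (fst p)"
  have nz: "?dz \<noteq> 0" "?dw \<noteq> 0" using mob_denom_nz[OF p] z w by auto
  then have nz': "cnj ?dz \<noteq> 0" by (metis complex_cnj_zero_iff)
  have "cnj ?dz * ?dw - cnj (fst p * z + snd p) * (fst p * w + snd p) =
      (fst p * cnj (fst p) - snd p * cnj (snd p)) * (1 - cnj z * w)" by (simp add: algebra_simps)
  also have "\<dots> = 1 - cnj z * w" using p su11_iff by simp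
  finally have e: "cnj ?dz * ?dw - cnj (fst p * z + snd p) * (fst p * w + snd p) = 1 - cnj z * w" .
  have "1 - cnj (mob p z) * mob p w = 1 - (cnj (fst p * z + snd p) * (fst p * w + snd p)) / (cnj ?dz * ?dw)"
    unfolding mob_def complex_cnj_divide by simp
  also have "\<dots> = (cnj ?dz * ?dw - cnj (fst p * z + snd p) * (fst p * w + snd p)) / (cnj ?dz * ?dw)"
    using nz nz' by (simp only: diff_divide_distrib divide_self mult_eq_0_iff simp_thms)
  finally show ?thesis unfolding e .
qed

lemma pseudo_dist_mob:
  assumes p: "p \<in> su11" and y: "cmod y < 1" and a: "cmod a < 1" and d: "cmod (a - y) < \<eta> * cmod (1 - cnj y * a)"
  shows "cmod (mob p a - mob p y) < \<eta> * cmod (1 - cnj (mob p y) * mob p a)"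
proof -
  let ?da = "cmod (cnj (snd p) * a + cnj (fst p))" and ?dy = "cmod (cnj (snd p) * y + cnj (fst p))"
  have pos: "?da > 0" "?dy > 0" using mob_denom_nz[OF p] a y by auto
  have 1: "cmod (mob p a - mob p y) = cmod (a - y) / (?da * ?dy)"
    unfolding mob_diff[OF p a y] by (simp add: norm_divide norm_mult)
  have 2: "cmod (1 - cnj (mob p y) * mob p a) = cmod (1 - cnj y * a) / (?dy * ?da)"
    unfolding mob_one_minus[OF p y a] norm_divide norm_mult complex_mod_cnj ..
  show ?thesis
    unfolding 1 2 using d pos by (simp add: divide_strict_right_mono mult.commute)
qed

lemma dense_in_disc_mob:
  assumes d: "dense_in_disc \<eta> A" and A: "A \<subseteq> ball 0 1" and p: "p \<in> su11"
  shows "dense_in_disc \<eta> (mob p ` A)"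
  unfolding dense_in_disc_def
proof (intro allI impI)
  fix z :: complex assume z: "cmod z < 1"
  define y where "y = mob (minv p) z"
  have y: "cmod y < 1" "mob p y = z"
    using mob_in_disc[OF minv_su11[OF p] z] mob_minv(2)[OF p z] by (auto simp: y_def)
  obtain a where a: "a \<in> A" "cmod (a - y) < \<eta> * cmod (1 - cnj y * a)"
    using d y(1) unfolding dense_in_disc_def by blast
  have ca: "cmod a < 1" using a A by auto
  have "cmod (mob p a - mob p y) < \<eta> * cmod (1 - cnj (mob p y) * mob p a)"
    by (rule pseudo_dist_mob[OF p y(1) ca a(2)])
  then show "\<exists>a\<in>mob p ` A. cmod (a - z) < \<eta> * cmod (1 - cnj z * a)" using a(1) y(2) by auto
qed

lemma recenter_props:
  assumes f: "disc_map f" and z: "cmod z < 1"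
  shows "disc_map (recenter f z)" "recenter f z 0 = 0"
proof -
  have fz: "cmod (- f z) < 1" using disc_map_norm[OF f z] by simp
  show "disc_map (recenter f z)" unfolding recenter_def[abs_def]
    by (intro disc_map_compose[OF disc_map_mob[OF mshift_su11[OF fz]]] disc_map_compose[OF f] disc_map_mob mshift_su11 z)
  show "recenter f z 0 = 0" using z disc_map_norm[OF f z] by (simp add: recenter_def)
qed

lemma recenter_ramified:
  assumes f: "ramified A f" and A: "A \<subseteq> ball 0 1" and z: "cmod z < 1"
  shows "ramified (mob (mshift (- f z)) ` A) (recenter f z)"
proof -
  have fz: "cmod (- f z) < 1" using disc_map_norm[OF ramified_disc_map[OF f] z] by simp
  show ?thesis unfolding recenter_def[abs_def]
    by (rule ramified_mob[OF ramified_compose[OF f disc_map_mob[OF mshift_su11[OF z]]] mshift_su11[OF fz] A])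
qed

text \<open>For each \<open>z\<close> the function \<open>g - g z\<close> is the square of a
  function vanishing at \<open>z\<close>, so \<open>g\<close> has derivative 0 everywhere.\<close>

lemma all_shifts_square_constant:
  assumes g: "disc_map g" "g 0 = 0" and sq: "\<And>c. cmod c < 1 \<Longrightarrow> has_sqrt (\<lambda>z. g z - c)" and z: "cmod z < 1"
  shows "g z = 0"
proof -
  have "(g has_field_derivative 0) (at z)" if z: "cmod z < 1" for z
  proof -
    obtain h where h: "h holomorphic_on ball 0 1" "\<And>u. cmod u < 1 \<Longrightarrow> g u - g z = (h u)\<^sup>2"
      using sq[OF disc_map_norm[OF g(1) z]] unfolding has_sqrt_def by blast
    have hz: "h z = 0" using h(2)[OF z] by simp
    have "((\<lambda>u. (h u)\<^sup>2 + g z) has_field_derivative 2 * h z * deriv h z) (at z)"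
      using holomorphic_derivI[OF h(1) open_ball, of z] z by (auto intro!: derivative_eq_intros)
    then have d0: "((\<lambda>u. (h u)\<^sup>2 + g z) has_field_derivative 0) (at z)" using hz by simp
    have eq: "(h u)\<^sup>2 + g z = g u" if "u \<in> ball 0 1" for u
      using h(2)[of u] that by (metis diff_add_cancel mem_ball_0)
    show ?thesis
      by (rule has_field_derivative_transform_within_open[OF d0 open_ball[of 0 1] _ eq]) (use z in auto)
  qed
  then have "(g has_field_derivative 0) (at x within ball 0 1)" if "x \<in> ball 0 1" for x
    using that has_field_derivative_at_within unfolding mem_ball_0 by blast
  from has_field_derivative_zero_constant[OF convex_ball this]
  obtain c where c: "\<And>x. x \<in> ball 0 1 \<Longrightarrow> g x = c" by blast
  show ?thesis using c[of 0] c[of z] g(2) z by simp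
qed

text \<open>Recentring the failing maps absorbs the base point into the branch set. Branch points
  \<open>a n\<close> tending to \<open>c\<close> and \<open>has_sqrt_limit\<close> make
  \<open>G - c\<close> a square for every \<open>c\<close>; uniform convergence on
  \<open>cball 0 r\<close> then contradicts the lower bound \<open>\<epsilon>\<close>.\<close>

lemma ramified_recenter_small:
  assumes r: "r < 1" and \<epsilon>: "\<epsilon> > 0"
  shows "\<exists>\<eta>>0. \<forall>A f z. A \<subseteq> ball 0 1 \<and> dense_in_disc \<eta> A \<and> ramified A f \<and> cmod z < 1 \<longrightarrow>
           (\<forall>u. cmod u \<le> r \<longrightarrow> cmod (recenter f z u) \<le> \<epsilon>)"
proof (rule ccontr)
  assume "\<not> ?thesis"
  then have neg: "\<forall>\<eta>>0. \<exists>A f z u. A \<subseteq> ball 0 1 \<and> dense_in_disc \<eta> A \<and> ramified A f \<and> cmod z < 1 \<and>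
           cmod u \<le> r \<and> cmod (recenter f z u) > \<epsilon>" by (meson not_le)
  have "\<forall>n. \<exists>A g u. A \<subseteq> ball 0 1 \<and> dense_in_disc (1 / Suc n) A \<and> ramified A g \<and> g 0 = 0 \<and> cmod u \<le> r \<and> cmod (g u) > \<epsilon>"
  proof
    fix n :: nat
    obtain A f z u where *: "A \<subseteq> ball 0 1" "dense_in_disc (1 / Suc n) A" "ramified A f" "cmod z < 1"
           "cmod u \<le> r" "cmod (recenter f z u) > \<epsilon>" using neg[rule_format, of "1 / Suc n"] by auto
    note fd = ramified_disc_map[OF *(3)]
    have su: "mshift (- f z) \<in> su11" using disc_map_norm[OF fd *(4)] by (intro mshift_su11) simp
    have "mob (mshift (- f z)) ` A \<subseteq> ball 0 1" using mob_in_disc[OF su] *(1) by auto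
    then show "\<exists>A g u. A \<subseteq> ball 0 1 \<and> dense_in_disc (1 / Suc n) A \<and> ramified A g \<and> g 0 = 0 \<and> cmod u \<le> r \<and> cmod (g u) > \<epsilon>"
      using dense_in_disc_mob[OF *(2,1) su] recenter_ramified[OF *(3,1,4)] recenter_props(2)[OF fd *(4)] *(5,6) by blast
  qed
  then obtain A g u where *: "\<And>n. A n \<subseteq> ball 0 1" "\<And>n. dense_in_disc (1 / Suc n) (A n)" "\<And>n. ramified (A n) (g n)"
      "\<And>n. g n 0 = 0" "\<And>n. cmod (u n) \<le> r" "\<And>n. cmod (g n (u n)) > \<epsilon>"
    by metis
  note gd = ramified_disc_map[OF *(3)]
  obtain G s where G: "G holomorphic_on ball 0 1" "strict_mono (s :: nat \<Rightarrow> nat)"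
    "\<forall>z. cmod z < 1 \<longrightarrow> (\<lambda>n. g (s n) z) \<longlonglongrightarrow> G z"
    "\<forall>K. compact K \<longrightarrow> K \<subseteq> ball 0 1 \<longrightarrow> uniform_limit K (\<lambda>n. g (s n)) G sequentially"
    using montel_disc_map[of g, OF gd] by blast
  have G0: "G 0 = 0" using G(3)[rule_format, of 0] *(4) by (simp add: LIMSEQ_const_iff)
  have Gd: "disc_map G"
    by (rule limit_disc_map[OF G(1), of "\<lambda>n. g (s n)" 0]) (use G gd G0 in auto)
  have "has_sqrt (\<lambda>z. G z - c)" if c: "cmod c < 1" for c
  proof -
    have "\<forall>n. \<exists>a\<in>A (s n). cmod (a - c) < 1 / Suc (s n) * cmod (1 - cnj c * a)"
      using *(2) c unfolding dense_in_disc_def by blast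
    then obtain a where a: "\<And>n. a n \<in> A (s n)" "\<And>n. cmod (a n - c) < 1 / Suc (s n) * cmod (1 - cnj c * a n)" by metis
    have an: "cmod (a n) < 1" for n using a(1)[of n] *(1)[of "s n"] by auto
    have le: "cmod (a n - c) \<le> 2 * (1 / Suc (s n))" for n
    proof -
      have "cmod (1 - cnj c * a n) \<le> 1 + cmod c * cmod (a n)"
        using norm_triangle_ineq4[of 1 "cnj c * a n"] by (simp add: norm_mult)
      also have "\<dots> \<le> 1 + 1 * 1" using c an[of n] by (intro add_mono mult_mono) auto
      finally have "1 / Suc (s n) * cmod (1 - cnj c * a n) \<le> 1 / Suc (s n) * 2" by (intro mult_left_mono) auto
      then show ?thesis using a(2)[of n] by linarith
    qed
    have i: "(\<lambda>n. 2 * (1 / real (Suc (s n)))) \<longlonglongrightarrow> 0"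
      using LIMSEQ_subseq_LIMSEQ[OF tendsto_mult_right_zero[OF LIMSEQ_Suc[OF lim_1_over_n[where 'a=real]], of 2] G(2)]
      by (simp add: o_def)
    have "(\<lambda>n. cmod (a n - c)) \<longlonglongrightarrow> 0"
      by (rule tendsto_sandwich[OF _ _ tendsto_const i]) (use le in \<open>auto intro!: always_eventually\<close>)
    then have "(\<lambda>n. a n - c) \<longlonglongrightarrow> 0" by (simp add: tendsto_norm_zero_iff)
    then have ac: "a \<longlonglongrightarrow> c" by (simp add: LIM_zero_iff)
    show ?thesis
    proof (rule has_sqrt_limit[of "\<lambda>n z. g (s n) z - a n" 2])
      show "has_sqrt (\<lambda>z. g (s n) z - a n)" for n using *(3)[of "s n"] a(1)[of n] by (simp add: ramified_def)
      show "cmod (g (s n) z - a n) \<le> 2" if "cmod z < 1" for n z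
        using norm_triangle_ineq4[of "g (s n) z" "a n"] disc_map_norm[OF gd that, of "s n"] an[of n] by linarith
      show "(\<lambda>n. g (s n) z - a n) \<longlonglongrightarrow> G z - c" if "cmod z < 1" for z
        by (intro tendsto_diff ac G(3)[rule_format, OF that])
    qed
  qed
  then have Gz: "G z = 0" if "cmod z < 1" for z using all_shifts_square_constant[OF Gd G0 _ that] by blast
  have sub: "cball 0 r \<subseteq> ball (0::complex) 1" using r by auto
  from uniform_limitD[OF G(4)[rule_format, OF compact_cball sub] \<epsilon>]
  obtain n where "\<forall>x\<in>cball 0 r. dist (g (s n) x) (G x) < \<epsilon>" unfolding eventually_sequentially by blast
  then have "cmod (g (s n) (u (s n)) - G (u (s n))) < \<epsilon>" using *(5)[of "s n"] by (simp add: dist_norm)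
  moreover have "cmod (u (s n)) < 1" using *(5)[of "s n"] r by simp
  ultimately show False using Gz[of "u (s n)"] *(6)[of "s n"] by simp
qed

text \<open>The second derivative of \<open>f\<close> with respect to the Poincare connections on source and target.\<close>

definition tension :: "(complex \<Rightarrow> complex) \<Rightarrow> complex \<Rightarrow> complex" where
  "tension f z = deriv (deriv f) z + 2 * cnj (f z) / of_real (1 - (cmod (f z))\<^sup>2) * (deriv f z)\<^sup>2
     - 2 * cnj z / of_real (1 - (cmod z)\<^sup>2) * deriv f z"

lemma mob_mshift_deriv:
  assumes a: "cmod a < 1" and z: "cmod z < 1"
  shows "(mob (mshift a) has_field_derivative of_real (1 - (cmod a)\<^sup>2) / (1 + cnj a * z)\<^sup>2) (at z)"
proof -
  have "1 - (cmod a)\<^sup>2 > 0" using a by (simp add: power_less_one_iff)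
  then have s: "(complex_of_real (sqrt (1 - (cmod a)\<^sup>2)))\<^sup>2 = of_real (1 - (cmod a)\<^sup>2)" by (simp flip: of_real_power)
  have d: "cnj (snd (mshift a)) * z + cnj (fst (mshift a)) = (1 + cnj a * z) / of_real (sqrt (1 - (cmod a)\<^sup>2))"
    by (simp add: mshift_def add_divide_distrib)
  show ?thesis using mob_has_derivative[OF mshift_su11[OF a] z] unfolding d power_divide s by simp
qed

text \<open>At 0 the Christoffel symbols of both Poincare metrics vanish, so after recentring the
  covariant second derivative is the ordinary one. The factor comes from the derivatives of the two
  shifts.\<close>

lemma recenter_second_deriv:
  assumes f: "disc_map f" and z: "cmod z < 1"
  shows "deriv (deriv (recenter f z)) 0 = of_real ((1 - (cmod z)\<^sup>2)\<^sup>2 / (1 - (cmod (f z))\<^sup>2)) * tension f z"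
proof -
  define c where "c = f z"
  have c: "cmod c < 1" "cmod (- c) < 1" using disc_map_norm[OF f z] by (auto simp: c_def)
  define Z C where "Z = complex_of_real (1 - (cmod z)\<^sup>2)" and "C = complex_of_real (1 - (cmod c)\<^sup>2)"
  have Z0: "Z \<noteq> 0" and C0: "C \<noteq> 0"
  proof -
    have "(cmod z)\<^sup>2 < 1" "(cmod c)\<^sup>2 < 1" using z c by (auto simp: power_less_one_iff)
    then show "Z \<noteq> 0" "C \<noteq> 0" unfolding Z_def C_def of_real_eq_0_iff by auto
  qed
  let ?t = "mob (mshift z)" and ?k = "mob (mshift (- c))"
  let ?t1 = "\<lambda>u. Z / (1 + cnj z * u)\<^sup>2" and ?k1 = "\<lambda>w. C / (1 - cnj c * w)\<^sup>2"
  have t: "(?t has_field_derivative ?t1 u) (at u)" if "cmod u < 1" for u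
    using mob_mshift_deriv[OF z that] by (simp add: Z_def)
  have k: "(?k has_field_derivative ?k1 w) (at w)" if "cmod w < 1" for w
    using mob_mshift_deriv[OF c(2) that] by (simp add: C_def)
  have td: "cmod (?t u) < 1" if "cmod u < 1" for u using mob_in_disc[OF mshift_su11[OF z] that] .
  have fd: "(f has_field_derivative deriv f w) (at w)" if "cmod w < 1" for w using disc_map_deriv[OF f that] .
  have "deriv (recenter f z) u = ?k1 (f (?t u)) * (deriv f (?t u) * ?t1 u)" if u: "cmod u < 1" for u
    unfolding recenter_def[abs_def] c_def[symmetric]
    by (rule DERIV_imp_deriv[OF DERIV_chain2[OF k[OF disc_map_norm[OF f td[OF u]]] DERIV_chain2[OF fd[OF td[OF u]] t[OF u]]]])
  then have "deriv (deriv (recenter f z)) 0 = deriv (\<lambda>u. ?k1 (f (?t u)) * (deriv f (?t u) * ?t1 u)) 0"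
    by (intro deriv_cong_disc) auto
  also have "\<dots> = (2 * cnj c / C\<^sup>2 * (deriv f z * Z)) * (deriv f z * Z) +
      (1 / C) * (deriv (deriv f) z * Z * Z + deriv f z * (- 2 * cnj z * Z))"
  proof (rule DERIV_imp_deriv)
    have t0: "?t 0 = z" using z by simp
    have cc: "1 - cnj c * c = C" by (simp add: C_def complex_norm_square mult.commute)
      (metis complex_norm_square mult.commute of_real_power)
    have K: "(?k1 has_field_derivative 2 * cnj c / C\<^sup>2) (at c)"
    proof -
      have "((\<lambda>w. C / (1 - cnj c * w)\<^sup>2) has_field_derivative
          - (C * (2 * (1 - cnj c * c) * (- cnj c))) / ((1 - cnj c * c)\<^sup>2 * (1 - cnj c * c)\<^sup>2)) (at c)"
        by (rule derivative_eq_intros refl | use cc C0 in simp)+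
      moreover have "- (C * (2 * (1 - cnj c * c) * (- cnj c))) / ((1 - cnj c * c)\<^sup>2 * (1 - cnj c * c)\<^sup>2) = 2 * cnj c / C\<^sup>2"
        unfolding cc using C0 by (simp add: field_simps power2_eq_square)
      ultimately show ?thesis by simp
    qed
    have T: "(?t1 has_field_derivative - 2 * cnj z * Z) (at 0)"
      by (rule derivative_eq_intros refl | simp)+
    have ft: "((\<lambda>u. f (?t u)) has_field_derivative deriv f z * Z) (at 0)"
      using DERIV_chain2[OF fd[of "?t 0"] t[of 0]] z by simp
    have Kft: "((\<lambda>u. ?k1 (f (?t u))) has_field_derivative 2 * cnj c / C\<^sup>2 * (deriv f z * Z)) (at 0)"
      by (rule DERIV_chain2[OF _ ft]) (use K t0 in \<open>simp add: c_def[symmetric]\<close>)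
    have "deriv f holomorphic_on ball 0 1" by (rule holomorphic_deriv[OF disc_map_holo[OF f] open_ball])
    then have f1: "(deriv f has_field_derivative deriv (deriv f) z) (at z)"
      using holomorphic_derivI[OF _ open_ball] z by simp
    have f1t: "((\<lambda>u. deriv f (?t u)) has_field_derivative deriv (deriv f) z * Z) (at 0)"
      using DERIV_chain2[of "deriv f" "deriv (deriv f) z" ?t 0 "?t1 0"] f1 t0 t[of 0] by simp
    have "((\<lambda>u. ?k1 (f (?t u)) * (deriv f (?t u) * ?t1 u)) has_field_derivative
       2 * cnj c / C\<^sup>2 * (deriv f z * Z) * (deriv f (?t 0) * ?t1 0) +
       (deriv (deriv f) z * Z * ?t1 0 + - 2 * cnj z * Z * deriv f (?t 0)) * ?k1 (f (?t 0))) (at 0)"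
      by (rule DERIV_mult[OF Kft DERIV_mult[OF f1t T]])
    then show "((\<lambda>u. ?k1 (f (?t u)) * (deriv f (?t u) * ?t1 u)) has_field_derivative
       2 * cnj c / C\<^sup>2 * (deriv f z * Z) * (deriv f z * Z) +
      1 / C * (deriv (deriv f) z * Z * Z + deriv f z * (- 2 * cnj z * Z))) (at 0)"
      unfolding t0 c_def[symmetric] cc using C0 by (simp add: power2_eq_square mult_ac)
  qed
  also have "\<dots> = Z\<^sup>2 / C * tension f z"
    unfolding tension_def c_def[symmetric] Z_def[symmetric] C_def[symmetric]
    using Z0 C0 by (simp add: field_simps power2_eq_square)
  finally show ?thesis unfolding Z_def C_def c_def by simp
qed

lemma tension_small:
  assumes f: "disc_map f" and z: "cmod z < 1" and r: "0 < r" "r < 1"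
    and sm: "\<And>u. cmod u \<le> r \<Longrightarrow> cmod (recenter f z u) \<le> B"
  shows "(1 - (cmod z)\<^sup>2)\<^sup>2 / (1 - (cmod (f z))\<^sup>2) * cmod (tension f z) \<le> 2 * B / r\<^sup>2"
proof -
  have hol: "recenter f z holomorphic_on ball 0 1" using disc_map_holo[OF recenter_props(1)[OF f z]] .
  have h1: "recenter f z holomorphic_on ball 0 r" using holomorphic_on_subset[OF hol] r by (simp add: subset_ball)
  have "cball 0 r \<subseteq> ball (0::complex) 1" using r by auto
  then have h2: "continuous_on (cball 0 r) (recenter f z)"
    using continuous_on_subset[OF holomorphic_on_imp_continuous_on[OF hol]] by blast
  have "cmod ((deriv ^^ 2) (recenter f z) 0) \<le> fact 2 * B / r ^ 2"
    by (rule Cauchy_inequality[OF h1 h2 r(1)]) (use sm in auto)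
  moreover have "(deriv ^^ 2) (recenter f z) 0 = deriv (deriv (recenter f z)) 0" by (simp add: numeral_2_eq_2)
  moreover have "(1 - (cmod (f z))\<^sup>2) > 0" using disc_map_norm[OF f z] by (simp add: power_less_one_iff)
  moreover from this have "cmod (deriv (deriv (recenter f z)) 0) = (1 - (cmod z)\<^sup>2)\<^sup>2 / (1 - (cmod (f z))\<^sup>2) * cmod (tension f z)"
    unfolding recenter_second_deriv[OF f z] norm_mult norm_of_real by simp
  ultimately show ?thesis by simp
qed

section \<open>The geometry of graphs\<close>

definition graph :: "(complex \<Rightarrow> complex) \<Rightarrow> (complex \<times> complex) set" where
  "graph F = {(z, F z) | z. cmod z < 1}"

text \<open>In a Hermitian plane the part of \<open>a\<close> orthogonal to \<open>v\<close> is
  measured by the determinant of the two vectors: the squared norm of that part is the Gram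
  determinant over the squared norm of \<open>v\<close>.\<close>

lemma normal_component:
  fixes v1 v2 a1 a2 c n1 n2 :: complex and A1 A2 Q :: real
  assumes A: "A1 > 0" "A2 > 0" and Q: "Q = (cmod v1)\<^sup>2 / A1 + (cmod v2)\<^sup>2 / A2" "Q > 0"
    and c: "c = (a1 * cnj v1 / of_real A1 + a2 * cnj v2 / of_real A2) / of_real Q"
    and n: "n1 = a1 - c * v1" "n2 = a2 - c * v2"
  shows "(cmod n1)\<^sup>2 / A1 + (cmod n2)\<^sup>2 / A2 = (cmod (a1 * v2 - a2 * v1))\<^sup>2 / (A1 * A2 * Q)"
proof -
  define W where "W = a1 * v2 - a2 * v1"
  let ?A1 = "complex_of_real A1" and ?A2 = "complex_of_real A2" and ?Q = "complex_of_real Q"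
  have nz: "?A1 \<noteq> 0" "?A2 \<noteq> 0" "?Q \<noteq> 0" using A Q(2) by auto
  have Qc: "?Q = v1 * cnj v1 / ?A1 + v2 * cnj v2 / ?A2"
    unfolding Q(1) of_real_add of_real_divide complex_norm_square ..
  have cQ: "c * ?Q = a1 * cnj v1 / ?A1 + a2 * cnj v2 / ?A2" using c nz by simp
  have "n1 * ?Q = a1 * ?Q - v1 * (c * ?Q)" unfolding n by (simp add: algebra_simps)
  also have "\<dots> = cnj v2 * W / ?A2" unfolding cQ unfolding Qc W_def using nz by (simp add: field_simps)
  finally have "cmod (n1 * ?Q) = cmod (cnj v2 * W / ?A2)" by simp
  then have 1: "cmod n1 * Q = cmod v2 * cmod W / A2" using A Q(2) by (simp add: norm_mult norm_divide)
  have "n2 * ?Q = a2 * ?Q - v2 * (c * ?Q)" unfolding n by (simp add: algebra_simps)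
  also have "\<dots> = - (cnj v1 * W / ?A1)" unfolding cQ unfolding Qc W_def using nz by (simp add: field_simps)
  finally have "cmod (n2 * ?Q) = cmod (cnj v1 * W / ?A1)" by simp
  then have 2: "cmod n2 * Q = cmod v1 * cmod W / A1" using A Q(2) by (simp add: norm_mult norm_divide)
  have 1: "cmod n1 = cmod v2 * cmod W / (A2 * Q)" using 1 Q(2) A by (simp add: field_simps)
  have 2: "cmod n2 = cmod v1 * cmod W / (A1 * Q)" using 2 Q(2) A by (simp add: field_simps)
  have "(cmod n1)\<^sup>2 / A1 + (cmod n2)\<^sup>2 / A2 = (cmod W)\<^sup>2 / (A1 * A2 * Q\<^sup>2) * ((cmod v1)\<^sup>2 / A1 + (cmod v2)\<^sup>2 / A2)"
    unfolding 1 2 power_divide power_mult_distrib using A Q(2) by (simp add: field_simps power2_eq_square)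
  also have "\<dots> = (cmod W)\<^sup>2 / (A1 * A2 * Q)" unfolding Q(1)[symmetric] using Q(2) by (simp add: power2_eq_square)
  finally show ?thesis unfolding W_def .
qed

text \<open>The determinant of acceleration and velocity is \<open>- (v1 ^ 3 * tension)\<close>,
  because the second derivative of the parametrisation cancels. The bound then uses
  \<open>|v1|^2 \<le> A1 * Q\<close>: the velocity is at least as long as its horizontal
  part.\<close>

lemma sff_norm_graph:
  assumes F: "disc_map F" and hol: "(\<lambda>s. fst (\<gamma> s)) holomorphic_on ball 0 r" and t: "t \<in> ball 0 r"
    and gr: "\<And>s. s \<in> ball 0 r \<Longrightarrow> cmod (fst (\<gamma> s)) < 1 \<and> snd (\<gamma> s) = F (fst (\<gamma> s))"
    and nz: "deriv (\<lambda>s. fst (\<gamma> s)) t \<noteq> 0"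
  shows "sff_norm \<gamma> t \<le> (1 - (cmod (fst (\<gamma> t)))\<^sup>2)\<^sup>2 / (1 - (cmod (F (fst (\<gamma> t))))\<^sup>2) * cmod (tension F (fst (\<gamma> t)))"
    and "sff_norm \<gamma> t = 0 \<Longrightarrow> tension F (fst (\<gamma> t)) = 0"
proof -
  define g1 g2 where "g1 = (\<lambda>s. fst (\<gamma> s))" and "g2 = (\<lambda>s. snd (\<gamma> s))"
  define x where "x = g1 t"
  have x: "cmod x < 1" and g2x: "g2 t = F x" using gr[OF t] by (auto simp: x_def g1_def g2_def)
  have g1d: "(g1 has_field_derivative deriv g1 s) (at s)" if "s \<in> ball 0 r" for s
    using holomorphic_derivI[OF hol open_ball that] by (simp add: g1_def)
  have g1n: "cmod (g1 s) < 1" if "s \<in> ball 0 r" for s using gr[OF that] by (simp add: g1_def)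
  have ev: "\<forall>\<^sub>F s in nhds u. s \<in> ball 0 r" if "u \<in> ball 0 r" for u
    by (rule eventually_nhds_in_open) (use that in auto)
  have g2eq: "g2 s = F (g1 s)" if "s \<in> ball 0 r" for s using gr[OF that] by (simp add: g1_def g2_def)
  have dg2: "deriv g2 s = deriv F (g1 s) * deriv g1 s" if s: "s \<in> ball 0 r" for s
  proof -
    have "deriv g2 s = deriv (\<lambda>s. F (g1 s)) s"
      by (rule deriv_cong_ev[OF eventually_mono[OF ev[OF s]] refl]) (simp add: g2eq)
    also have "\<dots> = deriv F (g1 s) * deriv g1 s"
      by (rule DERIV_imp_deriv[OF DERIV_chain2[OF disc_map_deriv[OF F g1n[OF s]] g1d[OF s]]])
    finally show ?thesis .
  qed
  have "deriv F holomorphic_on ball 0 1" by (rule holomorphic_deriv[OF disc_map_holo[OF F] open_ball])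
  then have F1: "(deriv F has_field_derivative deriv (deriv F) x) (at x)"
    using holomorphic_derivI[OF _ open_ball] x by simp
  have "deriv g1 holomorphic_on ball 0 r" by (rule holomorphic_deriv) (use hol in \<open>auto simp: g1_def\<close>)
  then have g11: "(deriv g1 has_field_derivative deriv (deriv g1) t) (at t)"
    using holomorphic_derivI[OF _ open_ball t] by simp
  have ddg2: "deriv (deriv g2) t = deriv (deriv F) x * (deriv g1 t)\<^sup>2 + deriv F x * deriv (deriv g1) t"
  proof -
    have "deriv (deriv g2) t = deriv (\<lambda>s. deriv F (g1 s) * deriv g1 s) t"
      by (rule deriv_cong_ev[OF eventually_mono[OF ev[OF t]] refl]) (simp add: dg2)
    also have "\<dots> = deriv (deriv F) x * deriv g1 t * deriv g1 t + deriv (deriv g1) t * deriv F (g1 t)"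
      by (rule DERIV_imp_deriv[OF DERIV_mult[OF DERIV_chain2[OF _ g1d[OF t]] g11]]) (use F1 in \<open>simp add: x_def\<close>)
    finally show ?thesis by (simp add: x_def power2_eq_square algebra_simps)
  qed
  define v1 v2 where "v1 = deriv g1 t" and "v2 = deriv g2 t"
  define a1 where "a1 = deriv (deriv g1) t + 2 * cnj x / of_real (1 - (cmod x)\<^sup>2) * v1\<^sup>2"
  define a2 where "a2 = deriv (deriv g2) t + 2 * cnj (F x) / of_real (1 - (cmod (F x))\<^sup>2) * v2\<^sup>2"
  define A1 A2 where "A1 = (1 - (cmod x)\<^sup>2)\<^sup>2" and "A2 = (1 - (cmod (F x))\<^sup>2)\<^sup>2"
  define Q where "Q = (cmod v1)\<^sup>2 / A1 + (cmod v2)\<^sup>2 / A2"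
  define c where "c = (a1 * cnj v1 / of_real A1 + a2 * cnj v2 / of_real A2) / of_real Q"
  define n1 n2 where "n1 = a1 - c * v1" and "n2 = a2 - c * v2"
  define D where "D = tension F x"
  have ux: "1 - (cmod x)\<^sup>2 > 0" and uF: "1 - (cmod (F x))\<^sup>2 > 0"
    using x disc_map_norm[OF F x] by (auto simp: power_less_one_iff)
  have A: "A1 > 0" "A2 > 0" using ux uF by (auto simp: A1_def A2_def)
  have v1: "v1 \<noteq> 0" using nz by (simp add: v1_def g1_def)
  have Q0: "Q > 0" unfolding Q_def using v1 A by (intro add_pos_nonneg) auto
  have v2: "v2 = deriv F x * v1" unfolding v2_def dg2[OF t] v1_def x_def ..
  have pq: "pmetric (\<gamma> t) (v1, v2) (v1, v2) = of_real Q"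
    using g2x unfolding pmetric_def Q_def of_real_add of_real_divide complex_norm_square A1_def A2_def
    by (simp add: x_def g1_def g2_def)
  have pa: "pmetric (\<gamma> t) (a1, a2) (v1, v2) = a1 * cnj v1 / of_real A1 + a2 * cnj v2 / of_real A2"
    using g2x unfolding pmetric_def A1_def A2_def by (simp add: x_def g1_def g2_def)
  have pn: "pmetric (\<gamma> t) (n1, n2) (n1, n2) = of_real ((cmod n1)\<^sup>2 / A1 + (cmod n2)\<^sup>2 / A2)"
    using g2x unfolding pmetric_def of_real_add of_real_divide complex_norm_square A1_def A2_def
    by (simp add: x_def g1_def g2_def)
  have fs: "fst (\<gamma> t) = x" "snd (\<gamma> t) = F x" using g2x by (auto simp: x_def g1_def g2_def)
  have S: "sff_norm \<gamma> t = sqrt ((cmod n1)\<^sup>2 / A1 + (cmod n2)\<^sup>2 / A2) / Q"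
  proof -
    have "sff_norm \<gamma> t = sqrt (Re (pmetric (\<gamma> t) (n1, n2) (n1, n2))) / Re (pmetric (\<gamma> t) (v1, v2) (v1, v2))"
      unfolding sff_norm_def Let_def g1_def[symmetric] g2_def[symmetric] fs fst_conv snd_conv
        v1_def[symmetric] v2_def[symmetric] a1_def[symmetric] a2_def[symmetric] pa pq c_def[symmetric]
        n1_def[symmetric] n2_def[symmetric] ..
    then show ?thesis unfolding pn pq by simp
  qed
  have W: "a1 * v2 - a2 * v1 = - (v1 ^ 3 * D)"
    unfolding a1_def a2_def v2 ddg2 D_def tension_def v1_def[symmetric]
    by (simp add: algebra_simps power2_eq_square power3_eq_cube)
  have R: "(cmod n1)\<^sup>2 / A1 + (cmod n2)\<^sup>2 / A2 = ((cmod v1) ^ 3 * cmod D)\<^sup>2 / (A1 * A2 * Q)"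
    using normal_component[OF A Q_def Q0 c_def n1_def n2_def] unfolding W by (simp add: norm_mult norm_power)
  define K where "K = (1 - (cmod x)\<^sup>2)\<^sup>2 / (1 - (cmod (F x))\<^sup>2) * cmod D"
  have K0: "K \<ge> 0" unfolding K_def using uF by simp
  have K2: "K\<^sup>2 = A1\<^sup>2 / A2 * (cmod D)\<^sup>2" unfolding K_def A1_def A2_def by (simp add: power_mult_distrib power_divide)
  have vQ: "(cmod v1)\<^sup>2 \<le> A1 * Q"
    unfolding Q_def using A by (simp add: field_simps)
  have "((cmod v1) ^ 3 * cmod D)\<^sup>2 = ((cmod v1)\<^sup>2) ^ 3 * (cmod D)\<^sup>2"
    by (simp add: power_mult_distrib flip: power_mult)
  also have "\<dots> \<le> (A1 * Q) ^ 3 * (cmod D)\<^sup>2" using vQ by (intro mult_right_mono power_mono) auto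
  finally have "((cmod v1) ^ 3 * cmod D)\<^sup>2 / (A1 * A2 * Q) \<le> (A1 * Q) ^ 3 * (cmod D)\<^sup>2 / (A1 * A2 * Q)"
    using A Q0 by (intro divide_right_mono) auto
  also have "\<dots> = (K * Q)\<^sup>2"
    unfolding power_mult_distrib K2 using A Q0 by (simp add: field_simps power2_eq_square power3_eq_cube)
  finally have "sqrt ((cmod n1)\<^sup>2 / A1 + (cmod n2)\<^sup>2 / A2) \<le> K * Q"
    unfolding R using K0 Q0 by (intro real_le_lsqrt) auto
  then have "sff_norm \<gamma> t \<le> K" unfolding S using Q0 by (simp add: pos_divide_le_eq)
  then show "sff_norm \<gamma> t \<le> (1 - (cmod (fst (\<gamma> t)))\<^sup>2)\<^sup>2 / (1 - (cmod (F (fst (\<gamma> t))))\<^sup>2) * cmod (tension F (fst (\<gamma> t)))"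
    unfolding K_def D_def fs .
  show "tension F (fst (\<gamma> t)) = 0" if "sff_norm \<gamma> t = 0"
    using that v1 A Q0 unfolding S R fs D_def[symmetric] by simp
qed

text \<open>The second velocity component is a multiple of the first, so a nonzero velocity is never
  vertical and \<open>sff_norm_graph\<close> covers every chart.\<close>

lemma chart_of_graph:
  assumes F: "disc_map F" and ch: "curve_chart (graph F) \<gamma> r" and s: "s \<in> ball 0 r"
  shows "cmod (fst (\<gamma> s)) < 1 \<and> snd (\<gamma> s) = F (fst (\<gamma> s))"
    and "deriv (\<lambda>s. fst (\<gamma> s)) s \<noteq> 0"
proof -
  have gr: "cmod (fst (\<gamma> s)) < 1 \<and> snd (\<gamma> s) = F (fst (\<gamma> s))" if "s \<in> ball 0 r" for s
  proof -
    have "\<gamma> ` ball 0 r \<subseteq> graph F" using ch unfolding curve_chart_def by (blast dest: openin_imp_subset)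
    then have "\<gamma> s \<in> graph F" using that by blast
    then show ?thesis by (auto simp: graph_def)
  qed
  show "cmod (fst (\<gamma> s)) < 1 \<and> snd (\<gamma> s) = F (fst (\<gamma> s))" using gr[OF s] .
  have hol: "(\<lambda>s. fst (\<gamma> s)) holomorphic_on ball 0 r" using ch by (simp add: curve_chart_def)
  have "deriv (\<lambda>s. snd (\<gamma> s)) s = deriv (\<lambda>s. F (fst (\<gamma> s))) s"
    by (rule deriv_cong_ev[OF eventually_mono[OF eventually_nhds_in_open[OF open_ball s]] refl]) (simp add: gr)
  also have "\<dots> = deriv F (fst (\<gamma> s)) * deriv (\<lambda>s. fst (\<gamma> s)) s"
    by (rule DERIV_imp_deriv[OF DERIV_chain2[OF disc_map_deriv[OF F] holomorphic_derivI[OF hol open_ball s]]])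
       (use gr[OF s] in simp)
  finally have "deriv (\<lambda>s. snd (\<gamma> s)) s = deriv F (fst (\<gamma> s)) * deriv (\<lambda>s. fst (\<gamma> s)) s" .
  moreover have "(deriv (\<lambda>s. fst (\<gamma> s)) s, deriv (\<lambda>s. snd (\<gamma> s)) s) \<noteq> (0, 0)"
    using ch s by (simp add: curve_chart_def)
  ultimately show "deriv (\<lambda>s. fst (\<gamma> s)) s \<noteq> 0" by auto
qed

lemma graph_chart:
  assumes F: "disc_map F" and z0: "cmod z0 < 1"
  shows "curve_chart (graph F) (\<lambda>t. (z0 + t, F (z0 + t))) (1 - cmod z0)"
proof -
  let ?r = "1 - cmod z0" and ?\<gamma> = "\<lambda>t. (z0 + t, F (z0 + t))"
  have lt: "cmod (z0 + t) < 1" if "t \<in> ball 0 ?r" for t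
    using that norm_triangle_ineq[of z0 t] by simp
  have hol: "(\<lambda>t. F (z0 + t)) holomorphic_on ball 0 ?r"
  proof -
    have sub: "(\<lambda>t. z0 + t) ` ball 0 ?r \<subseteq> ball 0 1" using lt by (intro image_subsetI) (simp only: mem_ball_0)
    have "(\<lambda>t. z0 + t) holomorphic_on ball 0 ?r" by (intro holomorphic_intros)
    from holomorphic_on_compose_gen[OF this disc_map_holo[OF F] sub] show ?thesis by (simp only: o_def)
  qed
  have d1: "deriv (\<lambda>t. z0 + t) t = 1" for t
    by (rule DERIV_imp_deriv) (auto intro!: derivative_eq_intros)
  have im: "?\<gamma> ` ball 0 ?r = graph F \<inter> (fst -` ball z0 ?r)"
  proof
    show "?\<gamma> ` ball 0 ?r \<subseteq> graph F \<inter> (fst -` ball z0 ?r)"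
      using lt by (auto simp: graph_def dist_norm)
    show "graph F \<inter> (fst -` ball z0 ?r) \<subseteq> ?\<gamma> ` ball 0 ?r"
    proof
      fix p assume "p \<in> graph F \<inter> (fst -` ball z0 ?r)"
      then obtain z where z: "p = (z, F z)" "cmod (z0 - z) < ?r" by (auto simp: graph_def dist_norm)
      then show "p \<in> ?\<gamma> ` ball 0 ?r" by (intro image_eqI[of _ _ "z - z0"]) (auto simp: norm_minus_commute)
    qed
  qed
  have op: "openin (top_of_set (graph F)) (?\<gamma> ` ball 0 ?r)"
    unfolding im by (intro openin_open_Int open_vimage) (auto intro!: continuous_intros)
  have homeo: "homeomorphism (ball 0 ?r) (?\<gamma> ` ball 0 ?r) ?\<gamma> (\<lambda>p. fst p - z0)"
    unfolding homeomorphism_def using holomorphic_on_imp_continuous_on[OF hol]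
    by (auto intro!: continuous_intros simp: image_image)
  show ?thesis unfolding curve_chart_def
    using z0 hol d1 op homeo by (auto intro!: holomorphic_intros)
qed

lemma graph_complex_curve:
  assumes F: "disc_map F" shows "complex_curve (graph F)"
  unfolding complex_curve_def
proof (intro conjI ballI)
  show "graph F \<subseteq> bidisc" using disc_map_norm[OF F] by (auto simp: graph_def bidisc_def)
  have c: "continuous_on bidisc (\<lambda>p. snd p - F (fst p))"
  proof (intro continuous_on_diff continuous_on_snd continuous_on_id)
    have "continuous_on (fst ` bidisc) F"
      using holomorphic_on_imp_continuous_on[OF disc_map_holo[OF F]]
      by (rule continuous_on_subset) (auto simp: bidisc_def)
    then show "continuous_on bidisc (\<lambda>p. F (fst p))"
      by (rule continuous_on_compose2[OF _ continuous_on_fst[OF continuous_on_id] order.refl])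
  qed
  have "graph F = bidisc \<inter> (\<lambda>p. snd p - F (fst p)) -` {0}"
    using disc_map_norm[OF F] by (auto simp: graph_def bidisc_def)
  then show "closedin (top_of_set bidisc) (graph F)"
    using continuous_closedin_preimage[OF c closed_singleton[of 0]] by simp
  fix p assume "p \<in> graph F"
  then obtain z where z: "p = (z, F z)" "cmod z < 1" by (auto simp: graph_def)
  show "\<exists>\<gamma> r. curve_chart (graph F) \<gamma> r \<and> \<gamma> 0 = p"
    using graph_chart[OF F z(2)] z(1) by (intro exI[of _ "\<lambda>t. (z + t, F (z + t))"] exI[of _ "1 - cmod z"]) auto
qed

lemma graph_eps_geodesic:
  assumes F: "disc_map F" and r: "0 < r" "r < 1"
    and sm: "\<And>z u. cmod z < 1 \<Longrightarrow> cmod u \<le> r \<Longrightarrow> cmod (recenter F z u) \<le> B" and B: "2 * B / r\<^sup>2 \<le> \<epsilon>"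
  shows "eps_geodesic \<epsilon> (graph F)"
  unfolding eps_geodesic_def
proof (intro allI impI)
  fix \<gamma> :: "complex \<Rightarrow> complex \<times> complex" and s :: real and t :: complex
  assume "curve_chart (graph F) \<gamma> s \<and> t \<in> ball 0 s"
  then have ch: "curve_chart (graph F) \<gamma> s" and t: "t \<in> ball 0 s" by auto
  have hol: "(\<lambda>s. fst (\<gamma> s)) holomorphic_on ball 0 s" using ch by (simp add: curve_chart_def)
  have x: "cmod (fst (\<gamma> t)) < 1" using chart_of_graph(1)[OF F ch t] by simp
  have "sff_norm \<gamma> t \<le> 2 * B / r\<^sup>2"
    using sff_norm_graph(1)[OF F hol t chart_of_graph(1)[OF F ch] chart_of_graph(2)[OF F ch t]]
      tension_small[OF F x r sm[OF x]] by linarith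
  then show "sff_norm \<gamma> t \<le> \<epsilon>" using B by linarith
qed

lemma graph_not_totally_geodesic:
  assumes F: "disc_map F" and z: "cmod z < 1" "tension F z \<noteq> 0"
  shows "\<not> totally_geodesic (graph F)"
proof
  assume tg: "totally_geodesic (graph F)"
  note ch = graph_chart[OF F z(1)]
  let ?\<gamma> = "\<lambda>t. (z + t, F (z + t))"
  have t: "0 \<in> ball (0::complex) (1 - cmod z)" using z by simp
  have "sff_norm ?\<gamma> 0 = 0" using tg ch t unfolding totally_geodesic_def by blast
  moreover have "(\<lambda>s. fst (?\<gamma> s)) holomorphic_on ball 0 (1 - cmod z)" by (auto intro!: holomorphic_intros)
  ultimately have "tension F (fst (?\<gamma> 0)) = 0"
    using sff_norm_graph(2)[OF F _ t chart_of_graph(1)[OF F ch] chart_of_graph(2)[OF F ch t]] by blast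
  then show False using z(2) by simp
qed

section \<open>Product automorphisms and closeness to the model disc\<close>

definition prod_aut :: "complex \<times> complex \<Rightarrow> complex \<times> complex \<Rightarrow> complex \<times> complex \<Rightarrow> complex \<times> complex" where
  "prod_aut p q x = (mob p (fst x), mob q (snd x))"

lemma prod_aut_bidisc: "p \<in> su11 \<Longrightarrow> q \<in> su11 \<Longrightarrow> x \<in> bidisc \<Longrightarrow> prod_aut p q x \<in> bidisc"
  using mob_in_disc[of p] mob_in_disc[of q] by (auto simp: prod_aut_def bidisc_def)

lemma prod_aut_holo2:
  assumes "p \<in> su11" "q \<in> su11" shows "holo2 (prod_aut p q) bidisc"
  unfolding holo2_def
proof
  fix x assume x: "x \<in> bidisc"
  obtain d1 where d1: "(mob p has_field_derivative d1) (at (fst x))"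
    using mob_has_derivative[OF assms(1), of "fst x"] x by (auto simp: bidisc_def split_beta)
  obtain d2 where d2: "(mob q has_field_derivative d2) (at (snd x))"
    using mob_has_derivative[OF assms(2), of "snd x"] x by (auto simp: bidisc_def split_beta)
  have f: "(fst has_derivative fst) (at x)" "(snd has_derivative snd) (at x)"
    by (auto intro!: derivative_eq_intros)
  have "((\<lambda>x. (mob p (fst x), mob q (snd x))) has_derivative (\<lambda>v. (d1 * fst v, d2 * snd v))) (at x)"
    by (intro has_derivative_Pair
        has_derivative_compose[OF f(1) d1[unfolded has_field_derivative_def]]
        has_derivative_compose[OF f(2) d2[unfolded has_field_derivative_def]])
  then have "(prod_aut p q has_derivative (\<lambda>v. (d1 * fst v, d2 * snd v))) (at x)"
    by (simp add: prod_aut_def[abs_def])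
  then show "\<exists>D. (prod_aut p q has_derivative D) (at x) \<and> (\<forall>v. D (cscale \<i> v) = cscale \<i> (D v))"
    by (intro exI[of _ "\<lambda>v. (d1 * fst v, d2 * snd v)"]) (auto simp: cscale_def)
qed

lemma prod_aut_compose:
  assumes "p \<in> su11" "q \<in> su11" "p' \<in> su11" "q' \<in> su11" "x \<in> bidisc"
  shows "prod_aut (mmul p p') (mmul q q') x = prod_aut p q (prod_aut p' q' x)"
  using assms by (auto simp: prod_aut_def bidisc_def mob_mmul)

lemma prod_aut_inverse:
  assumes "p \<in> su11" "q \<in> su11" "x \<in> bidisc"
  shows "prod_aut (minv p) (minv q) (prod_aut p q x) = x" "prod_aut p q (prod_aut (minv p) (minv q) x) = x"
  using assms by (auto simp: prod_aut_def bidisc_def mob_minv)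

lemma prod_aut_is_aut:
  assumes "p \<in> su11" "q \<in> su11" shows "bidisc_aut (prod_aut p q)"
  unfolding bidisc_aut_def
proof (intro conjI)
  show "holo2 (prod_aut p q) bidisc" by (rule prod_aut_holo2[OF assms])
  note i = minv_su11[OF assms(1)] minv_su11[OF assms(2)]
  show "bij_betw (prod_aut p q) bidisc bidisc"
    by (rule bij_betw_byWitness[where f' = "prod_aut (minv p) (minv q)"])
       (use prod_aut_inverse[OF assms] prod_aut_bidisc[OF assms] prod_aut_bidisc[OF i] in auto)
  show "\<exists>g. holo2 g bidisc \<and> (\<forall>x\<in>bidisc. g (prod_aut p q x) = x \<and> prod_aut p q (g x) = x)"
    using prod_aut_holo2[OF i] prod_aut_inverse[OF assms] by blast
qed

lemma prod_aut_graph_recenter: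
  assumes F: "disc_map F" and z: "cmod z < 1"
  shows "prod_aut (mshift (- z)) (mshift (- F z)) ` graph F = graph (recenter F z)"
proof
  show "prod_aut (mshift (- z)) (mshift (- F z)) ` graph F \<subseteq> graph (recenter F z)"
  proof (rule image_subsetI)
    fix p assume "p \<in> graph F"
    then obtain w where w: "p = (w, F w)" "cmod w < 1" by (auto simp: graph_def)
    have "cmod (mob (mshift (- z)) w) < 1" using mob_in_disc[OF mshift_su11] z w by simp
    then show "prod_aut (mshift (- z)) (mshift (- F z)) p \<in> graph (recenter F z)"
      using mob_mshift_cancel(1)[OF z w(2)] unfolding w(1) graph_def prod_aut_def recenter_def by auto
  qed
  show "graph (recenter F z) \<subseteq> prod_aut (mshift (- z)) (mshift (- F z)) ` graph F"
  proof
    fix p assume "p \<in> graph (recenter F z)"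
    then obtain u where u: "p = (u, recenter F z u)" "cmod u < 1" by (auto simp: graph_def)
    let ?w = "mob (mshift z) u"
    have "cmod ?w < 1" using mob_in_disc[OF mshift_su11[OF z]] u by simp
    then have "(?w, F ?w) \<in> graph F" by (auto simp: graph_def)
    moreover have "p = prod_aut (mshift (- z)) (mshift (- F z)) (?w, F ?w)"
      using mob_mshift_cancel(2)[OF z u(2)] by (simp add: u(1) prod_aut_def recenter_def)
    ultimately show "p \<in> prod_aut (mshift (- z)) (mshift (- F z)) ` graph F" by (rule image_eqI[rotated])
  qed
qed

lemma artanh_scale_le:
  fixes s x :: real assumes s: "0 \<le> s" "s \<le> 1" and x: "0 \<le> x" "x < 1"
  shows "artanh (s * x) \<le> s * artanh x"
proof -
  have "convex_on {0..<1} (artanh :: real \<Rightarrow> real)"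
  proof (rule f''_ge0_imp_convex)
    show "convex {0..<1::real}" by simp
    show "DERIV artanh x :> 1 / (1 - x\<^sup>2)" if "x \<in> {0..<1}" for x :: real
      using that by (auto intro!: derivative_eq_intros)
    show "DERIV (\<lambda>x. 1 / (1 - x\<^sup>2)) x :> 2 * x / (1 - x\<^sup>2)\<^sup>2" if "x \<in> {0..<1}" for x :: real
    proof -
      have "x\<^sup>2 < 1" using that by (simp add: power_less_one_iff)
      then show ?thesis by (auto intro!: derivative_eq_intros simp: power2_eq_square)
    qed
    show "0 \<le> 2 * x / (1 - x\<^sup>2)\<^sup>2" if "x \<in> {0..<1}" for x :: real using that by simp
  qed
  from convex_onD[OF this, of s 0 x] s x show ?thesis by simp
qed

text \<open>The chord of the convex function up to \<open>1/2\<close>, where its value is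
  \<open>ln 3 / 2 \<le> 1\<close>.\<close>

lemma artanh_le_double: "0 \<le> b \<Longrightarrow> b \<le> 1/2 \<Longrightarrow> artanh b \<le> 2 * (b::real)"
proof -
  assume b: "0 \<le> b" "b \<le> 1/2"
  have "ln 3 \<le> (2::real)" using ln_le_minus_one[of 3] by simp
  then have h: "artanh (1/2::real) \<le> 1" by (simp add: artanh_def)
  have "artanh b = artanh (2 * b * (1/2))" by simp
  also have "\<dots> \<le> 2 * b * artanh (1/2)" by (rule artanh_scale_le) (use b in auto)
  also have "\<dots> \<le> 2 * b * 1" using b h by (intro mult_left_mono) auto
  finally show ?thesis by simp
qed

text \<open>In effect \<open>tanh 1 < 4/5\<close>, from \<open>exp 1 \<le> 3\<close>; hence the
  radius \<open>4/5\<close> in the estimates on recentred maps.\<close>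

lemma artanh_less_one:
  fixes x :: real assumes "0 \<le> x" "x < 1" "artanh x < 1" shows "x < 4/5"
proof -
  have pos: "(1 + x) / (1 - x) > 0" using assms by simp
  have "ln ((1 + x) / (1 - x)) < 2" using assms(3) by (simp add: artanh_def)
  then have "(1 + x) / (1 - x) < exp 2" using pos by (metis exp_less_mono exp_ln)
  also have "exp 2 = (exp 1)\<^sup>2" by (simp flip: exp_double)
  also have "(exp 1)\<^sup>2 \<le> (3::real)\<^sup>2" using exp_le by (intro power_mono) auto
  finally show ?thesis using assms by (simp add: field_simps)
qed

lemma artanh_nonneg: "0 \<le> x \<Longrightarrow> x < 1 \<Longrightarrow> 0 \<le> artanh (x::real)"
  by (simp add: artanh_def)

lemma geo_ball_fst:
  assumes "(z, w) \<in> geo_ball" shows "cmod z < 1" "artanh (cmod z) < 1" "cmod z < 4/5"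
proof -
  show z: "cmod z < 1" using assms by (simp add: geo_ball_def)
  have "(artanh (cmod z))\<^sup>2 + (artanh (cmod w))\<^sup>2 < 1" using assms by (simp add: geo_ball_def)
  then have "(artanh (cmod z))\<^sup>2 < 1" using zero_le_power2[of "artanh (cmod w)"] by linarith
  then have "(artanh (cmod z))\<^sup>2 < 1\<^sup>2" by simp
  then show a: "artanh (cmod z) < 1" by (rule power2_less_imp_less) simp
  show "cmod z < 4/5" by (rule artanh_less_one[OF _ z a]) simp
qed

text \<open>Points of the graph project vertically to the disc. Conversely, a point of the disc is
  first shrunk by \<open>1 - \<kappa>\<close>, since raising it to the graph could leave the
  geodesic ball. A height of at most \<open>\<kappa> / 4\<close> costs at most
  \<open>\<kappa> / 2\<close> in \<open>artanh\<close>, and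
  \<open>(1 - \<kappa>)^2 + (\<kappa> / 2)^2 < 1\<close>.\<close>

lemma graph_modeled:
  assumes F: "disc_map F" and \<kappa>: "0 < \<kappa>" "\<kappa> \<le> 1/2" "\<kappa> \<le> \<delta> / 2"
    and sm: "\<And>z u. cmod z < 1 \<Longrightarrow> cmod u \<le> 4/5 \<Longrightarrow> cmod (recenter F z u) \<le> \<kappa> / 4"
  shows "modeled_on_disc \<delta> (graph F)"
  unfolding modeled_on_disc_def
proof
  fix p assume "p \<in> graph F"
  then obtain z where p: "p = (z, F z)" and z: "cmod z < 1" by (auto simp: graph_def)
  let ?\<phi> = "prod_aut (mshift (- z)) (mshift (- F z))" and ?N = "recenter F z"
  have Fz: "cmod (F z) < 1" using disc_map_norm[OF F z] .
  have "bidisc_aut ?\<phi>" using z Fz by (intro prod_aut_is_aut mshift_su11) auto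
  moreover have "?\<phi> p = (0, 0)" using z Fz by (simp add: p prod_aut_def)
  moreover have "hclose \<delta> (graph ?N \<inter> geo_ball) (model_disc \<inter> geo_ball)"
    unfolding hclose_def
  proof (intro conjI ballI)
    fix a assume a: "a \<in> graph ?N \<inter> geo_ball"
    then obtain u where u: "a = (u, ?N u)" "cmod u < 1" by (auto simp: graph_def)
    note gb = geo_ball_fst[of u "?N u"]
    have u45: "cmod u < 4/5" and au: "artanh (cmod u) < 1" using gb a u(1) by auto
    have "(artanh (cmod u))\<^sup>2 < 1"
      using au artanh_nonneg[OF _ u(2)] by (simp add: power_less_one_iff)
    then have "(u, 0) \<in> model_disc \<inter> geo_ball" using u(2) by (auto simp: model_disc_def geo_ball_def)
    moreover have "dist a (u, 0) \<le> \<delta>"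
      using sm[OF z, of u] u45 \<kappa> by (simp add: u(1) dist_prod_def)
    ultimately show "\<exists>b\<in>model_disc \<inter> geo_ball. dist a b \<le> \<delta>" by blast
  next
    fix b assume b: "b \<in> model_disc \<inter> geo_ball"
    then obtain x where x: "b = (x, 0)" by (auto simp: model_disc_def)
    note gb = geo_ball_fst[of x 0]
    have x1: "cmod x < 1" and ax: "artanh (cmod x) < 1" and x45: "cmod x < 4/5" using gb b x by auto
    define s where "s = 1 - \<kappa>"
    have s: "0 \<le> s" "s \<le> 1" "s > 0" using \<kappa> by (auto simp: s_def)
    define y where "y = complex_of_real s * x"
    have ny: "cmod y = s * cmod x" using s by (simp add: y_def norm_mult)
    have "s * cmod x \<le> 1 * cmod x" using s by (intro mult_right_mono) auto
    then have y1: "cmod y < 1" "cmod y \<le> 4/5" using ny x1 x45 by auto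
    have Ny: "cmod (?N y) \<le> \<kappa> / 4" using sm[OF z y1(2)] .
    have "artanh (cmod y) \<le> s * artanh (cmod x)" unfolding ny by (rule artanh_scale_le) (use s x1 in auto)
    also have "\<dots> \<le> s * 1" using s ax by (intro mult_left_mono) auto
    finally have "artanh (cmod y) \<le> s" by simp
    then have sq1: "(artanh (cmod y))\<^sup>2 \<le> s\<^sup>2" using artanh_nonneg[OF _ y1(1)] by (intro power_mono) auto
    have "artanh (cmod (?N y)) \<le> 2 * cmod (?N y)" using Ny \<kappa> by (intro artanh_le_double) auto
    then have "artanh (cmod (?N y)) \<le> \<kappa> / 2" using Ny by simp
    moreover have "0 \<le> artanh (cmod (?N y))" using Ny \<kappa> by (intro artanh_nonneg) auto
    ultimately have sq2: "(artanh (cmod (?N y)))\<^sup>2 \<le> (\<kappa> / 2)\<^sup>2" by (intro power_mono) auto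
    have "\<kappa> * \<kappa> \<le> \<kappa> * (1/2)" using \<kappa> by (intro mult_left_mono) auto
    then have "s\<^sup>2 + (\<kappa> / 2)\<^sup>2 < 1" using \<kappa> unfolding s_def by (simp add: power2_eq_square algebra_simps)
    then have "(artanh (cmod y))\<^sup>2 + (artanh (cmod (?N y)))\<^sup>2 < 1" using sq1 sq2 by linarith
    moreover have "cmod (?N y) < 1" using Ny \<kappa> by simp
    ultimately have "(y, ?N y) \<in> graph ?N \<inter> geo_ball" using y1 by (auto simp: graph_def geo_ball_def)
    moreover have "dist (y, ?N y) b \<le> \<delta>"
    proof -
      have "y - x = - (complex_of_real \<kappa> * x)" by (simp add: y_def s_def algebra_simps)
      then have "cmod (y - x) = \<kappa> * cmod x" using \<kappa> by (simp add: norm_mult)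
      also have "\<dots> \<le> \<kappa> * 1" using \<kappa> x1 by (intro mult_left_mono) auto
      finally have "dist y x \<le> \<kappa>" by (simp add: dist_norm)
      moreover have "dist (?N y) 0 \<le> \<kappa>" using Ny \<kappa> by simp
      moreover have "dist (y, ?N y) b \<le> dist y x + dist (?N y) 0"
        unfolding x dist_Pair_Pair by (rule sqrt_sum_squares_le_sum) auto
      ultimately show ?thesis using \<kappa> by linarith
    qed
    ultimately show "\<exists>a\<in>graph ?N \<inter> geo_ball. dist a b \<le> \<delta>" by blast
  qed
  ultimately show "\<exists>\<phi>. bidisc_aut \<phi> \<and> \<phi> p = (0, 0) \<and> hclose \<delta> (\<phi> ` graph F \<inter> geo_ball) (model_disc \<inter> geo_ball)"
    using prod_aut_graph_recenter[OF F z] by (intro exI[of _ ?\<phi>]) auto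
qed

section \<open>Elements of finite order have fixed points\<close>

lemma elliptic_fixed_point:
  assumes p: "p \<in> su11" and tr: "\<bar>Re (fst p)\<bar> < 1"
  shows "\<exists>z. cmod z < 1 \<and> mob p z = z"
proof (cases "snd p = 0")
  case True
  then show ?thesis by (intro exI[of _ 0]) (simp add: mob_def)
next
  case False
  define b y where "b = cmod (snd p)" and "y = Im (fst p)"
  have b: "b > 0" using False by (simp add: b_def)
  have xsq: "(Re (fst p))\<^sup>2 < 1" using tr by (simp add: abs_square_less_1)
  have "(Re (fst p))\<^sup>2 + y\<^sup>2 - b\<^sup>2 = 1" using p by (simp add: su11_def cmod_power2 y_def b_def)
  then have yb: "y\<^sup>2 - b\<^sup>2 > 0" using xsq by linarith
  define r where "r = sqrt (y\<^sup>2 - b\<^sup>2)"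
  have r: "r > 0" "r\<^sup>2 = y\<^sup>2 - b\<^sup>2" using yb by (auto simp: r_def)
  \<comment> \<open>With \<open>z = \<i> * \<rho> / cnj (snd p)\<close> the fixed point equation
    becomes \<open>\<rho>^2 - 2 * y * \<rho> + b^2 = 0\<close>. The roots have product
    \<open>b^2\<close>, and the one of smaller modulus gives \<open>|z| < 1\<close>.\<close>
  define \<rho> where "\<rho> = y - sgn y * r"
  have y0: "y \<noteq> 0" using yb b by auto
  then have sg: "sgn y * sgn y = 1" by (simp add: sgn_if)
  have quad: "2 * y * \<rho> - \<rho>\<^sup>2 - b\<^sup>2 = 0"
  proof -
    have "2 * y * \<rho> - \<rho>\<^sup>2 - b\<^sup>2 = y\<^sup>2 - (sgn y * sgn y) * r\<^sup>2 - b\<^sup>2"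
      unfolding \<rho>_def by (simp add: power2_eq_square algebra_simps)
    then show ?thesis using r sg by simp
  qed
  have "\<bar>y\<bar> > b" using yb b power2_less_imp_less[of b "\<bar>y\<bar>"] by simp
  have "\<bar>\<rho>\<bar> < b"
  proof -
    have "\<rho> = sgn y * (\<bar>y\<bar> - r)" unfolding \<rho>_def by (simp add: right_diff_distrib sgn_mult_abs)
    then have e: "\<bar>\<rho>\<bar> = \<bar>\<bar>y\<bar> - r\<bar>" using y0 by (simp add: abs_mult)
    have "r\<^sup>2 \<le> \<bar>y\<bar>\<^sup>2" using r b by simp
    then have "r \<le> \<bar>y\<bar>" by (rule power2_le_imp_le) simp
    moreover have "(\<bar>y\<bar> - b)\<^sup>2 < r\<^sup>2"
    proof -
      have "(\<bar>y\<bar> - b) * b < \<bar>y\<bar> * b" using b by simp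
      then show ?thesis unfolding r(2) using \<open>\<bar>y\<bar> > b\<close> b by (simp add: power2_eq_square algebra_simps)
    qed
    then have "\<bar>y\<bar> - b < r" using r(1) by (metis less_imp_le power2_less_imp_less)
    ultimately show ?thesis using e by linarith
  qed
  define z where "z = \<i> * of_real \<rho> / cnj (snd p)"
  have cz: "cnj (snd p) * z = \<i> * of_real \<rho>" using False by (simp add: z_def)
  have z: "cmod z < 1" using \<open>\<bar>\<rho>\<bar> < b\<close> b by (simp add: z_def norm_divide norm_mult b_def)
  have "cnj (snd p) * ((cnj (snd p) * z + cnj (fst p)) * z - (fst p * z + snd p)) =
     (cnj (snd p) * z) * (cnj (snd p) * z) + (cnj (fst p) - fst p) * (cnj (snd p) * z) - cnj (snd p) * snd p"
    by (simp add: algebra_simps)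
  also have "\<dots> = - of_real (\<rho>\<^sup>2) - (2 * \<i> * of_real y) * (\<i> * of_real \<rho>) - of_real (b\<^sup>2)"
  proof -
    have "cnj (fst p) - fst p = - (2 * \<i> * of_real y)" by (simp add: complex_eq_iff y_def)
    moreover have "cnj (snd p) * snd p = of_real (b\<^sup>2)" unfolding b_def complex_norm_square by simp
    moreover have "\<i> * complex_of_real \<rho> * (\<i> * of_real \<rho>) = - of_real (\<rho>\<^sup>2)"
      by (simp add: power2_eq_square complex_eq_iff)
    ultimately show ?thesis unfolding cz by simp
  qed
  also have "\<dots> = of_real (2 * y * \<rho> - \<rho>\<^sup>2 - b\<^sup>2)" by (simp add: complex_eq_iff power2_eq_square)
  finally have "(cnj (snd p) * z + cnj (fst p)) * z = fst p * z + snd p" using False unfolding quad by simp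
  then have "mob p z = z" unfolding mob_def using mob_denom_nz[OF p z] by (simp add: field_simps)
  then show ?thesis using z by blast
qed

primrec mpow :: "complex \<times> complex \<Rightarrow> nat \<Rightarrow> complex \<times> complex" where
  "mpow p 0 = (1, 0)"
| "mpow p (Suc n) = mmul p (mpow p n)"

text \<open>\<open>cheb x n\<close> is the pair of Chebyshev polynomials \<open>(U\<^sub>n\<^sub>-\<^sub>2 x, U\<^sub>n\<^sub>-\<^sub>1 x)\<close> of the second kind,
  which give the powers of a matrix of trace \<open>2 x\<close> and determinant \<open>1\<close>.\<close>

primrec cheb :: "real \<Rightarrow> nat \<Rightarrow> real \<times> real" where
  "cheb x 0 = (-1, 0)"
| "cheb x (Suc n) = (snd (cheb x n), 2 * x * snd (cheb x n) - fst (cheb x n))"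

lemma mpow_su11: "p \<in> su11 \<Longrightarrow> mpow p n \<in> su11"
  by (induction n) (auto intro: one_su11 mmul_su11)

lemma mob_mpow: "p \<in> su11 \<Longrightarrow> cmod z < 1 \<Longrightarrow> mob (mpow p n) z = (mob p ^^ n) z"
  by (induction n) (auto simp: mob_mmul mpow_su11)

text \<open>Cayley-Hamilton: the square of the matrix is its trace times itself minus the identity,
  which is the recursion of \<open>cheb\<close>.\<close>

lemma mpow_cheb:
  assumes p: "p \<in> su11"
  shows "mpow p n = (of_real (snd (cheb (Re (fst p)) n)) * fst p - of_real (fst (cheb (Re (fst p)) n)),
                     of_real (snd (cheb (Re (fst p)) n)) * snd p)"
proof (induction n)
  case (Suc n)
  define u v where "u = complex_of_real (fst (cheb (Re (fst p)) n))" and "v = complex_of_real (snd (cheb (Re (fst p)) n))"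
  have IH: "mpow p n = (v * fst p - u, v * snd p)" using Suc by (simp add: u_def v_def)
  have cv: "cnj v = v" "cnj u = u" by (auto simp: u_def v_def)
  have tr: "complex_of_real (2 * Re (fst p)) = fst p + cnj (fst p)" by (simp add: complex_add_cnj)
  have su: "snd p * cnj (snd p) = fst p * cnj (fst p) - 1" using p su11_iff[of p] by (simp add: algebra_simps)
  have "mpow p (Suc n) = (v * (fst p * fst p) - u * fst p + v * (snd p * cnj (snd p)),
      v * (fst p + cnj (fst p)) * snd p - u * snd p)"
    by (simp add: IH mmul_def cv algebra_simps)
  also have "\<dots> = (((fst p + cnj (fst p)) * v - u) * fst p - v, ((fst p + cnj (fst p)) * v - u) * snd p)"
    unfolding su by (simp add: algebra_simps)
  finally show ?case unfolding tr[symmetric] by (simp add: u_def v_def)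
qed simp

text \<open>For consecutive values the recursion gives \<open>|w| \<ge> 2 * |v| - |u|\<close>, so
  the increments never fall below the initial 1.\<close>

lemma cheb_growth:
  assumes "1 \<le> \<bar>x\<bar>" shows "\<bar>snd (cheb x (Suc n))\<bar> \<ge> \<bar>snd (cheb x n)\<bar> + 1"
proof (induction n)
  case (Suc n)
  define u v w where "u = snd (cheb x n)" and "v = snd (cheb x (Suc n))" and "w = snd (cheb x (Suc (Suc n)))"
  have w: "w = 2 * x * v - u" by (simp add: u_def v_def w_def)
  have "2 * \<bar>v\<bar> \<le> \<bar>2 * x * v\<bar>" using assms mult_right_mono[of 1 "\<bar>x\<bar>" "\<bar>v\<bar>"] by (simp add: abs_mult)
  also have "\<dots> \<le> \<bar>w\<bar> + \<bar>u\<bar>" unfolding w by linarith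
  finally have "\<bar>w\<bar> \<ge> \<bar>v\<bar> + 1" using Suc unfolding u_def[symmetric] v_def[symmetric] by linarith
  then show ?case unfolding v_def w_def .
qed simp

text \<open>In the non-elliptic case the off-diagonal entry of the \<open>n\<close>-th power is a
  nonzero Chebyshev value times \<open>snd p\<close>. A power fixing 0 has off-diagonal entry 0, so
  \<open>snd p = 0\<close> and \<open>p\<close> itself fixes 0.\<close>

lemma finite_order_fixed_point:
  assumes p: "p \<in> su11" and n: "n > 0" and fin: "(mob p ^^ n) 0 = 0"
  shows "\<exists>z. cmod z < 1 \<and> mob p z = z"
proof (cases "\<bar>Re (fst p)\<bar> < 1")
  case True
  then show ?thesis by (rule elliptic_fixed_point[OF p])
next
  case False
  then have x: "1 \<le> \<bar>Re (fst p)\<bar>" by simp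
  have "mob (mpow p n) 0 = 0" using mob_mpow[OF p, of 0] fin by simp
  then have "snd (mpow p n) = 0"
    using mob_denom_nz[OF mpow_su11[OF p], of 0 n] by (simp add: mob_def)
  then have "snd (cheb (Re (fst p)) n) = 0 \<or> snd p = 0" unfolding mpow_cheb[OF p] by simp
  moreover obtain m where m: "n = Suc m" using n by (cases n) auto
  have "snd (cheb (Re (fst p)) n) \<noteq> 0" using cheb_growth[OF x, of m] unfolding m by linarith
  ultimately have "snd p = 0" by simp
  then show ?thesis by (intro exI[of _ 0]) (simp add: mob_def)
qed

section \<open>The sign character and its kernel\<close>

lemma has_sqrt_prod:
  "finite S \<Longrightarrow> (\<And>a. a \<in> S \<Longrightarrow> has_sqrt (f a)) \<Longrightarrow> has_sqrt (\<lambda>z. \<Prod>a\<in>S. f a z)"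
proof (induction S rule: finite_induct)
  case empty
  have "has_sqrt (\<lambda>z. 1)" by (rule has_sqrt_nonvanishing) auto
  then show ?case by simp
next
  case (insert x S)
  then have "has_sqrt (\<lambda>z. f x z * (\<Prod>a\<in>S. f a z))" by (intro has_sqrt_mult) auto
  then show ?case using insert by simp
qed

lemma even_card_sym_diff:
  assumes "finite S" "finite T"
  shows "even (card ((S - T) \<union> (T - S))) \<longleftrightarrow> (even (card S) \<longleftrightarrow> even (card T))"
proof -
  have "card S = card (S - T) + card (S \<inter> T)" "card T = card (T - S) + card (S \<inter> T)"
    using assms card_Int_Diff by (metis add.commute, metis Int_commute add.commute)
  moreover have "card ((S - T) \<union> (T - S)) = card (S - T) + card (T - S)"
    by (rule card_Un_disjoint) (use assms in auto)
  ultimately show ?thesis by presburger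
qed

lemma fixing_identity:
  assumes p: "p \<in> su11" and z: "cmod z < 1" "mob p z = z" "deriv (mob p) z = 1" and u: "cmod u < 1"
  shows "mob p u = u"
proof -
  have zs: "mshift z \<in> su11" "mshift (- z) \<in> su11" using z mshift_su11[of z] mshift_su11[of "- z"] by auto
  note dm = disc_map_mob[OF zs(1)] disc_map_mob[OF zs(2)] disc_map_mob[OF p]
  define k where "k = (\<lambda>v. mob (mshift (- z)) (mob p (mob (mshift z) v)))"
  have kd: "disc_map k" unfolding k_def by (intro disc_map_compose[OF dm(2)] disc_map_compose[OF dm(3)] dm(1))
  have k0: "k 0 = 0" using z by (simp add: k_def)
  have "deriv k 0 = deriv (mob (mshift (- z))) z * (deriv (mob p) z * deriv (mob (mshift z)) 0)"
    unfolding k_def using disc_map_chain[OF dm(2) disc_map_compose[OF dm(3) dm(1)], of 0] disc_map_chain[OF dm(3) dm(1), of 0] z by simp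
  also have "\<dots> = deriv (\<lambda>v. mob (mshift (- z)) (mob (mshift z) v)) 0"
    using disc_map_chain[OF dm(2) dm(1), of 0] z by simp
  also have "\<dots> = deriv (\<lambda>v. v) 0" by (rule deriv_cong_disc) (use mob_mshift_cancel(2)[OF z(1)] in auto)
  finally have k1: "deriv k 0 = 1" by simp
  let ?v = "mob (mshift (- z)) u"
  have v: "cmod ?v < 1" using mob_in_disc[OF zs(2) u] .
  have "k ?v = ?v" by (rule schwarz_identity[OF kd k0 k1 v])
  then have "mob (mshift (- z)) (mob p u) = ?v" unfolding k_def mob_mshift_cancel(1)[OF z(1) u] .
  then show ?thesis using mob_inj[OF zs(2) mob_in_disc[OF p u] u] by simp
qed

lemma compact_in_cball:
  assumes "compact K" "K \<subseteq> ball (0::complex) 1"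
  shows "\<exists>r. 0 \<le> r \<and> r < 1 \<and> K \<subseteq> cball 0 r"
proof (cases "K = {}")
  case False
  have "compact (cmod ` K)" using assms(1) by (intro compact_continuous_image continuous_intros)
  then obtain x where "x \<in> K" "\<And>y. y \<in> K \<Longrightarrow> cmod y \<le> cmod x"
    using compact_attains_sup[of "cmod ` K"] False by auto
  then show ?thesis using assms(2) by (intro exI[of _ "cmod x"]) auto
qed (auto intro: exI[of _ 0])

text \<open>Inequivalence of the points of \<open>A0\<close> and the free action of
  \<open>Lam\<close> make each point of \<open>A\<close> equal to \<open>mob q a\<close> for exactly
  one pair \<open>(q, a)\<close>.\<close>

locale equivariant_cover = ramified_cover A F for A F +
  fixes A0 :: "complex set"
  assumes finA0: "finite A0" and evenA0: "even (card A0)" and A0_disc: "A0 \<subseteq> ball 0 1"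
    and A_eq: "A = (\<Union>q\<in>Lam. mob q ` A0)"
    and ineq: "\<And>a a' q. a \<in> A0 \<Longrightarrow> a' \<in> A0 \<Longrightarrow> q \<in> Lam \<Longrightarrow> mob q a = a' \<Longrightarrow> a = a'"
begin

lemma Lsu: "q \<in> Lam \<Longrightarrow> q \<in> su11" using Lam_su11 by blast

lemma mob_A:
  assumes q: "q \<in> Lam" shows "mob q ` A = A"
proof -
  have sub: "mob q ` A \<subseteq> A" if q: "q \<in> Lam" for q
  proof (rule image_subsetI)
    fix x assume "x \<in> A"
    then obtain l a where l: "l \<in> Lam" "a \<in> A0" "x = mob l a" using A_eq by auto
    then have "mob q x = mob (mmul q l) a" using mob_mmul[OF Lsu[OF q] Lsu[OF l(1)]] A0_disc by auto
    then show "mob q x \<in> A" using A_eq Lam_mmul[OF q l(1)] l(2) by auto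
  qed
  have "A \<subseteq> mob q ` A"
  proof
    fix x assume x: "x \<in> A"
    then have "x = mob q (mob (minv q) x)" using mob_minv(2)[OF Lsu[OF q]] A_disc by auto
    moreover have "mob (minv q) x \<in> A" using sub[OF Lam_minv[OF q]] x by auto
    ultimately show "x \<in> mob q ` A" by blast
  qed
  with sub[OF q] show ?thesis by (rule subset_antisym)
qed

lemma A0_subset: "A0 \<subseteq> A"
  unfolding A_eq using Lam_one by (auto intro!: bexI[of _ "(1,0)"])

text \<open>\<open>rt\<close> is a square root of \<open>P\<close> near the unit circle; it exists since \<open>A0\<close> has even cardinality.\<close>

definition P where "P x = (\<Prod>a\<in>A0. x - a)"
definition R where "R = Max (insert 0 (cmod ` A0))"
definition rt where "rt x = x ^ (card A0 div 2) * (\<Prod>a\<in>A0. csqrt (1 - a / x))"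

lemma R: "0 \<le> R" "R < 1" "a \<in> A0 \<Longrightarrow> cmod a \<le> R"
  using finA0 A0_disc by (auto simp: R_def)

lemma P_nonzero: "cmod x > R \<Longrightarrow> P x \<noteq> 0"
  using R(3) finA0 by (force simp: P_def)

lemma P_zero_iff: "P x = 0 \<longleftrightarrow> x \<in> A0"
  using finA0 by (auto simp: P_def)

lemma rt_square:
  assumes x: "cmod x > R" shows "(rt x)\<^sup>2 = P x"
proof -
  have x0: "x \<noteq> 0" using x R(1) by auto
  have "(rt x)\<^sup>2 = x ^ card A0 * (\<Prod>a\<in>A0. 1 - a / x)"
    unfolding rt_def power_mult_distrib using evenA0
    by (simp add: power_mult[symmetric] prod_power_distrib)
  also have "\<dots> = (\<Prod>a\<in>A0. x * (1 - a / x))" by (simp add: prod.distrib)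
  also have "\<dots> = P x" unfolding P_def using x0 by (intro prod.cong) (auto simp: field_simps)
  finally show ?thesis .
qed

text \<open>\<open>|a / x| < 1\<close> keeps \<open>1 - a / x\<close> in the right half-plane, off
  the branch cut.\<close>

lemma rt_continuous: "continuous_on {x. cmod x > R} rt"
proof -
  have x0: "x \<noteq> 0" if "x \<in> {x. cmod x > R}" for x using that R(1) by auto
  have nr: "1 - a / x \<notin> \<real>\<^sub>\<le>\<^sub>0" if "a \<in> A0" "x \<in> {x. cmod x > R}" for a x
  proof -
    have "cmod (a / x) < 1"
      using R(3)[OF that(1)] that(2) R(1) by (simp add: norm_divide divide_less_eq)
    then have "Re (a / x) < 1" using complex_Re_le_cmod[of "a / x"] by linarith
    then show ?thesis by (auto simp: complex_nonpos_Reals_iff)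
  qed
  have "continuous_on {x. cmod x > R} (\<lambda>x. csqrt (1 - a / x))" if "a \<in> A0" for a
    by (rule continuous_on_compose2[OF continuous_on_csqrt])
       (use nr[OF that] x0 in \<open>auto intro!: continuous_intros\<close>)
  then show ?thesis unfolding rt_def[abs_def] by (intro continuous_intros) auto
qed

text \<open>For all but finitely many \<open>l\<close> the sign of the root is fixed by \<open>rt\<close>; the other signs are arbitrary.\<close>

definition is_sig where
  "is_sig l g \<longleftrightarrow> g holomorphic_on ball 0 1 \<and> (\<forall>z. cmod z < 1 \<longrightarrow> (g z)\<^sup>2 = P (mob l (F z))) \<and>
     (cmod (mob l (F 0)) > R \<longrightarrow> g 0 = rt (mob l (F 0)))"

definition sig where "sig l = (SOME g. is_sig l g)"

text \<open>\<open>A\<close> is invariant under \<open>Lam\<close>, so \<open>l o F\<close> is again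
  ramified over \<open>A0\<close> and the product defining \<open>P\<close> has a root; its sign is
  then adjusted at 0.\<close>

lemma sig:
  assumes l: "l \<in> Lam" shows "is_sig l (sig l)"
proof -
  have ram: "ramified A (\<lambda>z. mob l (F z))" using ramified_mob[OF F_ram Lsu[OF l] A_disc] mob_A[OF l] by simp
  have "has_sqrt (\<lambda>z. P (mob l (F z)))" unfolding P_def
    by (rule has_sqrt_prod[OF finA0]) (use ram A0_subset in \<open>auto simp: ramified_def\<close>)
  then obtain g where g: "g holomorphic_on ball 0 1" "\<And>z. cmod z < 1 \<Longrightarrow> (g z)\<^sup>2 = P (mob l (F z))"
    unfolding has_sqrt_def by metis
  have "\<exists>g. is_sig l g"
  proof (cases "cmod (mob l (F 0)) > R")
    case True
    then have "(g 0)\<^sup>2 = (rt (mob l (F 0)))\<^sup>2" using g(2)[of 0] rt_square by simp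
    then consider "g 0 = rt (mob l (F 0))" | "- g 0 = rt (mob l (F 0))" by (auto simp: power2_eq_iff)
    then show ?thesis
    proof cases
      case 1 then show ?thesis using g unfolding is_sig_def by blast
    next
      case 2
      then have "is_sig l (\<lambda>z. - g z)" using g unfolding is_sig_def by (auto intro: holomorphic_intros)
      then show ?thesis by blast
    qed
  next
    case False
    then show ?thesis using g unfolding is_sig_def by blast
  qed
  then show ?thesis unfolding sig_def by (rule someI_ex)
qed

lemma sig_holo: "l \<in> Lam \<Longrightarrow> sig l holomorphic_on ball 0 1"
  and sig_square: "l \<in> Lam \<Longrightarrow> cmod z < 1 \<Longrightarrow> (sig l z)\<^sup>2 = P (mob l (F z))"
  and sig_base: "l \<in> Lam \<Longrightarrow> cmod (mob l (F 0)) > R \<Longrightarrow> sig l 0 = rt (mob l (F 0))"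
  using sig unfolding is_sig_def by blast+

text \<open>Ensures that a sign in front of a root is unambiguous. Surjectivity of \<open>F\<close>
  provides a point that avoids the zeros of \<open>P\<close>.\<close>

lemma sig_nonzero:
  assumes l: "l \<in> Lam" shows "\<exists>z. cmod z < 1 \<and> sig l z \<noteq> 0"
proof -
  have "infinite (ball (0::complex) 1)" using uncountable_ball[of 1 "0::complex"] uncountable_infinite by force
  then obtain y where y: "cmod y < 1" "y \<notin> A0"
    using finA0 by (metis mem_ball_0 finite_subset subsetI)
  obtain z where z: "cmod z < 1" "F z = mob (minv l) y"
    using F_surj[OF mob_in_disc[OF minv_su11[OF Lsu[OF l]] y(1)]] by blast
  have "mob l (F z) = y" using z(2) mob_minv(2)[OF Lsu[OF l] y(1)] by simp
  then have "(sig l z)\<^sup>2 \<noteq> 0" using sig_square[OF l z(1)] y(2) P_zero_iff by simp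
  then show ?thesis using z by auto
qed

section \<open>Deck pairs and the parity of sign changes\<close>

definition deck where
  "deck p q \<longleftrightarrow> p \<in> su11 \<and> q \<in> Lam \<and> (\<forall>u. cmod u < 1 \<longrightarrow> F (mob p u) = mob q (F u))"

lemma deckD: "deck p q \<Longrightarrow> p \<in> su11" "deck p q \<Longrightarrow> q \<in> Lam"
  "deck p q \<Longrightarrow> cmod u < 1 \<Longrightarrow> F (mob p u) = mob q (F u)"
  by (auto simp: deck_def)

lemma deck_one: "deck (1, 0) (1, 0)"
  by (simp add: deck_def one_su11 Lam_one)

lemma deck_mmul:
  assumes "deck p q" "deck p' q'" shows "deck (mmul p p') (mmul q q')"
  unfolding deck_def
proof (intro conjI allI impI)
  note d = deckD[OF assms(1)] and d' = deckD[OF assms(2)]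
  show "mmul p p' \<in> su11" "mmul q q' \<in> Lam" using d d' mmul_su11 Lam_mmul by auto
  fix u :: complex assume u: "cmod u < 1"
  show "F (mob (mmul p p') u) = mob (mmul q q') (F u)"
    using mob_mmul[OF d(1) d'(1) u] mob_mmul[OF Lsu[OF d(2)] Lsu[OF d'(2)] F_norm[OF u]]
      d(3)[OF mob_in_disc[OF d'(1) u]] d'(3)[OF u] by simp
qed

lemma deck_minv:
  assumes "deck p q" shows "deck (minv p) (minv q)"
  unfolding deck_def
proof (intro conjI allI impI)
  note d = deckD[OF assms(1)]
  show "minv p \<in> su11" "minv q \<in> Lam" using d minv_su11 Lam_minv by auto
  fix u :: complex assume u: "cmod u < 1"
  have mu: "cmod (mob (minv p) u) < 1" using mob_in_disc[OF minv_su11[OF d(1)] u] .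
  have "F u = mob q (F (mob (minv p) u))" using d(3)[OF mu] mob_minv(2)[OF d(1) u] by simp
  then show "F (mob (minv p) u) = mob (minv q) (F u)" using mob_minv(1)[OF Lsu[OF d(2)] F_norm[OF mu]] by simp
qed

text \<open>Composition with \<open>p\<close> turns the root of index \<open>l\<close> into the root
  of index \<open>l q\<close> up to sign; the set collects the negative signs.\<close>

definition flips where
  "flips p q = {l\<in>Lam. \<not> (\<forall>z. cmod z < 1 \<longrightarrow> sig l (mob p z) = sig (mmul l q) z)}"

lemma sig_sign:
  assumes d: "deck p q" and l: "l \<in> Lam"
  shows "l \<notin> flips p q \<Longrightarrow> cmod z < 1 \<Longrightarrow> sig l (mob p z) = sig (mmul l q) z"
    and "l \<in> flips p q \<Longrightarrow> cmod z < 1 \<Longrightarrow> sig l (mob p z) = - sig (mmul l q) z"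
proof -
  note dd = deckD[OF d]
  have lq: "mmul l q \<in> Lam" using Lam_mmul[OF l dd(2)] .
  show "l \<notin> flips p q \<Longrightarrow> cmod z < 1 \<Longrightarrow> sig l (mob p z) = sig (mmul l q) z"
    using l by (simp add: flips_def)
  have hol: "(\<lambda>z. sig l (mob p z)) holomorphic_on ball 0 1"
    using holomorphic_on_compose_gen[OF mob_holomorphic[OF dd(1)] sig_holo[OF l]] mob_in_disc[OF dd(1)]
    by (force simp: o_def)
  have "(sig l (mob p z))\<^sup>2 = (sig (mmul l q) z)\<^sup>2" if z: "cmod z < 1" for z
    using sig_square[OF l mob_in_disc[OF dd(1) z]] sig_square[OF lq z] dd(3)[OF z]
      mob_mmul[OF Lsu[OF l] Lsu[OF dd(2)] F_norm[OF z]] by simp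
  from holomorphic_sqrt_sign[OF hol sig_holo[OF lq] this]
  show "l \<in> flips p q \<Longrightarrow> cmod z < 1 \<Longrightarrow> sig l (mob p z) = - sig (mmul l q) z"
    by (auto simp: flips_def)
qed

lemma flips_finite:
  assumes d: "deck p q" shows "finite (flips p q)"
proof -
  note dd = deckD[OF d]
  define S where "S = closed_segment 0 (mob p 0)"
  have mp0: "cmod (mob p 0) < 1" using mob_in_disc[OF dd(1), of 0] by simp
  have S: "S \<subseteq> ball 0 1" unfolding S_def
    by (rule closed_segment_subset) (use mp0 in auto)
  have Fc: "continuous_on S F"
    using continuous_on_subset[OF holomorphic_on_imp_continuous_on[OF disc_map_holo[OF Fd]] S] .
  then have cF: "compact (F ` S)" by (intro compact_continuous_image) (auto simp: S_def)
  have cc: "compact (cmod ` F ` S)"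
    by (rule compact_continuous_image[OF continuous_on_norm[OF continuous_on_id] cF])
  have "0 \<in> S" "mob p 0 \<in> S" by (auto simp: S_def)
  then obtain x0 where x0: "x0 \<in> S" "\<And>x. x \<in> S \<Longrightarrow> cmod (F x) \<le> cmod (F x0)"
    using compact_attains_sup[OF cc] by blast
  define \<rho> where "\<rho> = max R (cmod (F x0))"
  have \<rho>: "\<rho> < 1" using R(2) F_norm[of x0] x0(1) S by (auto simp: \<rho>_def)
  have "flips p q \<subseteq> {l\<in>Lam. \<exists>z. cmod z \<le> \<rho> \<and> cmod (mob l z) \<le> \<rho>}"
  proof
    fix l assume lf: "l \<in> flips p q"
    then have l: "l \<in> Lam" by (simp add: flips_def)
    have "\<exists>x\<in>S. cmod (mob l (F x)) \<le> R"
    proof (rule ccontr)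
      assume "\<not> ?thesis"
      then have big: "cmod (mob l (F x)) > R" if "x \<in> S" for x using that by auto
      have lq: "mmul l q \<in> Lam" using Lam_mmul[OF l dd(2)] .
      define \<phi> where "\<phi> x = sig l x / rt (mob l (F x))" for x
      have rnz: "rt (mob l (F x)) \<noteq> 0" if "x \<in> S" for x
        using rt_square[OF big[OF that]] P_nonzero[OF big[OF that]] by auto
      have "continuous_on S (\<lambda>x. mob l (F x))"
        by (rule continuous_on_compose2[OF holomorphic_on_imp_continuous_on[OF mob_holomorphic[OF Lsu[OF l]]] Fc])
           (use F_norm S in auto)
      then have "continuous_on S (\<lambda>x. rt (mob l (F x)))"
        by (rule continuous_on_compose2[OF rt_continuous]) (use big in auto)
      then have "continuous_on S \<phi>" unfolding \<phi>_def
        using continuous_on_subset[OF holomorphic_on_imp_continuous_on[OF sig_holo[OF l]] S] rnz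
        by (intro continuous_on_divide) auto
      moreover have "\<phi> x \<in> {1, -1}" if x: "x \<in> S" for x
      proof -
        have "(sig l x)\<^sup>2 = (rt (mob l (F x)))\<^sup>2"
          using sig_square[OF l, of x] rt_square[OF big[OF x]] S x by auto
        then have "(\<phi> x)\<^sup>2 = 1" unfolding \<phi>_def power_divide using rnz[OF x] by simp
        then show ?thesis by (auto simp: power2_eq_1_iff)
      qed
      then have "finite (\<phi> ` S)" by (intro finite_subset[of "\<phi> ` S" "{1,-1}"]) auto
      moreover have "connected S" by (simp add: S_def)
      ultimately have "\<phi> constant_on S" using continuous_finite_range_constant by blast
      then have "\<phi> (mob p 0) = \<phi> 0" using \<open>0 \<in> S\<close> \<open>mob p 0 \<in> S\<close> unfolding constant_on_def by metis
      also have "\<phi> 0 = 1" unfolding \<phi>_def using sig_base[OF l big[OF \<open>0 \<in> S\<close>]] rnz[OF \<open>0 \<in> S\<close>] by simp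
      finally have e1: "sig l (mob p 0) = rt (mob l (F (mob p 0)))"
        unfolding \<phi>_def using rnz[OF \<open>mob p 0 \<in> S\<close>] by simp
      \<comment> \<open>So the value at which \<open>sig (mmul l q)\<close> is normalised at 0 is
        the one reached by \<open>sig l\<close> at \<open>mob p 0\<close>.\<close>
      have e2: "mob l (F (mob p 0)) = mob (mmul l q) (F 0)"
        using dd(3)[of 0] mob_mmul[OF Lsu[OF l] Lsu[OF dd(2)] F_norm[of 0]] by simp
      have "sig (mmul l q) 0 = rt (mob (mmul l q) (F 0))"
        by (rule sig_base[OF lq]) (use big[OF \<open>mob p 0 \<in> S\<close>] e2 in simp)
      then have "sig l (mob p 0) = sig (mmul l q) 0" using e1 e2 by simp
      moreover have "sig l (mob p 0) = - sig (mmul l q) 0" using sig_sign(2)[OF d l lf, of 0] by simp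
      moreover have "sig l (mob p 0) \<noteq> 0" unfolding e1 using rnz[OF \<open>mob p 0 \<in> S\<close>] .
      ultimately show False by simp
    qed
    then obtain x where x: "x \<in> S" "cmod (mob l (F x)) \<le> R" by blast
    then show "l \<in> {l\<in>Lam. \<exists>z. cmod z \<le> \<rho> \<and> cmod (mob l z) \<le> \<rho>}"
      using l x0(2)[OF x(1)] by (auto simp: \<rho>_def intro!: exI[of _ "F x"])
  qed
  then show ?thesis using Lam_discrete[OF \<rho>] finite_subset by blast
qed

definition chi where "chi p q \<longleftrightarrow> even (card (flips p q))"

text \<open>Signs multiply along a composition once indices are shifted: the flips of the product
  are the symmetric difference of those of the first pair and the right translate by the inverse of
  \<open>q\<close> of those of the second.\<close>

lemma chi_mmul:
  assumes d: "deck p q" and d': "deck p' q'"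
  shows "chi (mmul p p') (mmul q q') \<longleftrightarrow> (chi p q \<longleftrightarrow> chi p' q')"
proof -
  note dd = deckD[OF d] and dd' = deckD[OF d']
  note qsu = Lsu[OF dd(2)]
  define T where "T = {l\<in>Lam. mmul l q \<in> flips p' q'}"
  have fl: "flips p'' q'' \<subseteq> Lam" for p'' q'' by (auto simp: flips_def)
  have "bij_betw (\<lambda>l. mmul l q) T (flips p' q')"
  proof (rule bij_betw_byWitness[where f' = "\<lambda>l. mmul l (minv q)"])
    show "\<forall>l\<in>T. mmul (mmul l q) (minv q) = l" using mmul_minv(2)[OF qsu] by (simp add: mmul_assoc)
    show "\<forall>l\<in>flips p' q'. mmul (mmul l (minv q)) q = l" using mmul_minv(1)[OF qsu] by (simp add: mmul_assoc)
    show "(\<lambda>l. mmul l q) ` T \<subseteq> flips p' q'" by (auto simp: T_def)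
    show "(\<lambda>l. mmul l (minv q)) ` flips p' q' \<subseteq> T"
    proof (rule image_subsetI)
      fix l assume l: "l \<in> flips p' q'"
      then have "l \<in> Lam" using fl by blast
      then have "mmul l (minv q) \<in> Lam" using Lam_mmul Lam_minv[OF dd(2)] by blast
      moreover have "mmul (mmul l (minv q)) q = l" using mmul_minv(1)[OF qsu] by (simp add: mmul_assoc)
      ultimately show "mmul l (minv q) \<in> T" using l unfolding T_def by simp
    qed
  qed
  then have T: "card T = card (flips p' q')" "finite T"
    by (metis bij_betw_same_card, metis bij_betw_finite flips_finite[OF d'])
  have "flips (mmul p p') (mmul q q') = (flips p q - T) \<union> (T - flips p q)"
  proof -
    have "l \<in> flips (mmul p p') (mmul q q') \<longleftrightarrow> (l \<in> flips p q \<longleftrightarrow> l \<notin> T)" if l: "l \<in> Lam" for l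
    proof -
      have lq: "mmul l q \<in> Lam" using Lam_mmul[OF l dd(2)] .
      have tot: "mmul l (mmul q q') \<in> Lam" using Lam_mmul[OF l Lam_mmul[OF dd(2) dd'(2)]] .
      obtain z where z: "cmod z < 1" "sig (mmul l (mmul q q')) z \<noteq> 0" using sig_nonzero[OF tot] by blast
      have pz: "cmod (mob p' z) < 1" using mob_in_disc[OF dd'(1) z(1)] .
      have c: "sig l (mob (mmul p p') z) = sig l (mob p (mob p' z))" using mob_mmul[OF dd(1) dd'(1) z(1)] by simp
      have s1: "sig l (mob p (mob p' z)) = (if l \<in> flips p q then -1 else 1) * sig (mmul l q) (mob p' z)"
        using sig_sign[OF d l _ pz] by auto
      have s2: "sig (mmul l q) (mob p' z) = (if l \<in> T then -1 else 1) * sig (mmul l (mmul q q')) z"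
        using sig_sign[OF d' lq _ z(1)] l by (auto simp: T_def mmul_assoc)
      have s3: "sig l (mob (mmul p p') z) = (if l \<in> flips (mmul p p') (mmul q q') then -1 else 1) * sig (mmul l (mmul q q')) z"
        using sig_sign[OF deck_mmul[OF d d'] l _ z(1)] by auto
      show ?thesis using s1 s2 s3 c z(2) by (auto split: if_splits)
    qed
    moreover have "T \<subseteq> Lam" by (auto simp: T_def)
    ultimately show ?thesis using fl by blast
  qed
  then show ?thesis unfolding chi_def
    using even_card_sym_diff[OF flips_finite[OF d] T(2)] T(1) by simp
qed

lemma chi_one: "chi (1, 0) (1, 0)"
proof -
  have "flips (1, 0) (1, 0) = {}" by (auto simp: flips_def)
  then show ?thesis by (simp add: chi_def)
qed

lemma chi_minv:
  assumes d: "deck p q" shows "chi (minv p) (minv q) \<longleftrightarrow> chi p q"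
  using chi_mmul[OF deck_minv[OF d] d] chi_one mmul_minv(1)[OF deckD(1)[OF d]] mmul_minv(1)[OF Lsu[OF deckD(2)[OF d]]]
  by simp

section \<open>The kernel and its action on the bidisc and the graph\<close>

definition G where "G = {prod_aut p q | p q. deck p q \<and> chi p q}"

lemma G_memI: "deck p q \<Longrightarrow> chi p q \<Longrightarrow> prod_aut p q \<in> G"
  unfolding G_def by blast

lemma G_aut_group: "aut_group G"
  unfolding aut_group_def
proof (intro conjI ballI)
  show "bidisc_aut g" if "g \<in> G" for g
    using that prod_aut_is_aut deckD(1) Lsu[OF deckD(2)] by (auto simp: G_def)
  have "prod_aut (1,0) (1,0) \<in> G" using deck_one chi_one G_memI by blast
  moreover have "\<forall>x\<in>bidisc. prod_aut (1,0) (1,0) x = x" by (simp add: prod_aut_def)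
  ultimately show "\<exists>e\<in>G. \<forall>x\<in>bidisc. e x = x" by blast
  fix g assume "g \<in> G"
  then obtain p q where g: "g = prod_aut p q" "deck p q" "chi p q" unfolding G_def by blast
  note d = deckD(1)[OF g(2)] Lsu[OF deckD(2)[OF g(2)]]
  show "\<exists>k\<in>G. \<forall>x\<in>bidisc. k x = g (h x)" if hG: "h \<in> G" for h
  proof -
    obtain p' q' where h: "h = prod_aut p' q'" "deck p' q'" "chi p' q'" using hG unfolding G_def by blast
    have "prod_aut (mmul p p') (mmul q q') \<in> G"
      using deck_mmul[OF g(2) h(2)] chi_mmul[OF g(2) h(2)] g(3) h(3) G_memI by blast
    moreover have "\<forall>x\<in>bidisc. prod_aut (mmul p p') (mmul q q') x = g (h x)"
      using prod_aut_compose[OF d deckD(1)[OF h(2)] Lsu[OF deckD(2)[OF h(2)]]] g(1) h(1) by simp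
    ultimately show ?thesis by blast
  qed
  have "prod_aut (minv p) (minv q) \<in> G"
    using deck_minv[OF g(2)] chi_minv[OF g(2)] g(3) G_memI by blast
  then show "\<exists>h\<in>G. \<forall>x\<in>bidisc. h (g x) = x \<and> g (h x) = x"
    using prod_aut_inverse[OF d] g(1) by blast
qed

text \<open>The quotient of the two maps fixes 0 and leaves \<open>F\<close> unchanged; as
  \<open>deriv F 0\<close> is nonzero it has derivative 1 at 0 and is the identity.\<close>

lemma deck_determined:
  assumes d: "deck p q" "deck p' q" and eq: "mob p 0 = mob p' 0" and u: "cmod u < 1"
  shows "mob p u = mob p' u"
proof -
  let ?k = "mmul (minv p') p"
  note su = deckD(1)[OF d(1)] deckD(1)[OF d(2)]
  have ksu: "?k \<in> su11" using mmul_su11[OF minv_su11[OF su(2)] su(1)] .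
  have "deck ?k (mmul (minv q) q)" by (rule deck_mmul[OF deck_minv[OF d(2)] d(1)])
  then have dk: "deck ?k (1, 0)" using mmul_minv(1)[OF Lsu[OF deckD(2)[OF d(1)]]] by simp
  have k: "mob ?k u = mob (minv p') (mob p u)" if "cmod u < 1" for u
    using mob_mmul[OF minv_su11[OF su(2)] su(1) that] .
  have k0: "mob ?k 0 = 0" using k[of 0] eq mob_minv(1)[OF su(2), of 0] by simp
  have "deriv (\<lambda>u. F (mob ?k u)) 0 = deriv F 0"
    by (rule deriv_cong_disc) (use deckD(3)[OF dk] in auto)
  then have "deriv (mob ?k) 0 = 1"
    using disc_map_chain[OF Fd disc_map_mob[OF ksu], of 0] k0 dF0 by simp
  then have "mob ?k u = u" using fixing_identity[OF ksu _ k0 _ u] by simp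
  then have "mob p' (mob (minv p') (mob p u)) = mob p' u" using k[OF u] by simp
  then show ?thesis using mob_minv(2)[OF su(2) mob_in_disc[OF su(1) u]] by simp
qed

text \<open>The second factor leaves finitely many \<open>q\<close>. The first confines
  \<open>mob p 0\<close> to a compact disc, and there the fibre of \<open>F\<close> over
  \<open>mob q (F 0)\<close> is finite. By \<open>deck_determined\<close> the pair of
  \<open>mob p 0\<close> and \<open>q\<close> fixes the action.\<close>

lemma G_discrete: "discrete_aut_group G"
  unfolding discrete_aut_group_def
proof (intro allI impI)
  fix K assume K: "compact K \<and> K \<subseteq> bidisc"
  have "compact (fst ` K)" "compact (snd ` K)"
    using K by (auto intro!: compact_continuous_image continuous_intros)
  moreover have "fst ` K \<subseteq> ball 0 1" "snd ` K \<subseteq> ball 0 1" using K by (auto simp: bidisc_def)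
  ultimately obtain r1 r2 where r12: "0 \<le> r1" "r1 < 1" "fst ` K \<subseteq> cball 0 r1" "0 \<le> r2" "r2 < 1" "snd ` K \<subseteq> cball 0 r2"
    using compact_in_cball by meson
  define L where "L = {q\<in>Lam. \<exists>z. cmod z \<le> r2 \<and> cmod (mob q z) \<le> r2}"
  have finL: "finite L" unfolding L_def by (rule Lam_discrete[OF r12(5)])
  define \<kappa> where "\<kappa> = (1 - r1\<^sup>2) * (1 - r1)\<^sup>2"
  have \<kappa>: "\<kappa> > 0" using r12 by (simp add: \<kappa>_def power_less_one_iff)
  \<comment> \<open>Turns \<open>1 - |mob p 0|^2 = 1 / |fst p|^2 \<ge> \<kappa>\<close> into
    \<open>|mob p 0| \<le> \<rho>\<close>.\<close>
  define \<rho> where "\<rho> = sqrt (1 - \<kappa>)"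
  have \<rho>: "\<rho> < 1" using \<kappa> by (simp add: \<rho>_def)
  define Y where "Y = (\<Union>q\<in>L. {y\<in>cball 0 \<rho>. F y - mob q (F 0) = 0})"
  have finY: "finite Y" unfolding Y_def
  proof (rule finite_UN_I[OF finL])
    fix q assume "q \<in> L"
    have h: "(\<lambda>y. F y - mob q (F 0)) holomorphic_on ball 0 1" by (intro holomorphic_intros disc_map_holo Fd)
    have nc: "\<not> (\<lambda>y. F y - mob q (F 0)) constant_on ball 0 1"
    proof
      assume "(\<lambda>y. F y - mob q (F 0)) constant_on ball 0 1"
      then obtain c where "\<And>y. y \<in> ball 0 1 \<Longrightarrow> F y - mob q (F 0) = c" by (auto simp: constant_on_def)
      then have "F constant_on ball 0 1" unfolding constant_on_def by (metis diff_eq_eq)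
      then show False using F_nonconstant by simp
    qed
    have "cball 0 \<rho> \<subseteq> ball (0::complex) 1" using \<rho> by auto
    then show "finite {y\<in>cball 0 \<rho>. F y - mob q (F 0) = 0}"
      using holomorphic_compact_finite_zeros[OF h open_ball connected_ball compact_cball _ nc] by blast
  qed
  have "(\<lambda>g. restrict g bidisc) ` {g\<in>G. g ` K \<inter> K \<noteq> {}} \<subseteq>
     (\<lambda>(y,q). restrict (prod_aut (SOME p. deck p q \<and> mob p 0 = y) q) bidisc) ` (Y \<times> L)"
  proof (rule image_subsetI)
    fix g assume "g \<in> {g\<in>G. g ` K \<inter> K \<noteq> {}}"
    then obtain p q x where g: "g = prod_aut p q" "deck p q" and x: "x \<in> K" "g x \<in> K"
      unfolding G_def by blast
    note d = deckD[OF g(2)]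
    have f: "cmod (fst x) \<le> r1" "cmod (mob p (fst x)) \<le> r1" and s: "cmod (snd x) \<le> r2" "cmod (mob q (snd x)) \<le> r2"
      using x r12(3,6) by (force simp: g(1) prod_aut_def)+
    have qL: "q \<in> L" using d(2) s by (auto simp: L_def)
    have k: "(cmod (fst p))\<^sup>2 * \<kappa> \<le> 1" unfolding \<kappa>_def by (rule mob_norm_bound[OF d(1) r12(1,2) f])
    have fp: "cmod (fst p) > 0" using su11_norm_less[OF d(1)] by (smt (verit) norm_ge_zero)
    have "1 - (cmod (mob p 0))\<^sup>2 = 1 / (cmod (fst p))\<^sup>2" using mob_norm[OF d(1), of 0] by simp
    also have "\<dots> \<ge> \<kappa>" using k fp by (simp add: pos_le_divide_eq mult.commute)
    finally have "cmod (mob p 0) \<le> \<rho>" unfolding \<rho>_def by (intro real_le_rsqrt) simp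
    then have yY: "mob p 0 \<in> Y" using qL d(3)[of 0] by (auto simp: Y_def)
    let ?p = "SOME p'. deck p' q \<and> mob p' 0 = mob p 0"
    have sp: "deck ?p q \<and> mob ?p 0 = mob p 0" by (rule someI[of _ p]) (use g(2) in auto)
    have eq: "mob p u = mob ?p u" if "cmod u < 1" for u
      by (rule deck_determined[OF g(2) conjunct1[OF sp] conjunct2[OF sp, symmetric] that])
    have "prod_aut p q y = prod_aut ?p q y" if "y \<in> bidisc" for y
    proof -
      have "cmod (fst y) < 1" using that by (auto simp: bidisc_def)
      from eq[OF this] show ?thesis unfolding prod_aut_def prod.inject by blast
    qed
    then have "restrict g bidisc = restrict (prod_aut ?p q) bidisc"
      unfolding g(1) by (rule restrict_ext)
    then have "restrict g bidisc = (\<lambda>(y,q). restrict (prod_aut (SOME p. deck p q \<and> mob p 0 = y) q) bidisc) (mob p 0, q)"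
      unfolding prod.case .
    moreover have "(mob p 0, q) \<in> Y \<times> L" using yY qL by blast
    ultimately show "restrict g bidisc \<in> (\<lambda>(y,q). restrict (prod_aut (SOME p. deck p q \<and> mob p 0 = y) q) bidisc) ` (Y \<times> L)"
      by (rule image_eqI)
  qed
  then show "finite ((\<lambda>g. restrict g bidisc) ` {g\<in>G. g ` K \<inter> K \<noteq> {}})"
    by (rule finite_subset) (use finY finL in auto)
qed

text \<open>An involution fixing a ramification point over \<open>l\<inverse> a\<close> changes the sign of exactly one root,
  the one that has a simple zero there.\<close>

lemma involution_chi:
  assumes d: "deck p (1, 0)" and z: "cmod z < 1" "mob p z = z" "deriv (mob p) z = - 1"
  shows "\<not> chi p (1, 0)"
proof -
  note dd = deckD[OF d]
  have FA: "F z \<in> A"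
  proof (rule ccontr)
    assume nA: "F z \<notin> A"
    have "deriv (\<lambda>u. F (mob p u)) z = deriv F z" by (rule deriv_cong_disc) (use dd(3) z in auto)
    then show False
      using disc_map_chain[OF Fd disc_map_mob[OF dd(1)] z(1)] z F_deriv_nonzero[OF z(1) nA] by simp
  qed
  then obtain l0 a0 where l0: "l0 \<in> Lam" "a0 \<in> A0" "F z = mob l0 a0" using A_eq by auto
  have a0: "cmod a0 < 1" using l0 A0_disc by auto
  define l where "l = minv l0"
  have l: "l \<in> Lam" using Lam_minv[OF l0(1)] by (simp add: l_def)
  have lz: "mob l (F z) = a0" using mob_minv(1)[OF Lsu[OF l0(1)] a0] l0(3) by (simp add: l_def)
  \<comment> \<open>A root of another index that changed sign would vanish at \<open>z\<close>, so
    \<open>m\<close> would also take \<open>F z\<close> into \<open>A0\<close>; inequivalence and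
    freeness leave only \<open>m = l\<close>.\<close>
  have other: "m \<notin> flips p (1,0)" if m: "m \<in> Lam" "m \<noteq> l" for m
  proof
    assume mf: "m \<in> flips p (1,0)"
    have "sig m z = - sig m z" using sig_sign(2)[OF d m(1) mf z(1)] z(2) by simp
    then have "sig m z = 0" by simp
    then have ma: "mob m (F z) \<in> A0" using sig_square[OF m(1) z(1)] P_zero_iff by simp
    have ml: "mmul m l0 \<in> Lam" using Lam_mmul[OF m(1) l0(1)] .
    have e: "mob (mmul m l0) a0 = mob m (F z)" using mob_mmul[OF Lsu[OF m(1)] Lsu[OF l0(1)] a0] l0(3) by simp
    have "a0 = mob m (F z)" using ineq[OF l0(2) ma ml e] .
    then have "mmul m l0 = (1, 0)" using Lam_free[OF ml a0] e by simp
    then have "mmul (mmul m l0) (minv l0) = minv l0" by simp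
    then have "m = l" using mmul_minv(2)[OF Lsu[OF l0(1)]] by (simp add: mmul_assoc l_def)
    then show False using m by simp
  qed
  obtain g where g: "g holomorphic_on ball 0 1" "\<And>u. cmod u < 1 \<Longrightarrow> F u - F z = (g u)\<^sup>2"
    using F_ram FA unfolding ramified_def has_sqrt_def by blast
  have gz: "g z = 0" using g(2)[OF z(1)] by simp
  have g1: "deriv g z \<noteq> 0" by (rule F_sqrt_deriv_nonzero[OF z(1) FA g])
  \<comment> \<open>With the factor of \<open>a0\<close> split off, \<open>(sig l)^2\<close> is
    \<open>g^2\<close> times a function nonzero at \<open>z\<close>; so \<open>sig l\<close> has a
    simple zero there, like \<open>g\<close>.\<close>
  define U where "U u = (\<Prod>a\<in>A0 - {a0}. mob l (F u) - a) /
     ((cnj (snd l) * F u + cnj (fst l)) * (cnj (snd l) * F z + cnj (fst l)))" for u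
  have SU: "(sig l u)\<^sup>2 = (g u)\<^sup>2 * U u" if u: "cmod u < 1" for u
  proof -
    have "(sig l u)\<^sup>2 = (mob l (F u) - a0) * (\<Prod>a\<in>A0 - {a0}. mob l (F u) - a)"
      unfolding sig_square[OF l u] P_def using finA0 l0(2) by (simp add: prod.remove)
    also have "mob l (F u) - a0 = (F u - F z) / ((cnj (snd l) * F u + cnj (fst l)) * (cnj (snd l) * F z + cnj (fst l)))"
      unfolding lz[symmetric] by (rule mob_diff[OF Lsu[OF l] F_norm[OF u] F_norm[OF z(1)]])
    finally show ?thesis unfolding g(2)[OF u, symmetric] U_def by simp
  qed
  have Fcont: "isCont F z"
    using holomorphic_on_imp_differentiable_at[OF disc_map_holo[OF Fd] open_ball] z
    by (simp add: field_differentiable_imp_continuous_at)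
  have mcont: "isCont (mob l) (F z)"
    using mob_has_derivative[OF Lsu[OF l] F_norm[OF z(1)]] DERIV_isCont by blast
  have dn: "cnj (snd l) * F z + cnj (fst l) \<noteq> 0" using mob_denom_nz[OF Lsu[OF l] F_norm[OF z(1)]] .
  have Ucont: "isCont U z" unfolding U_def
    using Fcont dn isCont_o2[OF Fcont mcont] by (intro continuous_intros) auto
  have Uz: "U z \<noteq> 0" unfolding U_def lz using dn finA0 by auto
  have sz: "sig l z = 0" using SU[OF z(1)] gz by simp
  have Sd: "(sig l has_field_derivative deriv (sig l) z) (at z)"
    using holomorphic_derivI[OF sig_holo[OF l] open_ball] z by simp
  have gd: "(g has_field_derivative deriv g z) (at z)"
    using holomorphic_derivI[OF g(1) open_ball] z by simp
  have "((\<lambda>u. (sig l u / (u - z))\<^sup>2) \<longlongrightarrow> (deriv (sig l) z)\<^sup>2) (at z)"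
    using Sd unfolding has_field_derivative_iff sz by (intro tendsto_intros) simp
  moreover have lim2: "((\<lambda>u. (g u / (u - z))\<^sup>2 * U u) \<longlongrightarrow> (deriv g z)\<^sup>2 * U z) (at z)"
    using gd Ucont unfolding has_field_derivative_iff gz isCont_def by (intro tendsto_intros) simp_all
  moreover have ev: "\<forall>\<^sub>F u in at z. (sig l u / (u - z))\<^sup>2 = (g u / (u - z))\<^sup>2 * U u"
    using eventually_at_in_open'[of "ball 0 1" z] z SU by (auto elim!: eventually_mono simp: power_divide)
  ultimately have "(deriv (sig l) z)\<^sup>2 = (deriv g z)\<^sup>2 * U z"
    using tendsto_unique[OF at_neq_bot _ iffD2[OF tendsto_cong[OF ev] lim2]] by blast
  then have S1: "deriv (sig l) z \<noteq> 0" using g1 Uz by auto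
  \<comment> \<open>Without a sign change the chain rule would give
    \<open>deriv (sig l) z = - deriv (sig l) z\<close>.\<close>
  have "l \<in> flips p (1,0)"
  proof (rule ccontr)
    assume nl: "l \<notin> flips p (1,0)"
    have "deriv (\<lambda>u. sig l (mob p u)) z = deriv (sig l) z"
      by (rule deriv_cong_disc) (use sig_sign(1)[OF d l nl] z in auto)
    moreover have "deriv (\<lambda>u. sig l (mob p u)) z = deriv (sig l) z * deriv (mob p) z"
      by (rule DERIV_imp_deriv[OF DERIV_chain2[OF _ disc_map_deriv[OF disc_map_mob[OF dd(1)] z(1)]]]) (use Sd z in simp)
    ultimately show False using z S1 by simp
  qed
  then have "flips p (1,0) = {l}" using other by (auto simp: flips_def)
  then show ?thesis by (simp add: chi_def)
qed

text \<open>An element of finite order fixes some \<open>z\<close> in the first factor, so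
  \<open>q\<close> fixes \<open>F z\<close> and is trivial by freeness. The derivative at
  \<open>z\<close> is then 1, which gives the identity, or -1, which \<open>involution_chi\<close>
  excludes from the kernel.\<close>

lemma G_torsion_free: "torsion_free G"
  unfolding torsion_free_def
proof (intro ballI allI impI)
  fix g n x assume gG: "g \<in> G" and n: "(n::nat) > 0" and per: "\<forall>x\<in>bidisc. (g ^^ n) x = x" and x: "x \<in> bidisc"
  from gG obtain p q where g: "g = prod_aut p q" and d: "deck p q" and chi: "chi p q" unfolding G_def by blast
  note dd = deckD[OF d]
  have it: "(g ^^ k) y = ((mob p ^^ k) (fst y), (mob q ^^ k) (snd y))" for k y
    by (induction k) (auto simp: g prod_aut_def)
  have "(0, 0) \<in> bidisc" by (simp add: bidisc_def)
  then have "(mob p ^^ n) 0 = 0" using per it[of n "(0,0)"] by fastforce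
  from finite_order_fixed_point[OF dd(1) n this] obtain z where z: "cmod z < 1" "mob p z = z" by blast
  have "mob q (F z) = F z" using dd(3)[OF z(1)] z(2) by simp
  then have q: "q = (1, 0)" by (rule Lam_free[OF dd(2) F_norm[OF z(1)]])
  have "F (mob p u) = F u" if "cmod u < 1" for u using dd(3)[OF that] q by simp
  then have "(deriv (mob p) z)\<^sup>2 = 1" by (rule fixing_deriv[OF disc_map_mob[OF dd(1)] z])
  moreover have "deriv (mob p) z \<noteq> - 1" using involution_chi[OF _ z] d chi q by auto
  ultimately have "deriv (mob p) z = 1" by (auto simp: power2_eq_1_iff)
  then have "mob p u = u" if "cmod u < 1" for u by (rule fixing_identity[OF dd(1) z _ that])
  then show "g x = x" using x by (auto simp: g q prod_aut_def bidisc_def)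
qed

text \<open>\<open>F\<close> is open and onto, so the images of an exhaustion of the disc form an
  open cover of \<open>cball 0 r\<close>, and finitely many suffice.\<close>

lemma compact_preimage: "r < 1 \<Longrightarrow> \<exists>r'<1. cball 0 r \<subseteq> F ` cball 0 r'"
proof -
  assume r: "r < 1"
  have "cball 0 r \<subseteq> (\<Union>n::nat. F ` ball 0 (1 - 1 / real (Suc n)))"
  proof
    fix c :: complex assume "c \<in> cball 0 r"
    then obtain z where z: "cmod z < 1" "F z = c" using F_surj[of c] r by auto
    obtain n where "1 / real (Suc n) < 1 - cmod z" using nat_approx_posE[of "1 - cmod z"] z(1) by (metis diff_gt_0_iff_gt)
    then show "c \<in> (\<Union>n::nat. F ` ball 0 (1 - 1 / real (Suc n)))" using z(2) by (auto intro!: exI[of _ n] image_eqI[of _ _ z])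
  qed
  moreover have "open (F ` ball 0 (1 - 1 / real (Suc n)))" for n :: nat
    by (rule F_open) (auto simp: subset_ball)
  ultimately obtain N where N: "finite N" "cball 0 r \<subseteq> (\<Union>n\<in>N. F ` ball 0 (1 - 1 / real (Suc n)))"
    using compactE_image[OF compact_cball[of 0 r], of UNIV "\<lambda>n. F ` ball 0 (1 - 1 / real (Suc n))"] by auto
  define m where "m = Max (insert 0 N)"
  have "cball 0 r \<subseteq> F ` cball 0 (1 - 1 / real (Suc m))"
  proof
    fix c :: complex assume "c \<in> cball 0 r"
    then obtain n z where nz: "n \<in> N" "cmod z < 1 - 1 / real (Suc n)" "c = F z" using N(2) by auto
    have "n \<le> m" unfolding m_def using N(1) nz(1) by simp
    then have "1 / real (Suc m) \<le> 1 / real (Suc n)" by (simp add: frac_le)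
    then have "z \<in> cball 0 (1 - 1 / real (Suc m))" using nz(2) by simp
    then show "c \<in> F ` cball 0 (1 - 1 / real (Suc m))" using nz(3) by blast
  qed
  then show ?thesis by (intro exI[of _ "1 - 1 / real (Suc m)"]) auto
qed

lemma deck_graph:
  assumes d: "deck p q" and z: "cmod z < 1"
  shows "prod_aut p q (z, F z) = (mob p z, F (mob p z))"
  using deckD(3)[OF d z] by (simp add: prod_aut_def)

text \<open>\<open>Lam\<close> moves \<open>F z\<close> into a fixed disc, onto which
  \<open>F\<close> maps some \<open>cball 0 r\<close>; a deck pair then moves \<open>z\<close> into
  \<open>cball 0 r\<close>. If that pair is odd, one fixed odd pair corrects it at the price of a
  second compact piece.\<close>

lemma G_compact_curve_lift: "compact_curve_lift G (graph F)"
  unfolding compact_curve_lift_def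
proof (intro conjI ballI)
  show "graph F \<noteq> {}" by (auto simp: graph_def intro!: exI[of _ 0])
  show "complex_curve (graph F)" by (rule graph_complex_curve[OF Fd])
  show "g ` graph F \<subseteq> graph F" if gG: "g \<in> G" for g
  proof (rule image_subsetI)
    fix x assume "x \<in> graph F"
    then obtain z where x: "x = (z, F z)" and z: "cmod z < 1" by (auto simp: graph_def)
    obtain p q where g: "g = prod_aut p q" and d: "deck p q" using gG unfolding G_def by blast
    show "g x \<in> graph F" unfolding g x deck_graph[OF d z]
      using mob_in_disc[OF deckD(1)[OF d] z] by (auto simp: graph_def)
  qed
  obtain r0 where r0: "r0 < 1" "\<And>z. cmod z < 1 \<Longrightarrow> \<exists>q\<in>Lam. cmod (mob q z) \<le> r0" using Lam_cocompact by blast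
  obtain r where r: "r < 1" "cball 0 r0 \<subseteq> F ` cball 0 r" using compact_preimage[OF r0(1)] by blast
  have move: "\<exists>p q. deck p q \<and> mob p z \<in> cball 0 r" if z: "cmod z < 1" for z
  proof -
    obtain q where q: "q \<in> Lam" "cmod (mob q (F z)) \<le> r0" using r0(2)[OF F_norm[OF z]] by blast
    then obtain z' where z': "z' \<in> cball 0 r" "F z' = mob q (F z)" using r(2) by (metis imageE mem_cball_0 subsetD)
    have "cmod z' < 1" using z'(1) r(1) by simp
    from deck_transformation[OF Lsu[OF q(1)] mob_A[OF q(1)] z this z'(2)]
    obtain p where "p \<in> su11" "mob p z = z'" "\<forall>u. cmod u < 1 \<longrightarrow> F (mob p u) = mob q (F u)" by blast
    then show ?thesis using q(1) z'(1) unfolding deck_def by blast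
  qed
  \<comment> \<open>An odd pair if there is one, the identity otherwise.\<close>
  obtain p1 q1 where pq1: "deck p1 q1" "(\<exists>p q. deck p q \<and> \<not> chi p q) \<longrightarrow> \<not> chi p1 q1" using deck_one by blast
  define C where "C = cball 0 r \<union> mob p1 ` cball 0 r"
  have sub: "cball 0 r \<subseteq> ball (0::complex) 1" using r(1) by auto
  have mc: "continuous_on (cball 0 r) (mob p1)"
    using continuous_on_subset[OF holomorphic_on_imp_continuous_on[OF mob_holomorphic[OF deckD(1)[OF pq1(1)]]] sub] .
  have C: "compact C" unfolding C_def by (intro compact_Un compact_cball compact_continuous_image mc)
  have Cs: "C \<subseteq> ball 0 1" unfolding C_def using r(1) mob_in_disc[OF deckD(1)[OF pq1(1)]] by auto
  define K where "K = (\<lambda>z. (z, F z)) ` C"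
  have "continuous_on C F"
    using continuous_on_subset[OF holomorphic_on_imp_continuous_on[OF disc_map_holo[OF Fd]] Cs] .
  then have "compact K" unfolding K_def by (intro compact_continuous_image C continuous_intros)
  moreover have "K \<subseteq> graph F" using Cs by (auto simp: K_def graph_def)
  moreover have "graph F \<subseteq> (\<Union>g\<in>G. g ` K)"
  proof
    fix x assume "x \<in> graph F"
    then obtain z where x: "x = (z, F z)" and z: "cmod z < 1" by (auto simp: graph_def)
    have "\<exists>p q. deck p q \<and> chi p q \<and> mob p z \<in> C"
    proof -
      obtain p q where pq: "deck p q" "mob p z \<in> cball 0 r" using move[OF z] by blast
      show ?thesis
      proof (cases "chi p q")
        case True
        moreover have "mob p z \<in> C" using pq(2) unfolding C_def by blast
        ultimately show ?thesis using pq(1) by blast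
      next
        case False
        then have "\<not> chi p1 q1" using pq pq1(2) by blast
        then have "chi (mmul p1 p) (mmul q1 q)" using chi_mmul[OF pq1(1) pq(1)] False by simp
        moreover have "mob (mmul p1 p) z \<in> C"
          using mob_mmul[OF deckD(1)[OF pq1(1)] deckD(1)[OF pq(1)] z] pq(2) by (auto simp: C_def)
        ultimately show ?thesis using deck_mmul[OF pq1(1) pq(1)] by blast
      qed
    qed
    then obtain p q where pq: "deck p q" "chi p q" "mob p z \<in> C" by blast
    have "(mob p z, F (mob p z)) \<in> K" using pq(3) by (auto simp: K_def)
    then have k: "prod_aut p q x \<in> K" unfolding x deck_graph[OF pq(1) z] .
    have xb: "x \<in> bidisc" using x z F_norm by (auto simp: bidisc_def)
    have "x = prod_aut (minv p) (minv q) (prod_aut p q x)"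
      using prod_aut_inverse(1)[OF deckD(1)[OF pq(1)] Lsu[OF deckD(2)[OF pq(1)]] xb] by simp
    moreover have "prod_aut (minv p) (minv q) \<in> G"
      using deck_minv[OF pq(1)] chi_minv[OF pq(1)] pq(2) G_memI by blast
    ultimately show "x \<in> (\<Union>g\<in>G. g ` K)" using k by blast
  qed
  ultimately show "\<exists>K. compact K \<and> K \<subseteq> graph F \<and> graph F \<subseteq> (\<Union>g\<in>G. g ` K)" by blast
qed

text \<open>At a point over \<open>A\<close> the first derivative vanishes, so
  \<open>tension\<close> reduces to the second derivative, which is
  \<open>2 * (deriv g z)^2\<close>.\<close>

lemma F_not_totally_geodesic:
  assumes "A0 \<noteq> {}" shows "\<not> totally_geodesic (graph F)"
proof -
  obtain a where a: "a \<in> A" "cmod a < 1" using assms A0_subset A_disc by fastforce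
  obtain z where z: "cmod z < 1" "F z = a" using F_surj[OF a(2)] by blast
  obtain g where g: "g holomorphic_on ball 0 1" "\<And>u. cmod u < 1 \<Longrightarrow> F u - a = (g u)\<^sup>2"
    using F_ram a unfolding ramified_def has_sqrt_def by blast
  have gz: "g z = 0" using g(2)[OF z(1)] z(2) by simp
  have g1: "deriv g z \<noteq> 0" using F_sqrt_deriv_nonzero[OF z(1) _ g(1)] g(2) z(2) a(1) by simp
  have gd: "(g has_field_derivative deriv g u) (at u)" if "cmod u < 1" for u
    using holomorphic_derivI[OF g(1) open_ball] that by simp
  have dF: "deriv F u = 2 * g u * deriv g u" if u: "cmod u < 1" for u
  proof -
    have "deriv F u = deriv (\<lambda>u. (g u)\<^sup>2 + a) u"
      by (rule deriv_cong_disc[OF _ u]) (use g(2) in \<open>metis diff_add_cancel\<close>)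
    also have "\<dots> = 2 * g u * deriv g u"
      by (rule DERIV_imp_deriv) (use gd[OF u] in \<open>auto intro!: derivative_eq_intros\<close>)
    finally show ?thesis .
  qed
  have "deriv g holomorphic_on ball 0 1" by (rule holomorphic_deriv[OF g(1) open_ball])
  then have g2: "(deriv g has_field_derivative deriv (deriv g) z) (at z)"
    using holomorphic_derivI[OF _ open_ball] z by simp
  have "deriv (deriv F) z = deriv (\<lambda>u. 2 * g u * deriv g u) z" by (rule deriv_cong_disc[OF dF z(1)])
  also have "\<dots> = 2 * deriv g z * deriv g z + deriv (deriv g) z * (2 * g z)"
    by (rule DERIV_imp_deriv[OF DERIV_mult[OF DERIV_cmult[OF gd[OF z(1)]] g2]])
  finally have "tension F z \<noteq> 0" using gz g1 dF[OF z(1)] by (simp add: tension_def)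
  then show ?thesis using graph_not_totally_geodesic[OF Fd z(1)] by blast
qed

end

section \<open>Fine branch sets\<close>

lemma Lam_orbit_finite:
  assumes "finite A0" "A0 \<subseteq> ball 0 1" "r < 1"
  shows "finite ((\<Union>q\<in>Lam. mob q ` A0) \<inter> cball 0 r)"
proof -
  define \<rho> where "\<rho> = Max (insert r (cmod ` A0))"
  have \<rho>: "\<rho> < 1" "r \<le> \<rho>" "\<And>a. a \<in> A0 \<Longrightarrow> cmod a \<le> \<rho>" using assms by (auto simp: \<rho>_def)
  let ?L = "{q\<in>Lam. \<exists>z. cmod z \<le> \<rho> \<and> cmod (mob q z) \<le> \<rho>}"
  have "(\<Union>q\<in>Lam. mob q ` A0) \<inter> cball 0 r \<subseteq> (\<Union>q\<in>?L. mob q ` A0)"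
  proof
    fix x assume "x \<in> (\<Union>q\<in>Lam. mob q ` A0) \<inter> cball 0 r"
    then obtain q a where qa: "q \<in> Lam" "a \<in> A0" "x = mob q a" "cmod x \<le> r" by auto
    have "cmod (mob q a) \<le> \<rho>" using qa(3,4) \<rho>(2) by simp
    then have "q \<in> ?L" using qa(1) \<rho>(3)[OF qa(2)] by blast
    then show "x \<in> (\<Union>q\<in>?L. mob q ` A0)" using qa(2,3) by blast
  qed
  moreover have "finite (\<Union>q\<in>?L. mob q ` A0)" using Lam_discrete[OF \<rho>(1)] assms(1) by blast
  ultimately show ?thesis by (rule finite_subset)
qed

text \<open>Supplies the base value of \<open>F\<close> and the spare point that corrects the parity
  of \<open>A0\<close>.\<close>

lemma Lam_orbit_avoid:
  assumes "finite A0" "A0 \<subseteq> ball 0 1"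
  shows "\<exists>b. cmod b < 1 \<and> b \<notin> (\<Union>q\<in>Lam. mob q ` A0)"
proof (rule ccontr)
  assume "\<not> ?thesis"
  then have "cball 0 (1/2) \<subseteq> (\<Union>q\<in>Lam. mob q ` A0) \<inter> cball 0 (1/2)" by (intro subsetI IntI) auto
  from finite_subset[OF this Lam_orbit_finite[OF assms]] have "finite (cball (0::complex) (1/2))" by simp
  then show False using uncountable_cball[of "1/2" "0::complex"] uncountable_infinite by force
qed

text \<open>A finite net of a closed disc that every orbit meets is thinned to one point per orbit;
  its translates are fine everywhere by invariance of the pseudo-hyperbolic distance. A point of a
  new orbit is added if the number is odd.\<close>

lemma dense_orbit_transversal:
  assumes \<eta>: "\<eta> > 0"
  shows "\<exists>A0. finite A0 \<and> even (card A0) \<and> A0 \<noteq> {} \<and> A0 \<subseteq> ball 0 1 \<and>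
     (\<forall>a\<in>A0. \<forall>a'\<in>A0. \<forall>q\<in>Lam. mob q a = a' \<longrightarrow> a = a') \<and> dense_in_disc \<eta> (\<Union>q\<in>Lam. mob q ` A0)"
proof -
  have su: "q \<in> su11" if "q \<in> Lam" for q using Lam_su11 that by blast
  obtain r where r: "r < 1" "\<And>z. cmod z < 1 \<Longrightarrow> \<exists>q\<in>Lam. cmod (mob q z) \<le> r" using Lam_cocompact by blast
  \<comment> \<open>On the disc of radius \<open>r\<close> the factor \<open>|1 - cnj y * x|\<close>
    is at least \<open>1 - r\<close>, so this Euclidean mesh gives pseudo-hyperbolic mesh
    \<open>\<eta>\<close>.\<close>
  define e where "e = \<eta> * (1 - r)"
  have e: "e > 0" using \<eta> r(1) by (simp add: e_def)
  obtain E where E: "finite E" "E \<subseteq> cball (0::complex) r" "cball 0 r \<subseteq> (\<Union>x\<in>E. ball x e)"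
    using compactE_image[OF compact_cball[of "0::complex" r], of "cball 0 r" "\<lambda>x. ball x e"] e by (metis UN_I centre_in_ball open_ball subsetI)
  have E1: "cmod x < 1" if "x \<in> E" for x using E(2) r(1) that by fastforce
  define eqv where "eqv x y \<longleftrightarrow> (\<exists>q\<in>Lam. mob q x = y)" for x y
  have refl: "eqv x x" for x unfolding eqv_def using Lam_one by (intro bexI[of _ "(1,0)"]) auto
  have sym: "eqv y x" if "eqv x y" "cmod x < 1" for x y
    using that mob_minv(1)[OF su] Lam_minv unfolding eqv_def by blast
  have trans: "eqv x z" if "eqv x y" "eqv y z" "cmod x < 1" for x y z
    using that mob_mmul[OF su su] Lam_mmul unfolding eqv_def by metis
  \<comment> \<open>The choice is made by a predicate that depends only on the orbit of
    \<open>x\<close>, so equivalent points get the same representative.\<close>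
  define rep where "rep x = (SOME y. y \<in> E \<and> eqv x y)" for x
  have rep: "rep x \<in> E" "eqv x (rep x)" if "x \<in> E" for x
    using someI[of "\<lambda>y. y \<in> E \<and> eqv x y" x] refl that unfolding rep_def by auto
  have rep_eq: "rep x = rep y" if "x \<in> E" "y \<in> E" "eqv x y" for x y
  proof -
    have "eqv x z \<longleftrightarrow> eqv y z" for z using that sym[OF that(3)] trans E1 by blast
    then show ?thesis unfolding rep_def by simp
  qed
  define B where "B = rep ` E"
  have B: "finite B" "B \<subseteq> E" using E(1) rep(1) by (auto simp: B_def)
  have B1: "B \<subseteq> ball 0 1" using B(2) E1 by auto
  have Bineq: "a = a'" if a: "a \<in> B" "a' \<in> B" "eqv a a'" for a a'
  proof -
    obtain x x' where x: "x \<in> E" "a = rep x" "x' \<in> E" "a' = rep x'" using a by (auto simp: B_def)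
    have "eqv x a" "eqv x' a'" using rep(2) x by auto
    then have "eqv x x'" using trans[OF trans[OF \<open>eqv x a\<close> a(3)] sym[OF \<open>eqv x' a'\<close>]] E1 x by blast
    then show ?thesis using rep_eq x by simp
  qed
  have Borb: "\<exists>q\<in>Lam. \<exists>b\<in>B. mob q b = x" if x: "x \<in> E" for x
    using sym[OF rep(2)[OF x] E1[OF x]] x unfolding eqv_def B_def by blast
  obtain c where c: "cmod c < 1" "c \<notin> (\<Union>q\<in>Lam. mob q ` B)" using Lam_orbit_avoid[OF B(1) B1] by blast
  have cB: "c \<notin> B" using c(2) Lam_one by (metis UN_I image_eqI mob_one)
  define A0 where "A0 = (if even (card B) then B else insert c B)"
  have A0: "finite A0" "even (card A0)" "A0 \<subseteq> ball 0 1" "B \<subseteq> A0" "A0 \<subseteq> insert c B"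
    using B(1) B1 c cB by (auto simp: A0_def)
  have "dense_in_disc \<eta> (\<Union>q\<in>Lam. mob q ` A0)"
    unfolding dense_in_disc_def
  proof (intro allI impI)
    fix z :: complex assume z: "cmod z < 1"
    obtain q where q: "q \<in> Lam" "cmod (mob q z) \<le> r" using r(2)[OF z] by blast
    let ?y = "mob q z"
    obtain x where x: "x \<in> E" "dist x ?y < e" using E(3) q(2) by auto
    have y1: "cmod ?y < 1" using q(2) r(1) by simp
    have "0 \<le> r" using q(2) norm_ge_zero order.trans by blast
    then have "cmod (cnj ?y * x) \<le> r * 1"
      unfolding norm_mult complex_mod_cnj using q(2) E1[OF x(1)] by (intro mult_mono) auto
    then have "1 - r \<le> cmod (1 - cnj ?y * x)" using norm_triangle_ineq2[of 1 "cnj ?y * x"] by simp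
    then have "e \<le> \<eta> * cmod (1 - cnj ?y * x)" unfolding e_def using \<eta> by (intro mult_left_mono) auto
    then have "cmod (x - ?y) < \<eta> * cmod (1 - cnj ?y * x)" using x(2) by (simp add: dist_norm)
    from pseudo_dist_mob[OF minv_su11[OF su[OF q(1)]] y1 E1[OF x(1)] this]
    have d: "cmod (mob (minv q) x - z) < \<eta> * cmod (1 - cnj z * mob (minv q) x)"
      using mob_minv(1)[OF su[OF q(1)] z] by simp
    obtain l b where l: "l \<in> Lam" "b \<in> B" "mob l b = x" using Borb[OF x(1)] by blast
    have b1: "cmod b < 1" using l(2) B1 by auto
    have "mob (minv q) x = mob (mmul (minv q) l) b"
      using mob_mmul[OF minv_su11[OF su[OF q(1)]] su[OF l(1)] b1] l(3) by simp
    moreover have "mmul (minv q) l \<in> Lam" using Lam_mmul[OF Lam_minv[OF q(1)] l(1)] .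
    ultimately have "mob (minv q) x \<in> (\<Union>q\<in>Lam. mob q ` A0)" using l(2) A0(4) by blast
    then show "\<exists>a\<in>\<Union>q\<in>Lam. mob q ` A0. cmod (a - z) < \<eta> * cmod (1 - cnj z * a)" using d by blast
  qed
  moreover from this have "A0 \<noteq> {}" unfolding dense_in_disc_def by (auto dest: spec[of _ 0])
  moreover have "a = a'" if a: "a \<in> A0" "a' \<in> A0" "q \<in> Lam" "mob q a = a'" for a a' q
  proof -
    have ev: "eqv a a'" using a unfolding eqv_def by blast
    have a1: "cmod a < 1" using a A0(3) by auto
    consider "a \<in> B" "a' \<in> B" | "a = c" "a' = c" | "a \<in> B" "a' = c" | "a = c" "a' \<in> B"
      using a A0(5) by blast
    then show ?thesis
    proof cases
      case 1 then show ?thesis using Bineq ev by blast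
    next
      case 3 then show ?thesis using c(2) a by blast
    next
      case 4
      then have "eqv a' c" using sym[OF ev a1] by simp
      then show ?thesis using c(2) 4 unfolding eqv_def by blast
    qed simp
  qed
  ultimately show ?thesis using A0(1-3) by (intro exI[of _ A0]) blast
qed

theorem theorem1:
  fixes \<epsilon> \<delta> :: real
  assumes "\<epsilon> > 0" and "\<delta> > 0"
  shows "\<exists>G St. aut_group G \<and> discrete_aut_group G \<and> torsion_free G \<and>
           compact_curve_lift G St \<and> eps_geodesic \<epsilon> St \<and> modeled_on_disc \<delta> St \<and>
           \<not> totally_geodesic St"
proof -
  \<comment> \<open>With radius \<open>4/5\<close> and bound \<open>\<kappa> / 4\<close> the Cauchy
    estimate gives \<open>2 * (\<kappa> / 4) / (4/5)^2 = 25 * \<kappa> / 32 \<le>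
    \<epsilon>\<close>; the other two terms of the minimum are the conditions of
    \<open>graph_modeled\<close>.\<close>
  define \<kappa> where "\<kappa> = min (1/2) (min (\<delta> / 2) \<epsilon>)"
  have \<kappa>: "0 < \<kappa>" "\<kappa> \<le> 1/2" "\<kappa> \<le> \<delta> / 2" "\<kappa> \<le> \<epsilon>" using assms by (auto simp: \<kappa>_def)
  obtain \<eta> where \<eta>: "\<eta> > 0" "\<And>A f z u. A \<subseteq> ball 0 1 \<Longrightarrow> dense_in_disc \<eta> A \<Longrightarrow> ramified A f \<Longrightarrow> cmod z < 1 \<Longrightarrow>
           cmod u \<le> 4/5 \<Longrightarrow> cmod (recenter f z u) \<le> \<kappa> / 4"
    using ramified_recenter_small[of "4/5" "\<kappa> / 4"] \<kappa>(1) by auto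
  obtain A0 where A0: "finite A0" "even (card A0)" "A0 \<noteq> {}" "A0 \<subseteq> ball 0 1"
     "\<And>a a' q. a \<in> A0 \<Longrightarrow> a' \<in> A0 \<Longrightarrow> q \<in> Lam \<Longrightarrow> mob q a = a' \<Longrightarrow> a = a'"
     "dense_in_disc \<eta> (\<Union>q\<in>Lam. mob q ` A0)"
    using dense_orbit_transversal[OF \<eta>(1)] by blast
  define A where "A = (\<Union>q\<in>Lam. mob q ` A0)"
  have Ad: "A \<subseteq> ball 0 1"
  proof
    fix x assume "x \<in> A"
    then obtain q a where "q \<in> Lam" "a \<in> A0" "x = mob q a" by (auto simp: A_def)
    moreover from this have "q \<in> su11" "cmod a < 1" using Lam_su11 A0(4) by auto
    ultimately show "x \<in> ball 0 1" using mob_in_disc[of q a] by simp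
  qed
  have disc: "\<exists>e>0. ball z e \<inter> A \<subseteq> {z}" if z: "cmod z < 1" for z
  proof -
    define r where "r = (1 + cmod z) / 2"
    have r: "cmod z < r" "r < 1" using z by (auto simp: r_def)
    have "finite (A \<inter> cball 0 r)" unfolding A_def by (rule Lam_orbit_finite[OF A0(1,4) r(2)])
    from finite_set_avoid[OF this, of z]
    obtain d where d: "d > 0" "\<And>x. x \<in> A \<inter> cball 0 r \<Longrightarrow> x \<noteq> z \<Longrightarrow> d \<le> dist z x" by blast
    have "ball z (min d (r - cmod z)) \<inter> A \<subseteq> {z}"
    proof
      fix x assume x: "x \<in> ball z (min d (r - cmod z)) \<inter> A"
      then have "cmod (x - z) < r - cmod z" "dist z x < d" by (auto simp: dist_norm norm_minus_commute)
      moreover from this have "cmod x \<le> r" using norm_triangle_ineq[of z "x - z"] by simp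
      ultimately show "x \<in> {z}" using d(2)[of x] x by force
    qed
    then show ?thesis using d(1) r(1) by (intro exI[of _ "min d (r - cmod z)"]) auto
  qed
  obtain b where b: "cmod b < 1" "b \<notin> A" using Lam_orbit_avoid[OF A0(1,4)] unfolding A_def by blast
  obtain e where e: "e > 0" "ball b e \<inter> A \<subseteq> {b}" using disc[OF b(1)] by blast
  then have "ball b e \<inter> A = {}" using b(2) by blast
  from universal_ramified_map[OF b(1) e(1) this]
  obtain F where F: "ramified A F" "F 0 = b" "deriv F 0 \<noteq> 0"
    "\<And>f. ramified A f \<Longrightarrow> f 0 = b \<Longrightarrow> factors_through F f" by blast
  interpret equivariant_cover A F A0
    by unfold_locales (use Ad disc F b A0 in \<open>auto simp: A_def\<close>)
  have sm: "cmod (recenter F z u) \<le> \<kappa> / 4" if "cmod z < 1" "cmod u \<le> 4/5" for z u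
    using \<eta>(2)[OF Ad _ F(1) that] A0(6) by (simp add: A_def)
  have "eps_geodesic \<epsilon> (graph F)"
    by (rule graph_eps_geodesic[OF Fd, of "4/5" "\<kappa> / 4"])
       (use sm \<kappa> in \<open>auto simp: power2_eq_square\<close>)
  moreover have "modeled_on_disc \<delta> (graph F)"
    by (rule graph_modeled[OF Fd \<kappa>(1-3) sm])
  ultimately show ?thesis
    using G_aut_group G_discrete G_torsion_free G_compact_curve_lift F_not_totally_geodesic[OF A0(3)] by blast
qed

end
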